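(* Let $K\in C^{\infty}(E_{*})$ be a strictly positive function which is constant on each fibre of $E$ (i.e. on each $E_x\setminus\{0\}$, $x\in M$). Then there exists a radial graph $\mathcal{Y}$ on $\Sigma$ whose vertical Gaussian curvature is given by $K$. Moreover, if $K$ is constant, then $\mathcal{Y}$ may be chosen convex; and if $K$ is non-constant, then every radial graph on $\Sigma$ whose vertical Gaussian curvature is given by $K$ is non-convex.
   Context: Setting: $(M,g)$ is a compact Riemannian manifold without boundary of dimension $n\ge 1$, with Levi-Civita connection $\nabla$; $(E,\tilde g)$ is a Riemannian vector bundle on $M$ of rank $m\ge 2$ with projection $\pi$ and a $\tilde g$-metric connection $\tilde\nabla$; $E_*$ is $E$ with the zero section removed; $\|\xi\|$ is the $\tilde g$-norm; $\Sigma=\{\xi\in E:\|\xi\|=1\}$ is the unit sphere bundle. Metric and connection on $E$: over a chart of $M$ with coordinates $(x^i)_{1\le i\le n}$ and a local frame $(s_\alpha)_{n+1\le\alpha\le n+m}$ of $E$ with fibre coordinates $(y^\alpha)$, write $\nabla_{\partial_i}\partial_j=\Gamma^k_{ij}\partial_k$ and $\tilde\nabla_{\partial_i}s_\alpha=\Gamma^\beta_{i\alpha}s_\beta$. Let $e_i=\partial/\partial x^i-y^\alpha\Gamma^\beta_{i\alpha}\,\partial/\partial y^\beta$ (horizontal lift) and $e_\alpha=\partial/\partial y^\alpha$ (vertical). The metric $G$ on $E$ is given by $G(e_i,e_j)=g(\partial_i,\partial_j)$, $G(e_\alpha,e_\beta)=\tilde g(s_\alpha,s_\beta)$, $G(e_i,e_\alpha)=0$.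 The Sasaki connection $D$ on $E$ (which is $G$-metric, in general with torsion) is given by $D_{e_i}e_j=\Gamma^k_{ij}e_k$, $D_{e_i}e_\alpha=\Gamma^\beta_{i\alpha}e_\beta$, $D_{e_\alpha}e_i=D_{e_\alpha}e_\beta=0$. Radial graph: a radial graph on $\Sigma$ is a hypersurface $\mathcal{Y}$ of $E_*$ that is the image of a map $\xi\in\Sigma\mapsto e^{u(\xi)}\xi$ with $u\in C^\infty(\Sigma)$. Vertical Gaussian curvature: for a hypersurface $\mathcal{Y}$ of $E$ such that each $\mathcal{Y}_x=\mathcal{Y}\cap E_x$ is a hypersurface of the Euclidean space $(E_x,\tilde g_x)$, the vertical Gaussian curvature at $\xi\in\mathcal{Y}\cap E_x$ is the Gaussian curvature (product of principal curvatures) of $\mathcal{Y}_x$ at $\xi$ as a hypersurface of $E_x$, with the sign convention making the sphere of radius $r$ have curvature $r^{-(m-1)}$. It is "given by $K$" if it equals $K(\xi)$ at every $\xi\in\mathcal{Y}$. Convexity: a radial graph $\mathcal{Y}$ is convex if its second fundamental form in $(E,G,D)$, namely $II(X,Y)=-G(D_XY,\tilde\nu)$ for $X,Y$ tangent to $\mathcal{Y}$ and $\tilde\nu$ the outward $G$-unit normal, is positive in the sense $II(X,X)\ge 0$ for all tangent $X$.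
   Formalization: In the last clause (K non-constant implies every such radial graph is non-convex) M is assumed connected; for disconnected M it fails when K is locally constant but non-constant, as the fibrewise spheres are then convex. *)

theory Defs
  imports "HOL-Analysis.Analysis"
begin

primrec Ck_on :: "nat \<Rightarrow> ('a::euclidean_space \<Rightarrow> 'b::real_normed_vector) \<Rightarrow> 'a set \<Rightarrow> bool" where
  "Ck_on 0 f W \<longleftrightarrow> continuous_on W f"
| "Ck_on (Suc k) f W \<longleftrightarrow> (\<forall>x\<in>W. f differentiable (at x)) \<and>
      (\<forall>v. Ck_on k (\<lambda>x. frechet_derivative f (at x) v) W)"

text \<open>Smoothness on an arbitrary subset: locally the restriction of a smooth map defined on an open
  set. For open sets this is ordinary smoothness, for embedded submanifolds the usual notion.\<close>

definition smooth_on :: "'a::euclidean_space set \<Rightarrow> ('a \<Rightarrow> 'b::real_normed_vector) \<Rightarrow> bool" where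
  "smooth_on S f \<longleftrightarrow> (\<forall>z\<in>S. \<exists>W F. open W \<and> z \<in> W \<and> (\<forall>k. Ck_on k F W) \<and> (\<forall>w\<in>W \<inter> S. F w = f w))"

definition tangent_space :: "'a::euclidean_space set \<Rightarrow> 'a \<Rightarrow> 'a set" where
  "tangent_space S p = {v. \<exists>\<gamma> \<epsilon>. 0 < (\<epsilon>::real) \<and> smooth_on {-\<epsilon><..<\<epsilon>} \<gamma> \<and> \<gamma> ` {-\<epsilon><..<\<epsilon>} \<subseteq> S \<and>
      \<gamma> 0 = p \<and> (\<gamma> has_vector_derivative v) (at 0)}"

definition hypersurface :: "'a::euclidean_space set \<Rightarrow> bool" where
  "hypersurface S \<longleftrightarrow> (\<forall>p\<in>S. \<exists>W (F :: 'a \<Rightarrow> real). open W \<and> p \<in> W \<and> smooth_on W F \<and>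
      S \<inter> W = {q \<in> W. F q = 0} \<and> frechet_derivative F (at p) \<noteq> (\<lambda>_. 0))"

text \<open>Gaussian curvature at \<open>p\<close>, as the product of the principal curvatures, of a hypersurface \<open>S\<close> of a
  vector space with (constant) inner product \<open>ip\<close>. Here \<open>N\<close> is a unit normal field pointing away from
  the origin (so \<open>S\<close> is meant to be transverse to the radial direction), and \<open>B\<close> is an orthonormal
  basis of principal directions, i.e. of eigenvectors of the shape operator \<open>dN\<close>, with principal
  curvatures \<open>k\<close>. A sphere of radius \<open>r\<close> about the origin has all principal curvatures \<open>1 / r\<close>.\<close>

definition has_gauss_curvature ::
  "('v::euclidean_space \<Rightarrow> 'v \<Rightarrow> real) \<Rightarrow> 'v set \<Rightarrow> 'v \<Rightarrow> real \<Rightarrow> bool" where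
  "has_gauss_curvature ip S p \<kappa> \<longleftrightarrow> (\<exists>W N B k.
      open W \<and> p \<in> W \<and> smooth_on W N \<and>
      (\<forall>q\<in>S \<inter> W. ip (N q) (N q) = 1 \<and> (\<forall>v\<in>tangent_space S q. ip (N q) v = 0) \<and> ip (N q) q > 0) \<and>
      span B = tangent_space S p \<and> (\<forall>v\<in>B. \<forall>w\<in>B. ip v w = (if v = w then 1 else 0)) \<and>
      (\<forall>v\<in>B. frechet_derivative N (at p) v = k v *\<^sub>R v) \<and>
      \<kappa> = (\<Prod>v\<in>B. k v))"

text \<open>A chart is its domain together with its coordinate map.\<close>

type_synonym ('a, 'n) chart = "'a set \<times> ('a \<Rightarrow> real^'n)"

abbreviation chart_inv :: "('a, 'n::finite) chart \<Rightarrow> real^'n \<Rightarrow> 'a" where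
  "chart_inv c \<equiv> inv_into (fst c) (snd c)"

definition smooth_manifold :: "'a topology \<Rightarrow> ('a, 'n::finite) chart set \<Rightarrow> bool" where
  "smooth_manifold X \<A> \<longleftrightarrow> Hausdorff_space X \<and> second_countable X \<and> topspace X = \<Union>(fst ` \<A>) \<and>
     (\<forall>(U, \<phi>)\<in>\<A>. openin X U \<and> open (\<phi> ` U) \<and>
        homeomorphic_map (subtopology X U) (top_of_set (\<phi> ` U)) \<phi>) \<and>
     (\<forall>c\<in>\<A>. \<forall>c'\<in>\<A>. smooth_on (snd c ` (fst c \<inter> fst c')) (snd c' \<circ> chart_inv c))"

definition smooth_fun :: "('a, 'n::finite) chart set \<Rightarrow> 'a set \<Rightarrow> ('a \<Rightarrow> 'b::real_normed_vector) \<Rightarrow> bool" where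
  "smooth_fun \<A> W f \<longleftrightarrow> (\<forall>c\<in>\<A>. smooth_on (snd c ` (fst c \<inter> W)) (f \<circ> chart_inv c))"

definition pderiv_chart ::
  "('a, 'n::finite) chart \<Rightarrow> 'n \<Rightarrow> ('a \<Rightarrow> 'b::real_normed_vector) \<Rightarrow> 'a \<Rightarrow> 'b" where
  "pderiv_chart c i f x = frechet_derivative (f \<circ> chart_inv c) (at (snd c x)) (axis i 1)"

definition chart_jacobian :: "('a, 'n::finite) chart \<Rightarrow> ('a, 'n) chart \<Rightarrow> 'a \<Rightarrow> real^'n^'n" where
  "chart_jacobian c c' x = jacobian (snd c' \<circ> chart_inv c) (at (snd c x))"

text \<open>Tensors and connections are given by their components: \<open>g c x\<close> is the matrix of
  \<open>g\<^sub>i\<^sub>j = g(\<partial>\<^sub>i, \<partial>\<^sub>j)\<close> at \<open>x\<close> in the chart \<open>c\<close>, subject to the transformation rule of a covariant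
  2-tensor.\<close>

type_synonym ('a, 'n) tensor2 = "('a, 'n) chart \<Rightarrow> 'a \<Rightarrow> real^'n^'n"

definition riemannian_metric :: "('a, 'n::finite) chart set \<Rightarrow> ('a, 'n) tensor2 \<Rightarrow> bool" where
  "riemannian_metric \<A> g \<longleftrightarrow>
     (\<forall>c\<in>\<A>. smooth_fun \<A> (fst c) (g c) \<and>
        (\<forall>x\<in>fst c. transpose (g c x) = g c x \<and> (\<forall>a. a \<noteq> 0 \<longrightarrow> a \<bullet> (g c x *v a) > 0))) \<and>
     (\<forall>c\<in>\<A>. \<forall>c'\<in>\<A>. \<forall>x\<in>fst c \<inter> fst c'.
        g c x = transpose (chart_jacobian c c' x) ** g c' x ** chart_jacobian c c' x)"

text \<open>The entry \<open>\<Gamma> c x i $ k $ j\<close> is the Christoffel symbol \<open>\<Gamma>\<^sup>k\<^sub>i\<^sub>j\<close>, i.e. \<open>\<nabla>\<^sub>\<partial>\<^sub>i \<partial>\<^sub>j = \<Gamma>\<^sup>k\<^sub>i\<^sub>j \<partial>\<^sub>k\<close>.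
  The Levi-Civita connection is the torsion-free connection (\<open>\<Gamma>\<^sup>k\<^sub>i\<^sub>j = \<Gamma>\<^sup>k\<^sub>j\<^sub>i\<close>) that is metric
  (\<open>\<partial>\<^sub>i g\<^sub>j\<^sub>l = \<Gamma>\<^sup>k\<^sub>i\<^sub>j g\<^sub>k\<^sub>l + \<Gamma>\<^sup>k\<^sub>i\<^sub>l g\<^sub>j\<^sub>k\<close>). These two conditions determine \<open>\<Gamma>\<close> on the chart domains, hence
  imply smoothness and the transformation rule of a connection.\<close>

type_synonym ('a, 'n) christoffel = "('a, 'n) chart \<Rightarrow> 'a \<Rightarrow> 'n \<Rightarrow> real^'n^'n"

definition levi_civita ::
  "('a, 'n::finite) chart set \<Rightarrow> ('a, 'n) tensor2 \<Rightarrow> ('a, 'n) christoffel \<Rightarrow> bool" where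
  "levi_civita \<A> g \<Gamma> \<longleftrightarrow> (\<forall>c\<in>\<A>. \<forall>x\<in>fst c.
      (\<forall>i j k. \<Gamma> c x i $ k $ j = \<Gamma> c x j $ k $ i) \<and>
      (\<forall>i. pderiv_chart c i (g c) x = transpose (\<Gamma> c x i) ** g c x + g c x ** \<Gamma> c x i))"

text \<open>A local trivialisation is its domain in the base together with the fibre coordinates \<open>\<Phi>\<close> on
  the total space over that domain.\<close>

type_synonym ('a, 'e, 'm) triv = "'a set \<times> ('e \<Rightarrow> real^'m)"

record ('a, 'e, 'm::finite) vbundle =
  total :: "'e set"
  proj :: "'e \<Rightarrow> 'a"
  vzero :: "'a \<Rightarrow> 'e"
  vplus :: "'e \<Rightarrow> 'e \<Rightarrow> 'e"
  vscale :: "real \<Rightarrow> 'e \<Rightarrow> 'e"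
  trivs :: "('a, 'e, 'm) triv set"

definition fibre :: "('a, 'e, 'm::finite) vbundle \<Rightarrow> 'a \<Rightarrow> 'e set" where
  "fibre E x = {\<xi> \<in> total E. proj E \<xi> = x}"

text \<open>The element \<open>y\<^sup>\<alpha> s\<^sub>\<alpha>(x)\<close>, where \<open>(s\<^sub>\<alpha>)\<close> is the local frame dual to the fibre coordinates.\<close>

definition from_frame ::
  "('a, 'e, 'm::finite) vbundle \<Rightarrow> ('a, 'e, 'm) triv \<Rightarrow> 'a \<Rightarrow> real^'m \<Rightarrow> 'e" where
  "from_frame E t x y = inv_into (fibre E x) (snd t) y"

text \<open>The vector space axioms on the fibres follow from the fact that the trivialisations are
  bijective and compatible with the operations. Smoothness of the transition functions for each
  fixed \<open>y\<close> is smoothness of the transition matrices.\<close>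

definition vector_bundle ::
  "'a topology \<Rightarrow> ('a, 'n::finite) chart set \<Rightarrow> ('a, 'e, 'm::finite) vbundle \<Rightarrow> bool" where
  "vector_bundle X \<A> E \<longleftrightarrow>
     proj E ` total E \<subseteq> topspace X \<and>
     (\<forall>x\<in>topspace X. vzero E x \<in> fibre E x \<and>
        (\<forall>\<xi>\<in>fibre E x. (\<forall>\<eta>\<in>fibre E x. vplus E \<xi> \<eta> \<in> fibre E x) \<and> (\<forall>r. vscale E r \<xi> \<in> fibre E x))) \<and>
     topspace X = \<Union>(fst ` trivs E) \<and>
     (\<forall>(V, \<Phi>)\<in>trivs E. openin X V \<and>
        (\<forall>x\<in>V. bij_betw \<Phi> (fibre E x) UNIV \<and> \<Phi> (vzero E x) = 0 \<and>
           (\<forall>\<xi>\<in>fibre E x. (\<forall>\<eta>\<in>fibre E x. \<Phi> (vplus E \<xi> \<eta>) = \<Phi> \<xi> + \<Phi> \<eta>) \<and>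
                            (\<forall>r. \<Phi> (vscale E r \<xi>) = r *\<^sub>R \<Phi> \<xi>)))) \<and>
     (\<forall>t\<in>trivs E. \<forall>t'\<in>trivs E. \<forall>y.
        smooth_fun \<A> (fst t \<inter> fst t') (\<lambda>x. snd t' (from_frame E t x y)))"

definition transition_matrix ::
  "('a, 'e, 'm::finite) vbundle \<Rightarrow> ('a, 'e, 'm) triv \<Rightarrow> ('a, 'e, 'm) triv \<Rightarrow> 'a \<Rightarrow> real^'m^'m" where
  "transition_matrix E t t' x = matrix (\<lambda>y. snd t' (from_frame E t x y))"

definition punctured :: "('a, 'e, 'm::finite) vbundle \<Rightarrow> 'e set" where
  "punctured E = {\<xi> \<in> total E. \<xi> \<noteq> vzero E (proj E \<xi>)}"

definition fibre_gram ::
  "('a, 'e, 'm::finite) vbundle \<Rightarrow> ('e \<Rightarrow> 'e \<Rightarrow> real) \<Rightarrow> ('a, 'e, 'm) triv \<Rightarrow> 'a \<Rightarrow> real^'m^'m" where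
  "fibre_gram E h t x =
     (\<chi> \<alpha> \<beta>. h (from_frame E t x (axis \<alpha> 1)) (from_frame E t x (axis \<beta> 1)))"

definition fibre_metric ::
  "'a topology \<Rightarrow> ('a, 'n::finite) chart set \<Rightarrow> ('a, 'e, 'm::finite) vbundle \<Rightarrow>
   ('e \<Rightarrow> 'e \<Rightarrow> real) \<Rightarrow> bool" where
  "fibre_metric X \<A> E h \<longleftrightarrow>
     (\<forall>x\<in>topspace X. \<forall>\<xi>\<in>fibre E x.
        (\<xi> \<noteq> vzero E x \<longrightarrow> h \<xi> \<xi> > 0) \<and>
        (\<forall>\<eta>\<in>fibre E x. h \<xi> \<eta> = h \<eta> \<xi> \<and> (\<forall>r. h (vscale E r \<xi>) \<eta> = r * h \<xi> \<eta>) \<and>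
           (\<forall>\<zeta>\<in>fibre E x. h (vplus E \<xi> \<eta>) \<zeta> = h \<xi> \<zeta> + h \<eta> \<zeta>))) \<and>
     (\<forall>t\<in>trivs E. smooth_fun \<A> (fst t) (fibre_gram E h t))"

text \<open>The entry \<open>\<omega> c t x i $ \<beta> $ \<alpha>\<close> is \<open>\<Gamma>\<^sup>\<beta>\<^sub>i\<^sub>\<alpha>\<close>, where \<open>\<nabla>\<^sub>\<partial>\<^sub>i s\<^sub>\<alpha> = \<Gamma>\<^sup>\<beta>\<^sub>i\<^sub>\<alpha> s\<^sub>\<beta>\<close> for the coordinate fields of
  the chart \<open>c\<close> and the frame of the trivialisation \<open>t\<close>. The transformation rule expresses that the
  local formulas \<open>(\<nabla>\<^sub>\<partial>\<^sub>i s)\<^sup>\<beta> = \<partial>\<^sub>i s\<^sup>\<beta> + \<Gamma>\<^sup>\<beta>\<^sub>i\<^sub>\<alpha> s\<^sup>\<alpha>\<close> define one covariant derivative.\<close>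

type_synonym ('a, 'n, 'e, 'm) bundle_christoffel =
  "('a, 'n) chart \<Rightarrow> ('a, 'e, 'm) triv \<Rightarrow> 'a \<Rightarrow> 'n \<Rightarrow> real^'m^'m"

definition bundle_connection ::
  "('a, 'n::finite) chart set \<Rightarrow> ('a, 'e, 'm::finite) vbundle \<Rightarrow>
   ('a, 'n, 'e, 'm) bundle_christoffel \<Rightarrow> bool" where
  "bundle_connection \<A> E \<omega> \<longleftrightarrow>
     (\<forall>c\<in>\<A>. \<forall>t\<in>trivs E. \<forall>i. smooth_fun \<A> (fst c \<inter> fst t) (\<lambda>x. \<omega> c t x i)) \<and>
     (\<forall>c\<in>\<A>. \<forall>c'\<in>\<A>. \<forall>t\<in>trivs E. \<forall>t'\<in>trivs E. \<forall>x\<in>fst c \<inter> fst c' \<inter> fst t \<inter> fst t'. \<forall>i.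
        transition_matrix E t t' x ** \<omega> c t x i =
          pderiv_chart c i (transition_matrix E t t') x +
          (\<Sum>j\<in>UNIV. chart_jacobian c c' x $ j $ i *\<^sub>R \<omega> c' t' x j) ** transition_matrix E t t' x)"

definition metric_connection ::
  "('a, 'n::finite) chart set \<Rightarrow> ('a, 'e, 'm::finite) vbundle \<Rightarrow> ('e \<Rightarrow> 'e \<Rightarrow> real) \<Rightarrow>
   ('a, 'n, 'e, 'm) bundle_christoffel \<Rightarrow> bool" where
  "metric_connection \<A> E h \<omega> \<longleftrightarrow> bundle_connection \<A> E \<omega> \<and>
     (\<forall>c\<in>\<A>. \<forall>t\<in>trivs E. \<forall>x\<in>fst c \<inter> fst t. \<forall>i.
        pderiv_chart c i (fibre_gram E h t) x =
          transpose (\<omega> c t x i) ** fibre_gram E h t x + fibre_gram E h t x ** \<omega> c t x i)"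

text \<open>A chart \<open>c\<close> of the base and a trivialisation \<open>t\<close> induce coordinates \<open>(x\<^sup>i, y\<^sup>\<alpha>)\<close> on the total space.
  Throughout, \<open>E\<close> carries the smooth structure given by these.\<close>

definition edom ::
  "('a, 'e, 'm::finite) vbundle \<Rightarrow> ('a, 'n::finite) chart \<Rightarrow> ('a, 'e, 'm) triv \<Rightarrow> 'e set" where
  "edom E c t = {\<xi> \<in> total E. proj E \<xi> \<in> fst c \<inter> fst t}"

definition ecoord ::
  "('a, 'e, 'm::finite) vbundle \<Rightarrow> ('a, 'n::finite) chart \<Rightarrow> ('a, 'e, 'm) triv \<Rightarrow> 'e \<Rightarrow> (real^'n) \<times> (real^'m)" where
  "ecoord E c t \<xi> = (snd c (proj E \<xi>), snd t \<xi>)"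

abbreviation in_ecoord ::
  "('a, 'e, 'm::finite) vbundle \<Rightarrow> ('a, 'n::finite) chart \<Rightarrow> ('a, 'e, 'm) triv \<Rightarrow> 'e set \<Rightarrow>
   ((real^'n) \<times> (real^'m)) set" where
  "in_ecoord E c t Y \<equiv> ecoord E c t ` (Y \<inter> edom E c t)"

definition smooth_on_total ::
  "('a, 'n::finite) chart set \<Rightarrow> ('a, 'e, 'm::finite) vbundle \<Rightarrow> 'e set \<Rightarrow> ('e \<Rightarrow> real) \<Rightarrow> bool" where
  "smooth_on_total \<A> E S f \<longleftrightarrow> (\<forall>c\<in>\<A>. \<forall>t\<in>trivs E.
     smooth_on (in_ecoord E c t S) (f \<circ> inv_into (edom E c t) (ecoord E c t)))"

definition unit_sphere_bundle :: "('a, 'e, 'm::finite) vbundle \<Rightarrow> ('e \<Rightarrow> 'e \<Rightarrow> real) \<Rightarrow> 'e set" where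
  "unit_sphere_bundle E h = {\<xi> \<in> total E. sqrt (h \<xi> \<xi>) = 1}"

definition radial_graph ::
  "('a, 'n::finite) chart set \<Rightarrow> ('a, 'e, 'm::finite) vbundle \<Rightarrow> ('e \<Rightarrow> 'e \<Rightarrow> real) \<Rightarrow> 'e set \<Rightarrow> bool" where
  "radial_graph \<A> E h Y \<longleftrightarrow>
     Y \<subseteq> punctured E \<and> (\<forall>c\<in>\<A>. \<forall>t\<in>trivs E. hypersurface (in_ecoord E c t Y)) \<and>
     (\<exists>u. smooth_on_total \<A> E (unit_sphere_bundle E h) u \<and>
          Y = (\<lambda>\<xi>. vscale E (exp (u \<xi>)) \<xi>) ` unit_sphere_bundle E h)"

text \<open>A trivialisation identifies the Euclidean space \<open>(E\<^sub>x, h)\<close> with \<open>real^'m\<close> carrying the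
  transported inner product; neither condition below depends on its choice.\<close>

definition vertical_curvature_given_by ::
  "('a, 'e, 'm::finite) vbundle \<Rightarrow> ('e \<Rightarrow> 'e \<Rightarrow> real) \<Rightarrow> 'e set \<Rightarrow> ('e \<Rightarrow> real) \<Rightarrow> bool" where
  "vertical_curvature_given_by E h Y K \<longleftrightarrow> (\<forall>\<xi>\<in>Y. \<forall>t\<in>trivs E. proj E \<xi> \<in> fst t \<longrightarrow>
     (let x = proj E \<xi>; Yx = snd t ` (Y \<inter> fibre E x) in
        hypersurface Yx \<and>
        has_gauss_curvature (\<lambda>v w. h (from_frame E t x v) (from_frame E t x w)) Yx (snd t \<xi>) (K \<xi>)))"

text \<open>Tangent vectors of \<open>E\<close> are written by their components \<open>(a, b)\<close> in the frame
  \<open>e\<^sub>i = \<partial>/\<partial>x\<^sup>i - y\<^sup>\<alpha> \<Gamma>\<^sup>\<beta>\<^sub>i\<^sub>\<alpha> \<partial>/\<partial>y\<^sup>\<beta>\<close>, \<open>e\<^sub>\<alpha> = \<partial>/\<partial>y\<^sup>\<alpha>\<close>; \<open>adapted_vec\<close> is the coordinate vector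
  \<open>a\<^sup>i e\<^sub>i + b\<^sup>\<alpha> e\<^sub>\<alpha>\<close> at \<open>\<xi>\<close>.\<close>

definition adapted_vec ::
  "('a, 'e, 'm::finite) vbundle \<Rightarrow> ('a, 'n::finite, 'e, 'm) bundle_christoffel \<Rightarrow>
   ('a, 'n) chart \<Rightarrow> ('a, 'e, 'm) triv \<Rightarrow> 'e \<Rightarrow> (real^'n) \<times> (real^'m) \<Rightarrow> (real^'n) \<times> (real^'m)" where
  "adapted_vec E \<omega> c t \<xi> Z =
     (fst Z, snd Z - (\<Sum>i\<in>UNIV. (fst Z $ i) *\<^sub>R (\<omega> c t (proj E \<xi>) i *v snd t \<xi>)))"

definition sasaki_metric ::
  "('a, 'n) tensor2 \<Rightarrow> ('a, 'e, 'm::finite) vbundle \<Rightarrow> ('e \<Rightarrow> 'e \<Rightarrow> real) \<Rightarrow>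
   ('a, 'n::finite) chart \<Rightarrow> ('a, 'e, 'm) triv \<Rightarrow> 'e \<Rightarrow>
   (real^'n) \<times> (real^'m) \<Rightarrow> (real^'n) \<times> (real^'m) \<Rightarrow> real" where
  "sasaki_metric g E h c t \<xi> Z Z' =
     fst Z \<bullet> (g c (proj E \<xi>) *v fst Z') + snd Z \<bullet> (fibre_gram E h t (proj E \<xi>) *v snd Z')"

text \<open>The Sasaki derivative \<open>D\<^sub>Z A\<close> at \<open>\<xi>\<close>, with \<open>Z\<close>, the field \<open>A\<close> (a function of the coordinates) and
  the result all given by components in \<open>(e\<^sub>i, e\<^sub>\<alpha>)\<close>: differentiate the components of \<open>A\<close> along \<open>Z\<close>
  and add the terms from \<open>D\<^sub>e\<^sub>i e\<^sub>j = \<Gamma>\<^sup>k\<^sub>i\<^sub>j e\<^sub>k\<close>, \<open>D\<^sub>e\<^sub>i e\<^sub>\<alpha> = \<Gamma>\<^sup>\<beta>\<^sub>i\<^sub>\<alpha> e\<^sub>\<beta>\<close>; those with \<open>D\<^sub>e\<^sub>\<alpha>\<close> vanish.\<close>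

definition sasaki_deriv ::
  "('a, 'n::finite) christoffel \<Rightarrow> ('a, 'e, 'm::finite) vbundle \<Rightarrow> ('a, 'n, 'e, 'm) bundle_christoffel \<Rightarrow>
   ('a, 'n) chart \<Rightarrow> ('a, 'e, 'm) triv \<Rightarrow> 'e \<Rightarrow>
   (real^'n) \<times> (real^'m) \<Rightarrow> ((real^'n) \<times> (real^'m) \<Rightarrow> (real^'n) \<times> (real^'m)) \<Rightarrow> (real^'n) \<times> (real^'m)" where
  "sasaki_deriv \<Gamma> E \<omega> c t \<xi> Z A =
     (let p = ecoord E c t \<xi>; x = proj E \<xi> in
        frechet_derivative A (at p) (adapted_vec E \<omega> c t \<xi> Z) +
        (\<Sum>i\<in>UNIV. (fst Z $ i) *\<^sub>R (\<Gamma> c x i *v fst (A p), \<omega> c t x i *v snd (A p))))"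

text \<open>\<open>(0, snd t \<xi>)\<close> are the components of the radial vector \<open>y\<^sup>\<alpha> e\<^sub>\<alpha>\<close> at \<open>\<xi>\<close>; the outward normal of a
  radial graph is the one on its side.\<close>

definition outward_unit_normal ::
  "('a, 'n) tensor2 \<Rightarrow> ('a, 'e, 'm::finite) vbundle \<Rightarrow> ('e \<Rightarrow> 'e \<Rightarrow> real) \<Rightarrow>
   ('a, 'n::finite, 'e, 'm) bundle_christoffel \<Rightarrow> 'e set \<Rightarrow>
   ('a, 'n) chart \<Rightarrow> ('a, 'e, 'm) triv \<Rightarrow> 'e \<Rightarrow> (real^'n) \<times> (real^'m) \<Rightarrow> bool" where
  "outward_unit_normal g E h \<omega> Y c t \<xi> \<nu> \<longleftrightarrow>
     sasaki_metric g E h c t \<xi> \<nu> \<nu> = 1 \<and>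
     (\<forall>Z. adapted_vec E \<omega> c t \<xi> Z \<in> tangent_space (in_ecoord E c t Y) (ecoord E c t \<xi>) \<longrightarrow>
        sasaki_metric g E h c t \<xi> \<nu> Z = 0) \<and>
     sasaki_metric g E h c t \<xi> \<nu> (0, snd t \<xi>) > 0"

text \<open>\<open>A\<close> is a smooth vector field near \<open>ecoord E c t \<xi>\<close>, by components in \<open>(e\<^sub>i, e\<^sub>\<alpha>)\<close>, tangent to \<open>Y\<close>
  along \<open>Y\<close>.\<close>

definition tangent_field ::
  "('a, 'e, 'm::finite) vbundle \<Rightarrow> ('a, 'n::finite, 'e, 'm) bundle_christoffel \<Rightarrow> 'e set \<Rightarrow>
   ('a, 'n) chart \<Rightarrow> ('a, 'e, 'm) triv \<Rightarrow> 'e \<Rightarrow> ((real^'n) \<times> (real^'m) \<Rightarrow> (real^'n) \<times> (real^'m)) \<Rightarrow> bool" where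
  "tangent_field E \<omega> Y c t \<xi> A \<longleftrightarrow> (\<exists>W. open W \<and> ecoord E c t \<xi> \<in> W \<and> smooth_on W A \<and>
     (\<forall>\<eta>\<in>Y \<inter> edom E c t. ecoord E c t \<eta> \<in> W \<longrightarrow>
        adapted_vec E \<omega> c t \<eta> (A (ecoord E c t \<eta>)) \<in> tangent_space (in_ecoord E c t Y) (ecoord E c t \<eta>)))"

definition second_fundamental_form ::
  "('a, 'n) tensor2 \<Rightarrow> ('a, 'n::finite) christoffel \<Rightarrow> ('a, 'e, 'm::finite) vbundle \<Rightarrow> ('e \<Rightarrow> 'e \<Rightarrow> real) \<Rightarrow>
   ('a, 'n, 'e, 'm) bundle_christoffel \<Rightarrow> ('a, 'n) chart \<Rightarrow> ('a, 'e, 'm) triv \<Rightarrow> 'e \<Rightarrow> (real^'n) \<times> (real^'m) \<Rightarrow>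
   (real^'n) \<times> (real^'m) \<Rightarrow> ((real^'n) \<times> (real^'m) \<Rightarrow> (real^'n) \<times> (real^'m)) \<Rightarrow> real" where
  "second_fundamental_form g \<Gamma> E h \<omega> c t \<xi> \<nu> X A =
     - sasaki_metric g E h c t \<xi> (sasaki_deriv \<Gamma> E \<omega> c t \<xi> X A) \<nu>"

definition convex_graph ::
  "('a, 'n::finite) chart set \<Rightarrow> ('a, 'n) tensor2 \<Rightarrow> ('a, 'n) christoffel \<Rightarrow>
   ('a, 'e, 'm::finite) vbundle \<Rightarrow> ('e \<Rightarrow> 'e \<Rightarrow> real) \<Rightarrow> ('a, 'n, 'e, 'm) bundle_christoffel \<Rightarrow> 'e set \<Rightarrow> bool" where
  "convex_graph \<A> g \<Gamma> E h \<omega> Y \<longleftrightarrow>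
     (\<forall>c\<in>\<A>. \<forall>t\<in>trivs E. \<forall>\<xi>\<in>Y \<inter> edom E c t. \<forall>\<nu> A.
        outward_unit_normal g E h \<omega> Y c t \<xi> \<nu> \<longrightarrow> tangent_field E \<omega> Y c t \<xi> A \<longrightarrow>
        second_fundamental_form g \<Gamma> E h \<omega> c t \<xi> \<nu> (A (ecoord E c t \<xi>)) A \<ge> 0)"

end

theory Submission
  imports Defs
begin

text \<open>
  For existence take \<open>u = - ln K / (m - 1)\<close>: the fibres of the graph are spheres of radius \<open>exp u\<close> about
  the origin. If \<open>K\<close> is constant, differentiating \<open>h(y, B) = 0\<close> along the graph for a tangent field with
  vertical part \<open>B\<close> gives \<open>II = s h(B, B)\<close> with \<open>s > 0\<close>, because \<open>h\<close> is parallel.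

  Conversely let the graph of \<open>u\<close> be convex, extend \<open>u\<close> to be homogeneous of degree 0, and let
  \<open>L\<^sub>a = e\<^sub>a u\<close> be its derivative along the horizontal lift of a base vector \<open>a\<close> and \<open>\<nabla>\<^sup>2u\<close> its horizontal
  Hessian. Applying the second fundamental form to the tangent field \<open>(a, L\<^sub>a y)\<close> gives
  \<open>\<nabla>\<^sup>2u(a, a) + L\<^sub>a\<^sup>2 \<le> 0\<close>. By compactness \<open>L\<^sub>a\<^sup>2 / g(a, a)\<close> attains its maximum. Moving the maximum point in
  the direction \<open>a\<close>, and \<open>a\<close> itself parallelly, the derivative \<open>2 L\<^sub>a \<nabla>\<^sup>2u(a, a) / g(a, a)\<close> vanishes there,
  so \<open>L\<^sub>a = 0\<close> there and hence \<open>L = 0\<close> everywhere. Then parallel transport maps the fibres of the graph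
  isometrically onto each other, and \<open>K\<close> is locally constant. It is not needed that a closed hypersurface
  of constant curvature is a sphere.
\<close>

section \<open>Smooth maps\<close>

text \<open>A radial graph is a level set of \<open>rgauge\<close>, which is homogeneous of degree 1
  along the fibres. Euler's identity makes the level 1 regular, so tangent spaces are kernels of one
  differential, and statements about the sphere bundle become statements about functions on open
  sets. The field \<open>(a, L_a y)\<close> is forced: that differential takes
  \<open>(a, r y)\<close> to a multiple of \<open>r - L_a\<close>, so \<open>r = L_a\<close> is the
  only radial correction that makes a horizontal vector tangent. The radial correction enters the
  second fundamental form quadratically; this produces the term \<open>L_a^2\<close>, which supplies
  the strictness in the maximum principle. The horizontal Hessian need not be symmetric, since the
  bundle connection may have curvature, but moving in the direction \<open>a\<close> itself involves
  only its diagonal value at \<open>a\<close>. Only a first derivative is taken at the maximum, so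
  straight coordinate lines can replace geodesics. Gaussian curvature is a relation, with a choice
  of unit normal and of principal directions, so comparing two fibres needs its uniqueness as well
  as its invariance under linear isometries.\<close>

lemma Ck_on_subset: "Ck_on k f W \<Longrightarrow> V \<subseteq> W \<Longrightarrow> Ck_on k f V"
  by (induction k arbitrary: f) (auto intro: continuous_on_subset)

text \<open>A derivative at a point of an open set depends only on the values in that set. Each
  closure rule below uses this to replace a derivative by its explicit formula.\<close>

lemma Ck_on_cong:
  assumes "open W" "\<And>x. x \<in> W \<Longrightarrow> f x = g x" "Ck_on k f W"
  shows "Ck_on k g W"
  using assms(2,3)
proof (induction k arbitrary: f g)
  case 0
  then show ?case by (auto cong: continuous_on_cong)
next
  case (Suc k)
  have diff: "f differentiable (at x)" if "x \<in> W" for x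
    using Suc.prems that by auto
  have gf: "g differentiable (at x) \<and> frechet_derivative f (at x) = frechet_derivative g (at x)" if "x \<in> W" for x
  proof
    show "frechet_derivative f (at x) = frechet_derivative g (at x)"
      by (rule frechet_derivative_transform_within_open[OF diff[OF that] \<open>open W\<close> that]) (use Suc.prems in auto)
    show "g differentiable (at x)"
      using diff[OF that] \<open>open W\<close> that Suc.prems(1)
      by (meson differentiable_def has_derivative_transform_within_open)
  qed
  have "Ck_on k (\<lambda>x. frechet_derivative g (at x) v) W" for v
    by (rule Suc.IH[of "\<lambda>x. frechet_derivative f (at x) v"]) (use gf Suc.prems(2) in simp_all)
  with gf show ?case by simp
qed

lemma Ck_on_local:
  assumes "\<And>x. x \<in> W \<Longrightarrow> \<exists>V. open V \<and> x \<in> V \<and> Ck_on k f V"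
  shows "Ck_on k f W"
  using assms
proof (induction k arbitrary: f)
  case 0
  then show ?case
    by (metis Ck_on.simps(1) continuous_at_imp_continuous_on continuous_on_eq_continuous_at)
next
  case (Suc k)
  have "f differentiable (at x)" if "x \<in> W" for x
    using Suc.prems[OF that] by auto
  moreover have "Ck_on k (\<lambda>x. frechet_derivative f (at x) v) W" for v
    using Suc.prems by (intro Suc.IH) force
  ultimately show ?case by auto
qed

lemma Ck_on_SucD: "Ck_on (Suc k) f W \<Longrightarrow> Ck_on k f W"
proof (induction k arbitrary: f)
  case 0
  then show ?case
    by (auto intro!: continuous_at_imp_continuous_on differentiable_imp_continuous_within)
next
  case (Suc k)
  then show ?case by (metis Ck_on.simps(2))
qed

lemma Ck_on_const: "Ck_on k (\<lambda>x. c) W"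
  by (induction k arbitrary: c) auto

lemma Ck_on_bounded_linear:
  assumes "bounded_linear L" "open W" "Ck_on k f W"
  shows "Ck_on k (\<lambda>x. L (f x)) W"
  using assms(3)
proof (induction k arbitrary: f)
  case 0
  then show ?case
    using assms(1) by (auto intro: bounded_linear.continuous_on)
next
  case (Suc k)
  have *: "((\<lambda>x. L (f x)) has_derivative (\<lambda>v. L (frechet_derivative f (at x) v))) (at x)" if "x \<in> W" for x
    using Suc.prems that by (intro bounded_linear.has_derivative[OF assms(1)]) (auto simp: frechet_derivative_works)
  have "Ck_on k (\<lambda>x. frechet_derivative (\<lambda>x. L (f x)) (at x) v) W" for v
    by (rule Ck_on_cong[OF \<open>open W\<close> _ Suc.IH[of "\<lambda>x. frechet_derivative f (at x) v"]])
       (use Suc.prems in \<open>auto simp: frechet_derivative_at[OF *, symmetric]\<close>)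
  with * show ?case by (auto simp: differentiable_def)
qed

lemma Ck_on_add:
  assumes "open W" "Ck_on k f W" "Ck_on k g W"
  shows "Ck_on k (\<lambda>x. f x + g x) W"
  using assms(2,3)
proof (induction k arbitrary: f g)
  case 0
  then show ?case by (auto intro: continuous_on_add)
next
  case (Suc k)
  have *: "((\<lambda>x. f x + g x) has_derivative (\<lambda>v. frechet_derivative f (at x) v + frechet_derivative g (at x) v)) (at x)"
    if "x \<in> W" for x
    using Suc.prems that by (intro has_derivative_add) (auto simp: frechet_derivative_works)
  have "Ck_on k (\<lambda>x. frechet_derivative (\<lambda>x. f x + g x) (at x) v) W" for v
    by (rule Ck_on_cong[OF \<open>open W\<close> _ Suc.IH[of "\<lambda>x. frechet_derivative f (at x) v" "\<lambda>x. frechet_derivative g (at x) v"]])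
       (use Suc.prems in \<open>auto simp: frechet_derivative_at[OF *, symmetric]\<close>)
  with * show ?case by (auto simp: differentiable_def)
qed

lemma Ck_on_bilinear:
  assumes "bounded_bilinear pr" "open W" "Ck_on k f W" "Ck_on k g W"
  shows "Ck_on k (\<lambda>x. pr (f x) (g x)) W"
  using assms(3,4)
proof (induction k arbitrary: f g)
  case 0
  then show ?case using assms(1) by (auto intro: bounded_bilinear.continuous_on)
next
  case (Suc k)
  let ?D = "\<lambda>x v. pr (f x) (frechet_derivative g (at x) v) + pr (frechet_derivative f (at x) v) (g x)"
  have *: "((\<lambda>x. pr (f x) (g x)) has_derivative ?D x) (at x)"
    if "x \<in> W" for x
    using Suc.prems that by (intro bounded_bilinear.FDERIV[OF assms(1)]) (auto simp: frechet_derivative_works)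
  \<comment> \<open>The product rule leaves undifferentiated factors, which are needed only at order
    \<open>k\<close>; hence the appeal to \<open>Ck_on_SucD\<close>.\<close>
  have "Ck_on k (\<lambda>x. ?D x v) W" for v
    using Suc.prems by (intro Ck_on_add \<open>open W\<close> Suc.IH) (auto intro: Ck_on_SucD simp del: Ck_on.simps, auto)
  then have "Ck_on k (\<lambda>x. frechet_derivative (\<lambda>x. pr (f x) (g x)) (at x) v) W" for v
    by (rule Ck_on_cong[OF \<open>open W\<close>, rotated]) (auto simp: frechet_derivative_at[OF *, symmetric])
  with * show ?case by (auto simp: differentiable_def)
qed

lemma Ck_on_sum:
  assumes "open W" "\<And>i. i \<in> I \<Longrightarrow> Ck_on k (f i) W"
  shows "Ck_on k (\<lambda>x. \<Sum>i\<in>I. f i x) W"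
  using assms(2)
  by (induction I rule: infinite_finite_induct) (auto intro: Ck_on_const Ck_on_add[OF \<open>open W\<close>])

lemma Ck_on_compose:
  fixes f :: "'a::euclidean_space \<Rightarrow> 'b::euclidean_space" and g :: "'b \<Rightarrow> 'c::real_normed_vector"
  assumes "open W" "open V" "f ` W \<subseteq> V" "Ck_on k f W" "Ck_on k g V"
  shows "Ck_on k (\<lambda>x. g (f x)) W"
  using assms(4,5)
proof (induction k arbitrary: g)
  case 0
  then show ?case using assms(3) by (auto intro: continuous_on_compose2)
next
  case (Suc k)
  let ?D = "\<lambda>x v. frechet_derivative g (at (f x)) (frechet_derivative f (at x) v)"
  have gd: "(g has_derivative frechet_derivative g (at (f x))) (at (f x))" if "x \<in> W" for x
    using Suc.prems that assms(3) by (auto simp: frechet_derivative_works)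
  have *: "((\<lambda>x. g (f x)) has_derivative ?D x) (at x)"
    if "x \<in> W" for x
    proof -
    have "(f has_derivative frechet_derivative f (at x)) (at x)"
      using Suc.prems(1) that by (simp add: frechet_derivative_works)
    from has_derivative_compose[OF this, of g, OF gd[OF that]] show ?thesis .
  qed
  \<comment> \<open>\<open>Ck_on\<close> controls derivatives in fixed directions, while the chain
    rule differentiates \<open>g\<close> in a direction that varies with \<open>x\<close>. Expanding
    in the basis gives a sum of products with fixed directions.\<close>
  have eq: "?D x v = (\<Sum>b\<in>Basis. (frechet_derivative f (at x) v \<bullet> b) *\<^sub>R frechet_derivative g (at (f x)) b)"
    if "x \<in> W" for x v
  proof -
    have "linear (frechet_derivative g (at (f x)))"
      using gd[OF that] by (rule has_derivative_linear)
    then show ?thesis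
      by (subst euclidean_representation[of "frechet_derivative f (at x) v", symmetric])
         (simp add: linear_sum linear_scale)
  qed
  have "Ck_on k (\<lambda>x. \<Sum>b\<in>Basis. (frechet_derivative f (at x) v \<bullet> b) *\<^sub>R frechet_derivative g (at (f x)) b) W" for v
  proof (intro Ck_on_sum \<open>open W\<close> Ck_on_bilinear[OF bounded_bilinear_scaleR])
    fix b :: 'b
    show "Ck_on k (\<lambda>x. frechet_derivative f (at x) v \<bullet> b) W"
      using Suc.prems by (intro Ck_on_bounded_linear[OF bounded_linear_inner_left] \<open>open W\<close>) auto
    show "Ck_on k (\<lambda>x. frechet_derivative g (at (f x)) b) W"
      using Suc.prems by (intro Suc.IH) (auto intro: Ck_on_SucD simp del: Ck_on.simps, auto)
  qed
  then have "Ck_on k (\<lambda>x. frechet_derivative (\<lambda>x. g (f x)) (at x) v) W" for v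
    by (rule Ck_on_cong[OF \<open>open W\<close>, rotated]) (auto simp: frechet_derivative_at[OF *, symmetric] eq)
  with * show ?case by (auto simp: differentiable_def)
qed

section \<open>Smoothness on arbitrary subsets\<close>

lemma smooth_onE:
  assumes "smooth_on S f" "z \<in> S"
  obtains W F where "open W" "z \<in> W" "\<And>k. Ck_on k F W" "\<And>w. w \<in> W \<Longrightarrow> w \<in> S \<Longrightarrow> F w = f w"
  using bspec[OF assms(1)[unfolded smooth_on_def] assms(2)] by (elim exE conjE) auto

lemma smooth_on_open: "open W \<Longrightarrow> smooth_on W f \<longleftrightarrow> (\<forall>k. Ck_on k f W)"
proof
  assume W: "open W" and f: "smooth_on W f"
  show "\<forall>k. Ck_on k f W"
  proof (intro allI Ck_on_local)
    fix k z assume "z \<in> W"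
    from f this obtain V F where V: "open V" "z \<in> V"
      "\<And>k. Ck_on k F V" "\<And>w. w \<in> V \<Longrightarrow> w \<in> W \<Longrightarrow> F w = f w"
    by (rule smooth_onE) blast
    have "Ck_on k f (V \<inter> W)"
      by (rule Ck_on_cong[of _ F]) (use V W in \<open>auto intro: Ck_on_subset\<close>)
    then show "\<exists>V. open V \<and> z \<in> V \<and> Ck_on k f V"
      using V W \<open>z \<in> W\<close> by (intro exI[of _ "V \<inter> W"]) auto
  qed
qed (auto simp: smooth_on_def)

lemma smooth_on_subset:
  assumes "smooth_on S f" "T \<subseteq> S"
  shows "smooth_on T f"
  unfolding smooth_on_def
proof
  fix z assume "z \<in> T"
  then have "z \<in> S" using assms(2) by blast
  from assms(1) this obtain W F where "open W" "z \<in> W"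
    "\<And>k. Ck_on k F W" "\<And>w. w \<in> W \<Longrightarrow> w \<in> S \<Longrightarrow> F w = f w"
    by (rule smooth_onE) blast
  then show "\<exists>W F. open W \<and> z \<in> W \<and> (\<forall>k. Ck_on k F W) \<and> (\<forall>w\<in>W \<inter> T. F w = f w)"
    using assms(2) by (intro exI[of _ W] exI[of _ F]) auto
qed

lemma smooth_on_cong:
  assumes "smooth_on S f" "\<And>x. x \<in> S \<Longrightarrow> f x = g x"
  shows "smooth_on S g"
  using assms(1) unfolding smooth_on_def by (simp add: assms(2))

lemma smooth_on_differentiable:
  "smooth_on W f \<Longrightarrow> open W \<Longrightarrow> x \<in> W \<Longrightarrow> f differentiable (at x)"
  using smooth_on_open[of W f] Ck_on.simps(2)[of 0 f W] by blast

lemma smooth_on_has_derivative: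
  "smooth_on W f \<Longrightarrow> open W \<Longrightarrow> x \<in> W \<Longrightarrow> (f has_derivative frechet_derivative f (at x)) (at x)"
  using smooth_on_differentiable[of W f x] by (simp add: frechet_derivative_works)

lemma smooth_on_continuous_on: "smooth_on S f \<Longrightarrow> continuous_on S f"
  unfolding continuous_on_eq_continuous_within
proof
  fix z assume f: "smooth_on S f" and "z \<in> S"
  from this obtain W F where W: "open W" "z \<in> W"
    "\<And>k. Ck_on k F W" "\<And>w. w \<in> W \<Longrightarrow> w \<in> S \<Longrightarrow> F w = f w"
    by (rule smooth_onE) blast
  have "Ck_on 0 F W" by (rule W)
  then have "continuous (at z within S) F"
    using W(1,2) by (simp add: continuous_on_eq_continuous_at continuous_at_imp_continuous_at_within)
  moreover have "\<forall>\<^sub>F x in at z within S. F x = f x"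
    using W by (auto simp: eventually_at_topological)
  ultimately show "continuous (at z within S) f"
    using W \<open>z \<in> S\<close> by (auto simp: continuous_within intro: Lim_transform_eventually)
qed

lemma smooth_on_const [intro!]: "smooth_on S (\<lambda>x. c)"
  unfolding smooth_on_def by (intro ballI exI[of _ UNIV] exI[of _ "\<lambda>x. c"]) (auto intro: Ck_on_const)

lemma smooth_on_bounded_linear:
  assumes "bounded_linear L" "smooth_on S f"
  shows "smooth_on S (\<lambda>x. L (f x))"
  unfolding smooth_on_def
proof
  fix z assume "z \<in> S"
  from assms(2) this obtain W F where W: "open W" "z \<in> W"
    "\<And>k. Ck_on k F W" "\<And>w. w \<in> W \<Longrightarrow> w \<in> S \<Longrightarrow> F w = f w"
    by (rule smooth_onE) blast
  then show "\<exists>W F. open W \<and> z \<in> W \<and> (\<forall>k. Ck_on k F W) \<and> (\<forall>w\<in>W \<inter> S. F w = L (f w))"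
    by (intro exI[of _ W] exI[of _ "\<lambda>x. L (F x)"]) (auto intro: Ck_on_bounded_linear[OF assms(1)])
qed

lemma smooth_on_ident [intro!]: "smooth_on S (\<lambda>x. x)"
proof -
  have "Ck_on k (\<lambda>x. x) (UNIV :: 'a set)" for k
    by (cases k) (auto intro: Ck_on_const)
  then show ?thesis
    unfolding smooth_on_def by (intro ballI exI[of _ UNIV] exI[of _ "\<lambda>x. x"]) auto
qed

lemma smooth_on_linear: "linear L \<Longrightarrow> smooth_on S L" for L :: "'a::euclidean_space \<Rightarrow> 'b::real_normed_vector"
  by (rule smooth_on_bounded_linear[OF _ smooth_on_ident]) (simp add: linear_conv_bounded_linear)

lemma smooth_on_bilinear:
  assumes "bounded_bilinear pr" "smooth_on S f" "smooth_on S g"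
  shows "smooth_on S (\<lambda>x. pr (f x) (g x))"
  unfolding smooth_on_def
proof
  fix z assume "z \<in> S"
  from assms(2) this obtain W F where W: "open W" "z \<in> W"
    "\<And>k. Ck_on k F W" "\<And>w. w \<in> W \<Longrightarrow> w \<in> S \<Longrightarrow> F w = f w"
    by (rule smooth_onE) blast
  from assms(3) \<open>z \<in> S\<close> obtain V G where V: "open V" "z \<in> V"
    "\<And>k. Ck_on k G V" "\<And>w. w \<in> V \<Longrightarrow> w \<in> S \<Longrightarrow> G w = g w"
    by (rule smooth_onE) blast
  have "Ck_on k (\<lambda>x. pr (F x) (G x)) (W \<inter> V)" for k
    using W V by (intro Ck_on_bilinear[OF assms(1)]) (auto intro: Ck_on_subset)
  then show "\<exists>W F. open W \<and> z \<in> W \<and> (\<forall>k. Ck_on k F W) \<and> (\<forall>w\<in>W \<inter> S. F w = pr (f w) (g w))"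
    using W V by (intro exI[of _ "W \<inter> V"] exI[of _ "\<lambda>x. pr (F x) (G x)"]) auto
qed

lemma smooth_on_add:
  assumes "smooth_on S f" "smooth_on S g"
  shows "smooth_on S (\<lambda>x. f x + g x)"
  unfolding smooth_on_def
proof
  fix z assume "z \<in> S"
  from assms(1) this obtain W F where W: "open W" "z \<in> W"
    "\<And>k. Ck_on k F W" "\<And>w. w \<in> W \<Longrightarrow> w \<in> S \<Longrightarrow> F w = f w"
    by (rule smooth_onE) blast
  from assms(2) \<open>z \<in> S\<close> obtain V G where V: "open V" "z \<in> V"
    "\<And>k. Ck_on k G V" "\<And>w. w \<in> V \<Longrightarrow> w \<in> S \<Longrightarrow> G w = g w"
    by (rule smooth_onE) blast
  have "Ck_on k (\<lambda>x. F x + G x) (W \<inter> V)" for k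
    using W V by (intro Ck_on_add) (auto intro: Ck_on_subset)
  then show "\<exists>W F. open W \<and> z \<in> W \<and> (\<forall>k. Ck_on k F W) \<and> (\<forall>w\<in>W \<inter> S. F w = f w + g w)"
    using W V by (intro exI[of _ "W \<inter> V"] exI[of _ "\<lambda>x. F x + G x"]) auto
qed

lemma smooth_on_compose:
  fixes f :: "'a::euclidean_space \<Rightarrow> 'b::euclidean_space" and g :: "'b \<Rightarrow> 'c::real_normed_vector"
  assumes g: "smooth_on T g" and f: "smooth_on S f" and "f ` S \<subseteq> T"
  shows "smooth_on S (\<lambda>x. g (f x))"
  unfolding smooth_on_def
proof
  fix z assume "z \<in> S"
  from f this obtain W F where W: "open W" "z \<in> W"
    "\<And>k. Ck_on k F W" "\<And>w. w \<in> W \<Longrightarrow> w \<in> S \<Longrightarrow> F w = f w"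
    by (rule smooth_onE) blast
  from \<open>z \<in> S\<close> assms(3) have "f z \<in> T" by auto
  from g this obtain V G where V: "open V" "f z \<in> V"
    "\<And>k. Ck_on k G V" "\<And>w. w \<in> V \<Longrightarrow> w \<in> T \<Longrightarrow> G w = g w"
    by (rule smooth_onE) blast
  \<comment> \<open>The extension \<open>F\<close> may leave \<open>V\<close> away from
    \<open>S\<close>, so its domain is cut down to where \<open>G\<close> can be applied.\<close>
  define W' where "W' = W \<inter> F -` V"
  have "continuous_on W F" using W(3)[of 0] by simp
  then have W': "open W'" unfolding W'_def
    using continuous_open_preimage W(1) V(1) by blast
  have "Ck_on k (\<lambda>x. G (F x)) W'" for k
    by (rule Ck_on_compose[OF W' V(1)]) (use W V in \<open>auto simp: W'_def intro: Ck_on_subset\<close>)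
  then show "\<exists>W F. open W \<and> z \<in> W \<and> (\<forall>k. Ck_on k F W) \<and> (\<forall>w\<in>W \<inter> S. F w = g (f w))"
    using W V W' \<open>z \<in> S\<close> assms(3)
    by (intro exI[of _ W'] exI[of _ "\<lambda>x. G (F x)"]) (auto simp: W'_def)
qed

lemma smooth_on_sum:
  assumes "\<And>i. i \<in> I \<Longrightarrow> smooth_on S (f i)"
  shows "smooth_on S (\<lambda>x. \<Sum>i\<in>I. f i x)"
  using assms by (induction I rule: infinite_finite_induct) (auto intro: smooth_on_add)

lemmas smooth_on_scaleR = smooth_on_bilinear[OF bounded_bilinear_scaleR]
lemmas smooth_on_mult = smooth_on_bilinear[OF bounded_bilinear_mult]
lemmas smooth_on_inner = smooth_on_bilinear[OF bounded_bilinear_inner]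
lemmas smooth_on_uminus = smooth_on_bounded_linear[OF bounded_linear_minus[OF bounded_linear_ident]]
lemmas smooth_on_fst = smooth_on_bounded_linear[OF bounded_linear_fst]
lemmas smooth_on_snd = smooth_on_bounded_linear[OF bounded_linear_snd]
lemmas smooth_on_nth = smooth_on_bounded_linear[OF bounded_linear_vec_nth]

lemma smooth_on_diff: "smooth_on S f \<Longrightarrow> smooth_on S g \<Longrightarrow> smooth_on S (\<lambda>x. f x - g x)"
  using smooth_on_add[OF _ smooth_on_uminus, of S f g] by simp

lemma smooth_on_Pair:
  fixes f :: "'a::euclidean_space \<Rightarrow> 'b::real_normed_vector" and g :: "'a \<Rightarrow> 'c::real_normed_vector"
  assumes "smooth_on S f" "smooth_on S g"
  shows "smooth_on S (\<lambda>x. (f x, g x))"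
proof -
  have "bounded_linear (\<lambda>b::'b. (b, 0::'c))" "bounded_linear (\<lambda>c::'c. (0::'b, c))"
    by (intro bounded_linear_Pair bounded_linear_ident bounded_linear_zero)+
  then have "smooth_on S (\<lambda>x. (f x, 0::'c) + (0::'b, g x))"
    using assms by (intro smooth_on_add) (auto intro: smooth_on_bounded_linear[of "\<lambda>b. (b, 0)"] smooth_on_bounded_linear[of "\<lambda>c. (0, c)"])
  then show ?thesis by simp
qed

lemma smooth_on_vec:
  fixes f :: "'a::euclidean_space \<Rightarrow> 'i::finite \<Rightarrow> 'b::real_normed_vector"
  assumes "\<And>i. smooth_on S (\<lambda>x. f x i)"
  shows "smooth_on S (\<lambda>x. \<chi> i. f x i)"
proof -
  have "smooth_on S (\<lambda>x. \<Sum>i\<in>UNIV. axis i (f x i))"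
  proof (intro smooth_on_sum)
    fix i :: "'i"
    have "bounded_linear (\<lambda>b::'b. axis i b)"
    proof (rule bounded_linear_intro[where K=1])
      fix b :: 'b
      have "(norm (axis i b $ j))\<^sup>2 = (if j = i then (norm b)\<^sup>2 else 0)" for j
        by (simp add: axis_def)
      then show "norm (axis i b) \<le> norm b * 1"
        by (simp add: norm_vec_def L2_set_def)
    qed (auto simp: axis_def vec_eq_iff)
    then show "smooth_on S (\<lambda>x. axis i (f x i))"
      using assms by (rule smooth_on_bounded_linear)
  qed
  moreover have "(\<Sum>i\<in>UNIV. axis i (f x i)) = (\<chi> i. f x i)" for x
    by (simp add: vec_eq_iff axis_def if_distrib cong: if_cong)
  ultimately show ?thesis by simp
qed

lemma bounded_bilinear_matrix_vector_mult:
  "bounded_bilinear ((*v) :: real^'k^'l \<Rightarrow> real^'k \<Rightarrow> real^'l)"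
  unfolding bilinear_conv_bounded_bilinear[symmetric] bilinear_def
  by (intro conjI allI linearI)
    (simp_all add: matrix_vector_mult_add_rdistrib matrix_vector_right_distrib matrix_vector_mult_scaleR scaleR_matrix_vector_assoc[symmetric])

lemmas smooth_on_matrix_vector_mult = smooth_on_bilinear[OF bounded_bilinear_matrix_vector_mult]

text \<open>The direction may vary with the point, as it does for horizontal lifts; expansion in the
  basis reduces to fixed directions.\<close>

lemma smooth_on_frechet_derivative:
  fixes f :: "'a::euclidean_space \<Rightarrow> 'b::real_normed_vector"
  assumes "open W" "smooth_on W f" "smooth_on W v"
  shows "smooth_on W (\<lambda>x. frechet_derivative f (at x) (v x))"
proof -
  have "smooth_on W (\<lambda>x. frechet_derivative f (at x) b)" for b
    using assms(2) Ck_on.simps(2)[of _ f W] unfolding smooth_on_open[OF assms(1)] by blast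
  then have "smooth_on W (\<lambda>x. \<Sum>b\<in>Basis. (v x \<bullet> b) *\<^sub>R frechet_derivative f (at x) b)"
    by (intro smooth_on_sum smooth_on_scaleR smooth_on_inner assms smooth_on_const)
  then show ?thesis
  proof (rule smooth_on_cong)
    fix x assume "x \<in> W"
    then have "linear (frechet_derivative f (at x))"
      using assms linear_frechet_derivative smooth_on_differentiable by blast
    then show "(\<Sum>b\<in>Basis. (v x \<bullet> b) *\<^sub>R frechet_derivative f (at x) b) = frechet_derivative f (at x) (v x)"
      by (subst (2) euclidean_representation[of "v x", symmetric]) (simp add: linear_sum linear_scale)
  qed
qed

text \<open>Bootstrapping: \<open>exp\<close>, \<open>inverse\<close> and \<open>ln\<close> have
  derivatives expressible through functions whose smoothness is already known, or through themselves
  at one order less.\<close>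

lemma Ck_on_real_deriv:
  fixes f :: "real \<Rightarrow> real"
  assumes "open W" "\<And>x. x \<in> W \<Longrightarrow> (f has_field_derivative f' x) (at x)" "Ck_on k f' W"
  shows "Ck_on (Suc k) f W"
proof -
  have *: "(f has_derivative (\<lambda>v. v * f' x)) (at x)" if "x \<in> W" for x
    using assms(2)[OF that] by (simp add: has_field_derivative_def mult.commute[of _ "f' x"])
  have "Ck_on k (\<lambda>x. v * f' x) W" for v
    using Ck_on_bounded_linear[OF bounded_linear_mult_right assms(1,3)] .
  then have "Ck_on k (\<lambda>x. frechet_derivative f (at x) v) W" for v
    by (rule Ck_on_cong[OF assms(1), rotated]) (auto simp: frechet_derivative_at[OF *, symmetric])
  with * show ?thesis by (auto simp: differentiable_def)
qed

lemma smooth_on_exp: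
  fixes f :: "'a::euclidean_space \<Rightarrow> real"
  assumes "smooth_on S f" shows "smooth_on S (\<lambda>x. exp (f x))"
proof -
  have "Ck_on k exp (UNIV :: real set)" for k
  proof (induction k)
    case 0 then show ?case by (simp add: continuous_on_exp)
  next
    case (Suc k) then show ?case by (intro Ck_on_real_deriv) (auto intro: DERIV_exp)
  qed
  then have "smooth_on UNIV (exp :: real \<Rightarrow> real)" by (simp add: smooth_on_open)
  from smooth_on_compose[OF this assms] show ?thesis by simp
qed

lemma smooth_on_inverse:
  fixes f :: "'a::euclidean_space \<Rightarrow> real"
  assumes "smooth_on S f" "\<And>x. x \<in> S \<Longrightarrow> f x \<noteq> 0" shows "smooth_on S (\<lambda>x. inverse (f x))"
proof -
  have o: "open (-{0::real})" by auto
  have "Ck_on k inverse (-{0::real})" for k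
  proof (induction k)
    case 0 then show ?case by (auto intro!: continuous_intros)
  next
    case (Suc k)
    have "Ck_on k (\<lambda>x. - (inverse x * inverse x)) (-{0::real})"
      by (intro Ck_on_bounded_linear[OF bounded_linear_minus[OF bounded_linear_ident]] Ck_on_bilinear[OF bounded_bilinear_mult] o Suc)
    then show ?case
      by (rule Ck_on_real_deriv[OF o, rotated]) (auto intro!: derivative_eq_intros simp: power2_eq_square)
  qed
  then have inv: "smooth_on (-{0}) (inverse :: real \<Rightarrow> real)" by (simp add: smooth_on_open o)
  have "f ` S \<subseteq> -{0}" using assms(2) by auto
  then show ?thesis by (rule smooth_on_compose[OF inv assms(1)])
qed

lemma smooth_on_ln:
  fixes f :: "'a::euclidean_space \<Rightarrow> real"
  assumes "smooth_on S f" "\<And>x. x \<in> S \<Longrightarrow> f x > 0" shows "smooth_on S (\<lambda>x. ln (f x))"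
proof -
  have o: "open {0::real<..}" by auto
  have "smooth_on {0::real<..} inverse"
    by (rule smooth_on_inverse) auto
  then have inv: "Ck_on k inverse {0::real<..}" for k
    by (simp add: smooth_on_open)
  have "Ck_on (Suc k) ln {0::real<..}" for k
    by (rule Ck_on_real_deriv[OF o _ inv]) (auto intro: DERIV_ln)
  then have "Ck_on k ln {0::real<..}" for k
    by (rule Ck_on_SucD)
  then have "smooth_on {0<..} (ln :: real \<Rightarrow> real)" by (simp add: smooth_on_open)
  from smooth_on_compose[OF this assms(1)] show ?thesis using assms(2) by (simp add: image_subset_iff)
qed

lemma smooth_on_divide:
  fixes f g :: "'a::euclidean_space \<Rightarrow> real"
  assumes "smooth_on S f" "smooth_on S g" "\<And>x. x \<in> S \<Longrightarrow> g x \<noteq> 0" shows "smooth_on S (\<lambda>x. f x / g x)"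
  unfolding divide_inverse using assms by (intro smooth_on_mult smooth_on_inverse)

lemma smooth_on_sqrt:
  fixes f :: "'a::euclidean_space \<Rightarrow> real"
  assumes "smooth_on S f" "\<And>x. x \<in> S \<Longrightarrow> f x > 0" shows "smooth_on S (\<lambda>x. sqrt (f x))"
proof -
  \<comment> \<open>Positivity allows the square root to be written as
    \<open>exp (ln f / 2)\<close>, which needs no induction of its own.\<close>
  have "smooth_on S (\<lambda>x. exp (ln (f x) / 2))"
    by (intro smooth_on_exp smooth_on_divide smooth_on_ln smooth_on_const assms) auto
  then show ?thesis
  proof (rule smooth_on_cong)
    fix x assume "x \<in> S"
    then have "f x > 0" using assms(2) by blast
    then show "exp (ln (f x) / 2) = sqrt (f x)"
      by (simp add: ln_sqrt[symmetric])
  qed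
qed

section \<open>Radial level sets\<close>

lemma has_vector_derivative_chain:
  assumes "(f has_derivative f') (at (\<gamma> t))" "(\<gamma> has_vector_derivative v) (at t within S)"
  shows "((\<lambda>s. f (\<gamma> s)) has_vector_derivative f' v) (at t within S)"
  using vector_derivative_diff_chain_within[OF assms(2) has_derivative_at_withinI[OF assms(1)]]
  by (simp add: o_def)

lemma curve_in_open:
  fixes \<gamma> :: "real \<Rightarrow> 'a::real_normed_vector"
  assumes "(\<gamma> has_vector_derivative v) (at 0)" "open W" "\<gamma> 0 \<in> W"
  shows "\<exists>\<delta>>0. \<forall>t. \<bar>t\<bar> < \<delta> \<longrightarrow> \<gamma> t \<in> W"
proof -
  have "isCont \<gamma> 0" using assms(1) has_vector_derivative_continuous by blast
  then have "\<forall>\<^sub>F t in nhds 0. \<gamma> t \<in> W"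
    using assms(2,3) by (intro topological_tendstoD) (simp_all add: isCont_def tendsto_at_iff_tendsto_nhds)
  then show ?thesis
    unfolding eventually_nhds_metric by auto
qed

lemma tangent_spaceE:
  assumes "v \<in> tangent_space S p"
  obtains \<gamma> \<epsilon> where "0 < (\<epsilon>::real)" "\<And>t. \<bar>t\<bar> < \<epsilon> \<Longrightarrow> \<gamma> t \<in> S" "\<gamma> 0 = p"
    "(\<gamma> has_vector_derivative v) (at 0)"
proof -
  from assms obtain \<gamma> \<epsilon> where *: "0 < (\<epsilon>::real)" "\<gamma> ` {-\<epsilon><..<\<epsilon>} \<subseteq> S" "\<gamma> 0 = p"
    "(\<gamma> has_vector_derivative v) (at 0)"
    unfolding tangent_space_def by auto
  then have "\<gamma> t \<in> S" if "\<bar>t\<bar> < \<epsilon>" for t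
    using that by (intro subsetD[OF *(2)] imageI) auto
  with * show ?thesis using that by blast
qed

lemma tangent_space_linear_image:
  fixes L :: "'v::euclidean_space \<Rightarrow> 'w::euclidean_space"
  assumes "linear L" "v \<in> tangent_space S p"
  shows "L v \<in> tangent_space (L ` S) (L p)"
proof -
  from assms(2) obtain \<gamma> \<epsilon> where *: "0 < (\<epsilon>::real)" "smooth_on {-\<epsilon><..<\<epsilon>} \<gamma>"
    "\<gamma> ` {-\<epsilon><..<\<epsilon>} \<subseteq> S" "\<gamma> 0 = p" "(\<gamma> has_vector_derivative v) (at 0)"
    unfolding tangent_space_def by auto
  have bl: "bounded_linear L" using assms(1) by (simp add: linear_conv_bounded_linear)
  show ?thesis
    unfolding tangent_space_def
  proof (intro CollectI exI conjI)
    show "0 < \<epsilon>" by fact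
    show "smooth_on {-\<epsilon><..<\<epsilon>} (\<lambda>t. L (\<gamma> t))" by (rule smooth_on_bounded_linear[OF bl *(2)])
    show "((\<lambda>t. L (\<gamma> t)) has_vector_derivative L v) (at 0)"
      by (rule bounded_linear.has_vector_derivative[OF bl *(5)])
  qed (use * in auto)
qed

lemma has_vector_derivative_eventually_const:
  assumes "(f has_vector_derivative d) (at (0::real))" "0 < \<epsilon>" "\<And>t. \<bar>t\<bar> < \<epsilon> \<Longrightarrow> f t = c"
  shows "d = 0"
proof -
  have "((\<lambda>t. c) has_vector_derivative d) (at 0)"
    by (rule has_vector_derivative_transform_within_open[OF assms(1), of "{-\<epsilon><..<\<epsilon>}"]) (use assms in auto)
  then show ?thesis
    by (metis vector_derivative_at vector_derivative_const_at)
qed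

text \<open>The projection \<open>P\<close> is the identity for a fibre and \<open>(x, y) \<mapsto> (0, y)\<close> for the total space, so
  that \<open>q \<mapsto> q + (s - 1) P q\<close> is dilation by \<open>s\<close> in the fibre direction.\<close>

locale radial_level =
  fixes D :: "'a::euclidean_space set" and P :: "'a \<Rightarrow> 'a" and F :: "'a \<Rightarrow> real"
  assumes open_D: "open D"
    and linear_P: "linear P"
    and smooth_F: "smooth_on D F"
    and F_pos: "q \<in> D \<Longrightarrow> F q > 0"
    and scale_D: "q \<in> D \<Longrightarrow> s > 0 \<Longrightarrow> q + (s - 1) *\<^sub>R P q \<in> D"
    and F_scale: "q \<in> D \<Longrightarrow> s > 0 \<Longrightarrow> F (q + (s - 1) *\<^sub>R P q) = s * F q"
begin

lemmas F_deriv = smooth_on_has_derivative[OF smooth_F open_D]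

lemma linear_dF: "q \<in> D \<Longrightarrow> linear (frechet_derivative F (at q))"
  using F_deriv has_derivative_linear by blast

text \<open>Euler's identity for a function of degree 1: along the ray through \<open>q\<close> the
  function is linear in the dilation factor. In particular the differential does not vanish on the
  level set.\<close>

lemma dF_radial:
  assumes "q \<in> D" shows "frechet_derivative F (at q) (P q) = F q"
proof -
  let ?g = "\<lambda>t::real. q + t *\<^sub>R P q"
  have "(?g has_vector_derivative P q) (at 0)"
    by (auto intro!: derivative_eq_intros)
  then have "((\<lambda>t. F (?g t)) has_vector_derivative frechet_derivative F (at q) (P q)) (at 0)"
    by (intro has_vector_derivative_chain[where f=F and \<gamma>="?g"]) (simp_all add: F_deriv assms)
  moreover have "((\<lambda>t. F (?g t)) has_vector_derivative F q) (at 0)"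
  proof (rule has_vector_derivative_transform_within_open[of "\<lambda>t. (1 + t) * F q" _ _ "{-1<..<1}"])
    show "((\<lambda>t. (1 + t) * F q) has_vector_derivative F q) (at 0)"
      by (auto intro!: derivative_eq_intros simp: has_real_derivative_iff_has_vector_derivative[symmetric])
    show "(1 + t) * F q = F (?g t)" if "t \<in> {-1<..<1}" for t
      using F_scale[OF assms, of "1 + t"] that by simp
  qed auto
  ultimately show ?thesis by (rule vector_derivative_unique_at)
qed

definition S where "S = {q \<in> D. F q = 1}"

lemma hypersurface_S: "hypersurface S"
  unfolding hypersurface_def
proof
  fix p assume p: "p \<in> S"
  have "((\<lambda>q. F q - 1) has_derivative frechet_derivative F (at p)) (at p)"
    using F_deriv[of p] p by (auto intro!: derivative_eq_intros simp: S_def)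
  then have "frechet_derivative (\<lambda>q. F q - 1) (at p) = frechet_derivative F (at p)"
    by (metis frechet_derivative_at)
  moreover have "frechet_derivative F (at p) (P p) = 1"
    using dF_radial p by (simp add: S_def)
  ultimately have "frechet_derivative (\<lambda>q. F q - 1) (at p) \<noteq> (\<lambda>_. 0)"
    by (metis zero_neq_one)
  then show "\<exists>W F. open W \<and> p \<in> W \<and> smooth_on W F \<and> S \<inter> W = {q \<in> W. F q = (0::real)} \<and>
      frechet_derivative F (at p) \<noteq> (\<lambda>_. 0)"
    using p open_D smooth_F
    by (intro exI[of _ D] exI[of _ "\<lambda>q. F q - 1"]) (auto simp: S_def intro: smooth_on_diff)
qed

text \<open>One inclusion differentiates the constant \<open>F\<close> along a curve. For the other,
  a curve inside the level set is built from the straight line with velocity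
  \<open>v\<close>.\<close>

lemma tangent_space_S:
  assumes p: "p \<in> S"
  shows "tangent_space S p = {v. frechet_derivative F (at p) v = 0}"
proof (intro equalityI subsetI CollectI)
  fix v assume "v \<in> tangent_space S p"
  then obtain \<gamma> \<epsilon> where *: "0 < (\<epsilon>::real)" "\<And>t. \<bar>t\<bar> < \<epsilon> \<Longrightarrow> \<gamma> t \<in> S" "\<gamma> 0 = p"
    "(\<gamma> has_vector_derivative v) (at 0)" by (rule tangent_spaceE) blast
  have "((\<lambda>s. F (\<gamma> s)) has_vector_derivative frechet_derivative F (at p) v) (at 0)"
    using p * by (intro has_vector_derivative_chain[where f=F and \<gamma>=\<gamma>]) (simp_all add: S_def F_deriv)
  then show "frechet_derivative F (at p) v = 0"
    by (rule has_vector_derivative_eventually_const[OF _ *(1), of _ _ 1]) (use *(2) in \<open>auto simp: S_def\<close>)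
next
  fix v assume "v \<in> {v. frechet_derivative F (at p) v = 0}"
  then have v: "frechet_derivative F (at p) v = 0" by simp
  have pD: "p \<in> D" "F p = 1" using p by (auto simp: S_def)
  let ?l = "\<lambda>t::real. p + t *\<^sub>R v"
  \<comment> \<open>The line is pushed back to the level 1 by dilating with \<open>1 / F\<close>.
    Since \<open>v\<close> lies in the kernel of the differential, the dilation factor is stationary
    at time 0 and the velocity remains \<open>v\<close>.\<close>
  let ?g = "\<lambda>t. ?l t + (inverse (F (?l t)) - 1) *\<^sub>R P (?l t)"
  have "open (?l -` D)"
    by (intro open_vimage open_D continuous_intros)
  then obtain e where e: "e > 0" "ball 0 e \<subseteq> ?l -` D"
    using pD by (metis (no_types, lifting) open_contains_ball pth_1 pth_4(1) scaleR_zero_left add.right_neutral vimageI)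
  have ball: "{-e<..<e} = ball 0 e" by (auto simp: dist_real_def)
  have lD: "?l t \<in> D" if "t \<in> {-e<..<e}" for t using e(2) that unfolding ball by auto
  have l: "smooth_on {-e<..<e} ?l"
    by (intro smooth_on_add smooth_on_scaleR smooth_on_const smooth_on_ident)
  have Fl: "smooth_on {-e<..<e} (\<lambda>t. F (?l t))"
    by (rule smooth_on_compose[OF smooth_F l]) (use lD in auto)
  have lv: "(?l has_vector_derivative v) (at 0)"
    by (auto intro!: derivative_eq_intros)
  then have "((\<lambda>t. F (?l t)) has_vector_derivative 0) (at 0)"
    using has_vector_derivative_chain[of F "frechet_derivative F (at p)" ?l 0 v] F_deriv[OF pD(1)] v by simp
  then have "((\<lambda>t. inverse (F (?l t))) has_vector_derivative 0) (at 0)"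
    unfolding has_real_derivative_iff_has_vector_derivative[symmetric]
    by (auto intro!: derivative_eq_intros simp: pD)
  moreover have blP: "bounded_linear P" using linear_P by (simp add: linear_conv_bounded_linear)
  note bounded_linear.has_vector_derivative[OF blP lv]
  ultimately have "(?g has_vector_derivative v + ((inverse (F (?l 0)) - 1) *\<^sub>R P v + 0 *\<^sub>R P (?l 0))) (at 0)"
    using lv by (intro has_vector_derivative_add has_vector_derivative_scaleR)
      (auto simp: has_real_derivative_iff_has_vector_derivative intro!: derivative_eq_intros)
  then have "(?g has_vector_derivative v) (at 0)" using pD by simp
  moreover have "smooth_on {-e<..<e} ?g"
    by (intro smooth_on_add l smooth_on_scaleR smooth_on_diff smooth_on_inverse Fl smooth_on_const
        smooth_on_bounded_linear[OF blP]) (use lD F_pos in force)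
  moreover have "?g t \<in> S" if "t \<in> {-e<..<e}" for t
    using scale_D[OF lD[OF that], of "inverse (F (?l t))"] F_scale[OF lD[OF that], of "inverse (F (?l t))"]
      F_pos[OF lD[OF that]] by (auto simp: S_def)
  ultimately show "v \<in> tangent_space S p"
    unfolding tangent_space_def using e(1) pD by (intro CollectI exI[of _ ?g] exI[of _ e]) auto
qed

end

section \<open>Gaussian curvature\<close>

text \<open>The normal field is conjugated by \<open>L\<close> and the principal directions are
  mapped by \<open>L\<close>, with unchanged principal curvatures. Linearity keeps the origin fixed,
  hence also the meaning of a normal pointing away from it.\<close>

lemma gauss_curvature_isometry:
  fixes L :: "'v::euclidean_space \<Rightarrow> 'w::euclidean_space"
  assumes L: "linear L" "bij L" and iso: "\<And>v w. ip' (L v) (L w) = ip v w"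
    and gc: "has_gauss_curvature ip S p \<kappa>"
  shows "has_gauss_curvature ip' (L ` S) (L p) \<kappa>"
proof -
  define M where "M = inv L"
  have inv_L: "M (L v) = v" for v unfolding M_def using L(2) by (simp add: bij_is_inj)
  have L_inv: "L (M w) = w" for w unfolding M_def using L(2) by (simp add: bij_is_surj surj_f_inv_f)
  have M: "linear M"
  proof (rule linearI)
    show "M (x + y) = M x + M y" for x y
      using inv_L[of "M x + M y"] by (simp add: linear_add[OF L(1)] L_inv)
    show "M (c *\<^sub>R x) = c *\<^sub>R M x" for c x
      using inv_L[of "c *\<^sub>R M x"] by (simp add: linear_scale[OF L(1)] L_inv)
  qed
  have blL: "bounded_linear L" and blM: "bounded_linear M"
    using L M by (simp_all add: linear_conv_bounded_linear)
  have tang: "tangent_space (L ` S) (L q) = L ` tangent_space S q" for q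
  proof (intro equalityI subsetI)
    fix w assume "w \<in> tangent_space (L ` S) (L q)"
    from tangent_space_linear_image[OF M this] have "M w \<in> tangent_space S q"
      by (simp add: image_image inv_L)
    then show "w \<in> L ` tangent_space S q" using L_inv by (metis imageI)
  qed (use tangent_space_linear_image[OF L(1)] in auto)
  from gc obtain W N B k where W: "open W" "p \<in> W" and N: "smooth_on W N"
    and n': "\<forall>q\<in>S \<inter> W. ip (N q) (N q) = 1 \<and> (\<forall>v\<in>tangent_space S q. ip (N q) v = 0) \<and> ip (N q) q > 0"
    and B: "span B = tangent_space S p" "\<forall>v\<in>B. \<forall>w\<in>B. ip v w = (if v = w then 1 else 0)"
    and k: "\<forall>v\<in>B. frechet_derivative N (at p) v = k v *\<^sub>R v" "\<kappa> = (\<Prod>v\<in>B. k v)"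
    unfolding has_gauss_curvature_def by (elim exE conjE)
  note n = bspec[OF n']
  let ?N = "\<lambda>q. L (N (M q))"
  have "(N has_derivative frechet_derivative N (at p)) (at (M (L p)))"
    using smooth_on_has_derivative[OF N W] by (simp add: inv_L)
  from has_derivative_compose[OF bounded_linear_imp_has_derivative[OF blM] this]
  have "((\<lambda>q. N (M q)) has_derivative (\<lambda>v. frechet_derivative N (at p) (M v))) (at (L p))" .
  then have "(?N has_derivative (\<lambda>v. L (frechet_derivative N (at p) (M v)))) (at (L p))"
    by (rule bounded_linear.has_derivative[OF blL])
  then have dN: "frechet_derivative ?N (at (L p)) = (\<lambda>v. L (frechet_derivative N (at p) (M v)))"
    by (metis frechet_derivative_at)
  show ?thesis
    unfolding has_gauss_curvature_def
  proof (intro exI conjI ballI)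
    show "open (M -` W)"
      by (rule open_vimage[OF W(1)]) (simp add: blM linear_continuous_on)
    show "L p \<in> M -` W" using W by (simp add: inv_L)
    show "smooth_on (M -` W) ?N"
      by (intro smooth_on_bounded_linear[OF blL] smooth_on_compose[OF N smooth_on_linear[OF M]]) auto
    show "span (L ` B) = tangent_space (L ` S) (L p)"
      using L(1) B(1) by (simp add: tang span_linear_image)
    show "\<kappa> = (\<Prod>v\<in>L ` B. (k \<circ> M) v)"
      using k(2) L(2) by (subst prod.reindex) (auto simp: inv_L intro: inj_on_subset[OF bij_is_inj])
  next
    fix v assume "v \<in> L ` B"
    then show "frechet_derivative ?N (at (L p)) v = (k \<circ> M) v *\<^sub>R v"
      using k(1) L(1) by (auto simp: dN inv_L linear_scale)
  next
    fix v w assume "v \<in> L ` B" "w \<in> L ` B"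
    then show "ip' v w = (if v = w then 1 else 0)"
      using B(2) by (auto simp: iso)
  next
    fix q assume "q \<in> L ` S \<inter> M -` W"
    then obtain s where s: "q = L s" "s \<in> S \<inter> W" by (auto simp: inv_L)
    show "ip' (L (N (M q))) (L (N (M q))) = 1" "ip' (L (N (M q))) q > 0"
      using n[OF s(2)] s(1) by (auto simp: inv_L iso)
    fix v assume "v \<in> tangent_space (L ` S) q"
    then show "ip' (L (N (M q))) v = 0"
      using n[OF s(2)] s(1) by (auto simp: inv_L iso tang)
  qed
qed

text \<open>Comparing coefficients in the independent set \<open>B\<close>: an eigenvector for
  \<open>\<mu>\<close> has no component along members of \<open>B\<close> with another
  eigenvalue.\<close>

lemma eigenvector_span:
  fixes B :: "'v::real_vector set"
  assumes "independent B" "finite B" "linear L" "\<And>b. b \<in> B \<Longrightarrow> L b = k b *\<^sub>R b"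
  shows "span {b \<in> B. k b = \<mu>} = {v \<in> span B. L v = \<mu> *\<^sub>R v}"
proof (intro equalityI subsetI)
  fix v assume v: "v \<in> span {b \<in> B. k b = \<mu>}"
  have "subspace {v \<in> span B. L v = \<mu> *\<^sub>R v}"
    using assms(3) by (auto simp: subspace_def span_zero span_add span_scale linear_0 linear_add linear_scale scaleR_add_right)
  then show "v \<in> {v \<in> span B. L v = \<mu> *\<^sub>R v}"
    by (rule subsetD[OF span_minimal v, rotated]) (use assms(4) in \<open>auto intro: span_base\<close>)
next
  fix v assume "v \<in> {v \<in> span B. L v = \<mu> *\<^sub>R v}"
  then obtain c where v: "v = (\<Sum>b\<in>B. c b *\<^sub>R b)" and Lv: "L v = \<mu> *\<^sub>R v"
    using span_finite[OF assms(2)] by auto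
  have "L v = (\<Sum>b\<in>B. (c b * k b) *\<^sub>R b)"
    unfolding v linear_sum[OF assms(3)] using assms by (intro sum.cong) (auto simp: linear_scale)
  moreover have "\<mu> *\<^sub>R v = (\<Sum>b\<in>B. (c b * \<mu>) *\<^sub>R b)"
    unfolding v by (simp add: scaleR_sum_right mult.commute)
  ultimately have "(\<Sum>b\<in>B. (c b * k b - c b * \<mu>) *\<^sub>R b) = 0"
    using Lv by (simp add: scaleR_diff_left sum_subtractf)
  then have "c b * k b - c b * \<mu> = 0" if "b \<in> B" for b
    using independentD[OF assms(1,2) subset_refl _ that, of "\<lambda>b. c b * k b - c b * \<mu>"] by blast
  then have c: "c b = 0" if "b \<in> B" "k b \<noteq> \<mu>" for b
    using that by (auto simp: right_diff_distrib[symmetric])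
  have "v = (\<Sum>b\<in>{b\<in>B. k b = \<mu>}. c b *\<^sub>R b)"
    unfolding v by (rule sum.mono_neutral_right) (use assms(2) c in auto)
  also have "\<dots> \<in> span {b \<in> B. k b = \<mu>}"
    by (intro span_sum span_scale span_base)
  finally show "v \<in> span {b \<in> B. k b = \<mu>}" .
qed

text \<open>The multiplicity of each eigenvalue is the dimension of its eigenspace, which depends
  only on the common restriction of the two maps to the common span; outside the span they may
  differ.\<close>

lemma eigenvalue_prod_unique:
  fixes B1 B2 :: "'v::real_vector set"
  assumes "independent B1" "finite B1" "linear L1" "\<And>b. b \<in> B1 \<Longrightarrow> L1 b = k1 b *\<^sub>R b"
    and "independent B2" "finite B2" "linear L2" "\<And>b. b \<in> B2 \<Longrightarrow> L2 b = k2 b *\<^sub>R b"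
    and "span B1 = span B2" "\<And>v. v \<in> span B1 \<Longrightarrow> L1 v = L2 v"
  shows "(\<Prod>b\<in>B1. k1 b) = (\<Prod>b\<in>B2. k2 b)"
proof -
  have "span {b \<in> B1. k1 b = \<mu>} = span {b \<in> B2. k2 b = \<mu>}" for \<mu>
    using eigenvector_span[OF assms(1-4), where \<mu>=\<mu>] eigenvector_span[OF assms(5-8), where \<mu>=\<mu>] assms(9,10)
    by auto
  moreover have "independent {b \<in> B1. k1 b = \<mu>}" "independent {b \<in> B2. k2 b = \<mu>}" for \<mu>
    by (rule independent_mono[OF assms(1)], blast) (rule independent_mono[OF assms(5)], blast)
  ultimately have card: "card {b \<in> B1. k1 b = \<mu>} = card {b \<in> B2. k2 b = \<mu>}" for \<mu>
    using dim_eq_card_independent[of "{b \<in> B1. k1 b = \<mu>}"] dim_eq_card_independent[of "{b \<in> B2. k2 b = \<mu>}"]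
      dim_span[of "{b \<in> B1. k1 b = \<mu>}"] dim_span[of "{b \<in> B2. k2 b = \<mu>}"] by presburger
  \<comment> \<open>Eigenvalues are the numbers with nonzero multiplicity, so both the index set and
    the factors of the grouped product are functions of the multiplicities.\<close>
  have im: "k ` B = {\<mu>. card {b \<in> B. k b = \<mu>} \<noteq> 0}" if "finite B" for B :: "'v set" and k :: "'v \<Rightarrow> real"
    using that by auto
  have pr: "(\<Prod>b\<in>B. k b) = (\<Prod>\<mu>\<in>k ` B. \<mu> ^ card {b \<in> B. k b = \<mu>})" if "finite B" for B :: "'v set" and k :: "'v \<Rightarrow> real"
  proof -
    have "(\<Prod>b\<in>B. k b) = (\<Prod>\<mu>\<in>k ` B. \<Prod>b\<in>{b \<in> B. k b = \<mu>}. k b)"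
      by (rule prod.image_gen[OF that])
    also have "\<dots> = (\<Prod>\<mu>\<in>k ` B. \<mu> ^ card {b \<in> B. k b = \<mu>})"
      by (intro prod.cong refl) simp
    finally show ?thesis .
  qed
  show ?thesis
    unfolding pr[OF assms(2)] pr[OF assms(6)] im[OF assms(2)] im[OF assms(6)] card ..
qed

text \<open>Three inner products occur besides \<open>\<bullet>\<close>: the fibre metric in a
  trivialisation, the base metric in a chart, and their sum, the metric \<open>G\<close> in adapted
  components.\<close>

locale inner_form =
  fixes ip :: "'v::euclidean_space \<Rightarrow> 'v \<Rightarrow> real"
  assumes bilinear_ip: "bilinear ip"
    and ip_sym: "ip v w = ip w v"
    and ip_pos: "v \<noteq> 0 \<Longrightarrow> ip v v > 0"
begin

lemma linear_ip: "linear (ip v)" "linear (\<lambda>w. ip w v)"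
  using bilinear_ip by (auto simp: bilinear_def)

lemmas ip_simps = linear_add[OF linear_ip(1)] linear_add[OF linear_ip(2)]
  linear_scale[OF linear_ip(1)] linear_scale[OF linear_ip(2)]
  linear_diff[OF linear_ip(1)] linear_diff[OF linear_ip(2)]
  linear_0[OF linear_ip(1)] linear_0[OF linear_ip(2)]

lemma ip_eq_0: "ip v v = 0 \<longleftrightarrow> v = 0"
  using ip_pos[of v] ip_simps(7) by fastforce

lemma ip_nondegenerate: "(\<And>w. ip v w = ip v' w) \<Longrightarrow> v = v'"
  using ip_eq_0[of "v - v'"] by (simp add: ip_simps)

definition orthonormal where
  "orthonormal B \<longleftrightarrow> (\<forall>v\<in>B. \<forall>w\<in>B. ip v w = (if v = w then 1 else 0))"

lemma orthonormal_sum: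
  assumes "orthonormal B" "finite B" "w \<in> B"
  shows "ip w (\<Sum>v\<in>B. c v *\<^sub>R v) = c w"
proof -
  have "ip w (\<Sum>v\<in>B. c v *\<^sub>R v) = (\<Sum>v\<in>B. c v * ip w v)"
    by (simp add: linear_sum[OF linear_ip(1)] ip_simps)
  also have "\<dots> = (\<Sum>v\<in>B. if v = w then c w else 0)"
    using assms by (intro sum.cong) (auto simp: orthonormal_def)
  also have "\<dots> = c w" using assms by simp
  finally show ?thesis .
qed

lemma orthonormal_independent:
  assumes "orthonormal B" shows "independent B"
  unfolding dependent_explicit
proof safe
  fix t u v assume t: "finite t" "t \<subseteq> B" "(\<Sum>v\<in>t. u v *\<^sub>R v) = 0" and v: "v \<in> t" "u v \<noteq> 0"
  have "orthonormal t" using assms t(2) unfolding orthonormal_def by (meson subsetD)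
  from orthonormal_sum[OF this t(1) v(1), of u] have "u v = 0" by (simp add: t ip_simps)
  with v show False by simp
qed

text \<open>One Gram-Schmidt step for each vector; a vector whose orthogonal remainder vanishes is
  dropped.\<close>

lemma orthonormal_span_exists:
  assumes "finite A"
  shows "\<exists>B. finite B \<and> span B = span A \<and> orthonormal B"
  using assms
proof induction
  case empty
  then show ?case by (intro exI[of _ "{}"]) (simp add: orthonormal_def)
next
  case (insert a A)
  then obtain B where B: "finite B" "span B = span A" "orthonormal B" by blast
  define w where "w = a - (\<Sum>b\<in>B. ip b a *\<^sub>R b)"
  have sB: "(\<Sum>b\<in>B. ip b a *\<^sub>R b) \<in> span B"
    by (intro span_sum span_scale span_base)
  have span_a: "span (insert a A) = span (insert w B)"
  proof -
    have "span (insert a A) = span (insert a B)"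
      by (metis B(2) span_insert)
    also have "\<dots> = span (insert w B)"
      unfolding w_def by (rule eq_span_insert_eq) (use sB in simp)
    finally show ?thesis .
  qed
  have wB: "ip b w = 0" if "b \<in> B" for b
    unfolding w_def using orthonormal_sum[OF B(3,1) that] by (simp add: ip_simps)
  show ?case
  proof (cases "w = 0")
    case True
    then have "span (insert a A) = span B"
      using span_a by (metis span_insert_0)
    with B show ?thesis by metis
  next
    case False
    define z where "z = (1 / sqrt (ip w w)) *\<^sub>R w"
    have pos: "ip w w > 0" using False ip_pos by simp
    have z: "ip z z = 1" "\<And>b. b \<in> B \<Longrightarrow> ip b z = 0" "\<And>b. b \<in> B \<Longrightarrow> ip z b = 0"
      using pos wB ip_sym by (auto simp: z_def ip_simps field_simps)
    have "z \<notin> B" using z by fastforce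
    have "span (insert z B) = span (insert w B)"
    proof -
      have "span (insert (c *\<^sub>R w) B) = span (insert w B)" if "c \<noteq> 0" for c
      proof (intro equalityI; rule span_minimal; (rule subspace_span)?)
        show "insert (c *\<^sub>R w) B \<subseteq> span (insert w B)"
          by (auto intro: span_base span_scale)
        have "c *\<^sub>R w \<in> span (insert (c *\<^sub>R w) B)" by (intro span_base) simp
        then have "(1 / c) *\<^sub>R c *\<^sub>R w \<in> span (insert (c *\<^sub>R w) B)" by (rule span_scale)
        then show "insert w B \<subseteq> span (insert (c *\<^sub>R w) B)"
          using that by (auto intro: span_base)
      qed
      then show ?thesis using pos by (simp add: z_def)
    qed
    moreover have "orthonormal (insert z B)"
      using B(3) z by (auto simp: orthonormal_def)
    ultimately show ?thesis using B(1) span_a by (intro exI[of _ "insert z B"]) auto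
  qed
qed

text \<open>The tangent hyperplanes miss the position vector, so the sign condition selects one of
  the two unit normals and both normal fields agree on \<open>S\<close>, though perhaps not off it.
  Tangential derivatives see only values on \<open>S\<close>, so the shape operators agree on the
  tangent space.\<close>

lemma gauss_curvature_unique:
  assumes T: "\<And>q. q \<in> S \<Longrightarrow> \<exists>f :: 'v \<Rightarrow> real. linear f \<and> f q \<noteq> 0 \<and> tangent_space S q = {v. f v = 0}"
    and p: "p \<in> S"
    and gc: "has_gauss_curvature ip S p \<kappa>" "has_gauss_curvature ip S p \<kappa>'"
  shows "\<kappa> = \<kappa>'"
proof -
  from gc(1) obtain W1 N1 B1 k1 where W1: "open W1" "p \<in> W1" and N1: "smooth_on W1 N1"
    and n1': "\<forall>q\<in>S \<inter> W1. ip (N1 q) (N1 q) = 1 \<and> (\<forall>v\<in>tangent_space S q. ip (N1 q) v = 0) \<and> ip (N1 q) q > 0"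
    and B1: "span B1 = tangent_space S p" "orthonormal B1"
    and k1': "\<forall>v\<in>B1. frechet_derivative N1 (at p) v = k1 v *\<^sub>R v" and k1_prod: "\<kappa> = (\<Prod>v\<in>B1. k1 v)"
    unfolding has_gauss_curvature_def orthonormal_def by (elim exE conjE)
  note n1 = bspec[OF n1'] and k1 = bspec[OF k1']
  from gc(2) obtain W2 N2 B2 k2 where W2: "open W2" "p \<in> W2" and N2: "smooth_on W2 N2"
    and n2': "\<forall>q\<in>S \<inter> W2. ip (N2 q) (N2 q) = 1 \<and> (\<forall>v\<in>tangent_space S q. ip (N2 q) v = 0) \<and> ip (N2 q) q > 0"
    and B2: "span B2 = tangent_space S p" "orthonormal B2"
    and k2': "\<forall>v\<in>B2. frechet_derivative N2 (at p) v = k2 v *\<^sub>R v" and k2_prod: "\<kappa>' = (\<Prod>v\<in>B2. k2 v)"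
    unfolding has_gauss_curvature_def orthonormal_def by (elim exE conjE)
  note n2 = bspec[OF n2'] and k2 = bspec[OF k2']
  have N12: "N1 q = N2 q" if q: "q \<in> S" "q \<in> W1" "q \<in> W2" for q
  proof -
    obtain f :: "'v \<Rightarrow> real" where f: "linear f" "f q \<noteq> 0" "tangent_space S q = {v. f v = 0}"
      using T[OF q(1)] by blast
    \<comment> \<open>Every vector is tangential up to a multiple of \<open>q\<close>, so each
      normal is determined by its pairing with \<open>q\<close>; unit length then forces the two
      positive pairings to be equal.\<close>
    define a1 where "a1 = ip (N1 q) q"
    define a2 where "a2 = ip (N2 q) q"
    have a: "a1 > 0" "a2 > 0" using n1[of q] n2[of q] q by (auto simp: a1_def a2_def)
    have tang: "v - (f v / f q) *\<^sub>R q \<in> tangent_space S q" for v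
      using f by (simp add: linear_diff linear_scale)
    have e1: "ip (N1 q) v = (f v / f q) * a1" for v
      using n1[of q] q tang[of v] by (auto simp: ip_simps a1_def)
    have e2: "ip (N2 q) v = (f v / f q) * a2" for v
      using n2[of q] q tang[of v] by (auto simp: ip_simps a2_def)
    have eq: "a2 *\<^sub>R N1 q = a1 *\<^sub>R N2 q"
      by (rule ip_nondegenerate) (simp add: ip_simps e1 e2)
    have "a2\<^sup>2 = ip (a2 *\<^sub>R N1 q) (a2 *\<^sub>R N1 q)"
      using n1[of q] q by (simp add: ip_simps power2_eq_square)
    also have "\<dots> = a1\<^sup>2"
      unfolding eq using n2[of q] q by (simp add: ip_simps power2_eq_square)
    finally have "a1 = a2" using a by simp
    with eq a show ?thesis by simp
  qed
  have dN: "frechet_derivative N1 (at p) v = frechet_derivative N2 (at p) v" if "v \<in> tangent_space S p" for v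
  proof -
    from that obtain \<gamma> \<epsilon> where g: "0 < (\<epsilon>::real)" "\<And>t. \<bar>t\<bar> < \<epsilon> \<Longrightarrow> \<gamma> t \<in> S" "\<gamma> 0 = p"
      "(\<gamma> has_vector_derivative v) (at 0)" by (rule tangent_spaceE) blast
    have 1: "((\<lambda>t. N1 (\<gamma> t)) has_vector_derivative frechet_derivative N1 (at p) v) (at 0)"
      using g W1 by (intro has_vector_derivative_chain[where f=N1 and \<gamma>=\<gamma>]) (simp_all add: smooth_on_has_derivative[OF N1])
    have 2: "((\<lambda>t. N2 (\<gamma> t)) has_vector_derivative frechet_derivative N2 (at p) v) (at 0)"
      using g W2 by (intro has_vector_derivative_chain[where f=N2 and \<gamma>=\<gamma>]) (simp_all add: smooth_on_has_derivative[OF N2])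
    have "open (W1 \<inter> W2)" "\<gamma> 0 \<in> W1 \<inter> W2" using g W1 W2 by auto
    from curve_in_open[OF g(4) this] obtain \<delta> where "\<delta> > 0" "\<And>t. \<bar>t\<bar> < \<delta> \<Longrightarrow> \<gamma> t \<in> W1 \<inter> W2"
      by blast
    then have "((\<lambda>t. N2 (\<gamma> t)) has_vector_derivative frechet_derivative N1 (at p) v) (at 0)"
      using g N12 by (intro has_vector_derivative_transform_within_open[OF 1, of "{-min \<delta> \<epsilon><..<min \<delta> \<epsilon>}"]) auto
    with 2 show ?thesis by (rule vector_derivative_unique_at[rotated])
  qed
  have fin: "finite B1" "finite B2"
    using B1(2) B2(2) orthonormal_independent independent_bound by blast+
  show ?thesis
    unfolding k1_prod k2_prod
    by (rule eigenvalue_prod_unique[OF orthonormal_independent[OF B1(2)] fin(1) _ _ orthonormal_independent[OF B2(2)] fin(2),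
          where ?L1.0="frechet_derivative N1 (at p)" and ?L2.0="frechet_derivative N2 (at p)"])
      (simp_all add: k1 k2 B1 B2 dN linear_frechet_derivative smooth_on_differentiable[OF N1 W1] smooth_on_differentiable[OF N2 W2])
qed

text \<open>In finite dimension the map from \<open>w\<close> to the functional \<open>ip w\<close>
  is injective, hence surjective. This provides the normal of a graph as a gradient of
  \<open>rgauge\<close>.\<close>

lemma riesz:
  fixes f :: "'v \<Rightarrow> real"
  assumes "linear f" shows "\<exists>w. \<forall>v. ip w v = f v"
proof -
  let ?T = "\<lambda>w. \<Sum>b\<in>Basis. ip w b *\<^sub>R b"
  have "linear ?T"
    by (rule linearI) (simp_all add: ip_simps scaleR_left_distrib sum.distrib scaleR_sum_right)
  moreover have Tv: "?T w \<bullet> v = ip w v" for w v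
  proof -
    have "ip w v = ip w (\<Sum>b\<in>Basis. (v \<bullet> b) *\<^sub>R b)" by (simp add: euclidean_representation)
    also have "\<dots> = ?T w \<bullet> v"
      by (simp add: linear_sum[OF linear_ip(1)] ip_simps inner_sum_left inner_commute[of v] mult.commute)
    finally show ?thesis by simp
  qed
  moreover have "inj ?T"
  proof (rule injI)
    fix w w' assume "?T w = ?T w'"
    then show "w = w'" by (intro ip_nondegenerate) (metis Tv)
  qed
  ultimately have "surj ?T" by (intro linear_inj_imp_surj)
  from surjD[OF this, of "\<Sum>b\<in>Basis. f b *\<^sub>R b"] obtain w where w: "?T w = (\<Sum>b\<in>Basis. f b *\<^sub>R b)"
    by auto
  have "ip w v = f v" for v
  proof -
    have "f v = f (\<Sum>b\<in>Basis. (v \<bullet> b) *\<^sub>R b)" by (simp add: euclidean_representation)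
    also have "\<dots> = (\<Sum>b\<in>Basis. f b *\<^sub>R b) \<bullet> v"
      by (simp add: linear_sum[OF assms] linear_scale[OF assms] inner_sum_left inner_commute[of v] mult.commute)
    also have "\<dots> = ip w v" unfolding w[symmetric] by (rule Tv)
    finally show ?thesis by simp
  qed
  then show ?thesis by blast
qed

lemma bounded_bilinear_ip: "bounded_bilinear ip"
  using bilinear_ip bilinear_conv_bounded_bilinear by blast

lemma ip_self_derivative: "((\<lambda>y. ip y y) has_derivative (\<lambda>v. 2 * ip y v)) (at y)"
  using bounded_bilinear.FDERIV[OF bounded_bilinear_ip has_derivative_ident has_derivative_ident, of y UNIV]
  by (simp add: ip_sym[of _ y])

text \<open>The normal field \<open>q / r\<close> is linear and its derivative is a multiple of the
  identity, so any orthonormal basis of the tangent space consists of principal directions.\<close>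

lemma gauss_curvature_sphere:
  assumes "r > 0" and p: "ip p p = r\<^sup>2"
  shows "has_gauss_curvature ip {y. ip y y = r\<^sup>2} p ((1 / r) ^ (DIM('v) - 1))"
proof -
  let ?F = "\<lambda>y. sqrt (ip y y) / r"
  interpret radial_level "-{0}" "\<lambda>v. v" ?F
  proof
    show "smooth_on (-{0}) ?F"
      using \<open>r > 0\<close> ip_pos
      by (intro smooth_on_divide smooth_on_sqrt smooth_on_bilinear[OF bounded_bilinear_ip] smooth_on_ident smooth_on_const) auto
    fix q :: 'v and s :: real assume q: "q \<in> -{0}"
    show "0 < ?F q" using q \<open>r > 0\<close> ip_pos by simp
    assume "s > 0"
    have "q + (s - 1) *\<^sub>R q = s *\<^sub>R q" by (simp add: scaleR_diff_left)
    then show "q + (s - 1) *\<^sub>R q \<in> -{0}" "?F (q + (s - 1) *\<^sub>R q) = s * ?F q"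
      using q \<open>s > 0\<close> by (auto simp: ip_simps real_sqrt_mult)
  qed (auto intro: linear_ident)
  have S: "S = {y. ip y y = r\<^sup>2}"
  proof (intro equalityI subsetI)
    fix y assume "y \<in> S"
    then have "ip y y > 0" "sqrt (ip y y) = r" using \<open>r > 0\<close> by (auto simp: S_def ip_pos)
    then show "y \<in> {y. ip y y = r\<^sup>2}" by auto
  next
    fix y assume "y \<in> {y. ip y y = r\<^sup>2}"
    then show "y \<in> S" using \<open>r > 0\<close> by (auto simp: S_def ip_simps)
  qed
  have tan_eq: "tangent_space S q = {v. ip q v = 0}" if "q \<in> S" for q
  proof -
    have q: "ip q q = r\<^sup>2" using that S by simp
    have "(?F has_derivative (\<lambda>v. ip q v / r\<^sup>2)) (at q)"
      using \<open>r > 0\<close> q by (auto intro!: derivative_eq_intros has_derivative_compose[OF ip_self_derivative] simp: field_simps power2_eq_square)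
    then have "frechet_derivative ?F (at q) = (\<lambda>v. ip q v / r\<^sup>2)" by (metis frechet_derivative_at)
    then show ?thesis using tangent_space_S[OF that] \<open>r > 0\<close> by simp
  qed
  have pS: "p \<in> S" using p S by simp
  have p0: "p \<noteq> 0" using pS by (auto simp: S_def)
  \<comment> \<open>Writing \<open>ip p\<close> as a Euclidean product with \<open>a\<close> turns
    the tangent space into a Euclidean hyperplane, whose dimension is known.\<close>
  define a where "a = (\<Sum>b\<in>Basis. ip p b *\<^sub>R b)"
  have a: "ip p v = a \<bullet> v" for v
  proof -
    have "ip p v = ip p (\<Sum>b\<in>Basis. (v \<bullet> b) *\<^sub>R b)" by (simp add: euclidean_representation)
    also have "\<dots> = (\<Sum>b\<in>Basis. (v \<bullet> b) * ip p b)"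
      by (simp add: linear_sum[OF linear_ip(1)] ip_simps)
    also have "\<dots> = a \<bullet> v"
      by (simp add: a_def inner_sum_left inner_commute[of v] mult.commute)
    finally show ?thesis .
  qed
  have "a \<noteq> 0" using a[of p] p \<open>r > 0\<close> by auto
  have "subspace (tangent_space S p)"
    unfolding tan_eq[OF pS] a by (rule subspace_hyperplane)
  then have sp: "span (tangent_space S p) = tangent_space S p" by simp
  obtain A where A0: "A \<subseteq> tangent_space S p" "independent A" "tangent_space S p \<subseteq> span A"
    by (rule basis_exists[of "tangent_space S p"])
  have A: "finite A" by (rule finiteI_independent[OF A0(2)])
  have "span A = tangent_space S p"
    using span_mono[OF A0(1)] A0(3) sp by (intro equalityI) simp_all
  then obtain B where B: "finite B" "span B = tangent_space S p" "orthonormal B"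
    using orthonormal_span_exists[OF A] by auto
  have "card B = dim (span B)"
    using orthonormal_independent[OF B(3)] by (simp add: dim_eq_card_independent)
  also have "\<dots> = DIM('v) - 1"
    unfolding B(2) tan_eq[OF pS] a by (rule dim_hyperplane[OF \<open>a \<noteq> 0\<close>])
  finally have card: "card B = DIM('v) - 1" .
  have lin: "linear (\<lambda>q::'v. (1 / r) *\<^sub>R q)" by (rule linear_scale_self)
  have "((\<lambda>q::'v. (1 / r) *\<^sub>R q) has_derivative (\<lambda>v. (1 / r) *\<^sub>R v)) (at p)"
    by (auto intro!: derivative_eq_intros)
  then have dN: "frechet_derivative (\<lambda>q::'v. (1 / r) *\<^sub>R q) (at p) = (\<lambda>v. (1 / r) *\<^sub>R v)"
    by (metis frechet_derivative_at)
  show ?thesis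
    unfolding has_gauss_curvature_def S[symmetric]
  proof (intro exI conjI)
    show "open (UNIV :: 'v set)" "p \<in> UNIV" by auto
    show "smooth_on UNIV (\<lambda>q::'v. (1 / r) *\<^sub>R q)" by (rule smooth_on_linear[OF lin])
    show "\<forall>q\<in>S \<inter> UNIV. ip ((1 / r) *\<^sub>R q) ((1 / r) *\<^sub>R q) = 1 \<and>
      (\<forall>v\<in>tangent_space S q. ip ((1 / r) *\<^sub>R q) v = 0) \<and> 0 < ip ((1 / r) *\<^sub>R q) q"
    proof
      fix q assume "q \<in> S \<inter> UNIV"
      then have "q \<in> S" "ip q q = r\<^sup>2" using S by auto
      then show "ip ((1 / r) *\<^sub>R q) ((1 / r) *\<^sub>R q) = 1 \<and>
        (\<forall>v\<in>tangent_space S q. ip ((1 / r) *\<^sub>R q) v = 0) \<and> 0 < ip ((1 / r) *\<^sub>R q) q"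
        using \<open>r > 0\<close> by (simp add: tan_eq ip_simps power2_eq_square)
    qed
    show "\<forall>v\<in>B. frechet_derivative (\<lambda>q. (1 / r) *\<^sub>R q) (at p) v = (\<lambda>v. 1 / r) v *\<^sub>R v"
      by (simp add: dN)
    show "(1 / r) ^ (DIM('v) - 1) = (\<Prod>v\<in>B. (\<lambda>v. 1 / r) v)"
      by (simp add: card)
  qed (use B in \<open>auto simp: orthonormal_def\<close>)
qed

end

section \<open>A global Picard theorem\<close>

text \<open>With Lipschitz constant 1/2 the Picard operator on the whole interval
  \<open>{0..1}\<close> is already a contraction in the supremum norm, so the interval need not be
  subdivided.\<close>

lemma lipschitz_ode_solution:
  fixes f :: "real \<Rightarrow> 'a::banach \<Rightarrow> 'a"
  assumes cont: "continuous_on ({0..1} \<times> UNIV) (\<lambda>(s, y). f s y)"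
    and lip: "\<And>s y z. s \<in> {0..1} \<Longrightarrow> norm (f s y - f s z) \<le> norm (y - z) / 2"
  shows "\<exists>y. y 0 = y0 \<and> (\<forall>s\<in>{0..1}. (y has_vector_derivative f s (y s)) (at s within {0..1}))"
proof -
  define G where "G x t = y0 + integral {0..t} (\<lambda>s. f s (x s))" for x t
  have fx: "continuous_on {0..1} (\<lambda>s. f s (x s))" if "continuous_on {0..1} x" for x
  proof -
    have "continuous_on {0..1} (\<lambda>s. (s, x s))" using that by (intro continuous_intros)
    from continuous_on_compose2[OF cont this] show ?thesis by (simp add: image_subset_iff)
  qed
  have fxb: "continuous_on {0..1} (\<lambda>s. f s (apply_bcontfun x s))" for x
    by (rule fx) simp
  have G_cont: "continuous_on {0..1} (G (apply_bcontfun x))" for x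
    unfolding G_def by (intro continuous_intros indefinite_integral_continuous_1 integrable_continuous_real fxb)
  \<comment> \<open>The fixed point is sought among bounded continuous functions on the whole line;
    clamping the time to \<open>{0..1}\<close> extends the integral operator to that complete
    space.\<close>
  have bc: "(\<lambda>t. G (apply_bcontfun x) (clamp 0 1 t)) \<in> bcontfun" for x
    unfolding bcontfun_def
  proof (intro CollectI conjI clamp_bounded clamp_continuous_on)
    show "continuous_on (cbox 0 1) (G (apply_bcontfun x))" using G_cont by simp
    then show "bounded (G (apply_bcontfun x) ` cbox 0 1)"
      by (intro compact_imp_bounded compact_continuous_image) auto
  qed
  define T where "T x = Bcontfun (\<lambda>t. G (apply_bcontfun x) (clamp 0 1 t))" for x
  have T: "apply_bcontfun (T x) t = G (apply_bcontfun x) (clamp 0 1 t)" for x t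
    unfolding T_def by (simp add: Bcontfun_inverse[OF bc])
  have "dist (T x) (T y) \<le> 1 / 2 * dist x y" for x y
  proof (rule dist_bound)
    fix t :: real
    define \<tau> where "\<tau> = (clamp 0 1 t :: real)"
    have \<tau>: "0 \<le> \<tau>" "\<tau> \<le> 1" using clamp_in_interval[of 0 1 t] by (auto simp: \<tau>_def)
    have c: "continuous_on {0..\<tau>} (\<lambda>s. f s (apply_bcontfun x s))" for x
      by (rule continuous_on_subset[OF fxb]) (use \<tau> in auto)
    have "dist (apply_bcontfun (T x) t) (apply_bcontfun (T y) t)
      = norm (integral {0..\<tau>} (\<lambda>s. f s (apply_bcontfun x s) - f s (apply_bcontfun y s)))"
      unfolding T \<tau>_def[symmetric] G_def
      by (simp add: dist_norm Henstock_Kurzweil_Integration.integral_diff[OF integrable_continuous_real[OF c] integrable_continuous_real[OF c]])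
    also have "\<dots> \<le> (dist x y / 2) * (\<tau> - 0)"
    proof (rule integral_bound)
      fix s assume "s \<in> {0..\<tau>}"
      then have "s \<in> {0..1}" using \<tau> by auto
      from lip[OF this, of "apply_bcontfun x s" "apply_bcontfun y s"]
      show "norm (f s (apply_bcontfun x s) - f s (apply_bcontfun y s)) \<le> dist x y / 2"
        using dist_bounded[of x s y] by (simp add: dist_norm)
    qed (use \<tau> c in \<open>auto intro: continuous_intros\<close>)
    also have "\<dots> \<le> 1 / 2 * dist x y"
      using mult_left_mono[OF \<tau>(2), of "dist x y / 2"] by simp
    finally show "dist (apply_bcontfun (T x) t) (apply_bcontfun (T y) t) \<le> 1 / 2 * dist x y" .
  qed
  then have "\<exists>!x. T x = x"
    by (intro banach_fix_type[of "1/2"]) auto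
  then obtain x where x: "T x = x" by blast
  have xG: "apply_bcontfun x t = G (apply_bcontfun x) t" if "t \<in> {0..1}" for t
    using T[of x t] that by (simp add: x clamp_cancel_cbox)
  have "(apply_bcontfun x has_vector_derivative f s (apply_bcontfun x s)) (at s within {0..1})" if s: "s \<in> {0..1}" for s
  proof (rule has_vector_derivative_transform[OF s xG])
    show "(G (apply_bcontfun x) has_vector_derivative f s (apply_bcontfun x s)) (at s within {0..1})"
      unfolding G_def using integral_has_vector_derivative[OF fxb s]
      by (auto intro!: derivative_eq_intros)
  qed
  moreover have "apply_bcontfun x 0 = y0"
    using xG[of 0] by (simp add: G_def)
  ultimately show ?thesis by blast
qed

section \<open>Riemannian vector bundles in coordinates\<close>

lemma sum_matrix_vector_mult:
  fixes M :: "'i \<Rightarrow> real^'k^'l"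
  shows "(\<Sum>i\<in>I. M i) *v v = (\<Sum>i\<in>I. M i *v v)"
  by (rule linear_sum) (rule bounded_linear.linear[OF bounded_bilinear.bounded_linear_left[OF bounded_bilinear_matrix_vector_mult]])

lemma inner_transpose_mult: "v \<bullet> (transpose M *v w) = (M *v v) \<bullet> w" for M :: "real^'k^'l"
  by (simp add: dot_lmul_matrix[symmetric] transpose_matrix_vector inner_commute)

lemma linear_axis_expand:
  fixes f :: "real^'n \<Rightarrow> 'b::real_vector"
  assumes "linear f" shows "f a = (\<Sum>i\<in>UNIV. a $ i *\<^sub>R f (axis i 1))"
proof -
  have "a = (\<Sum>i\<in>UNIV. a $ i *\<^sub>R axis i 1)"
    by (simp add: vec_eq_iff axis_def if_distrib cong: if_cong)
  then have "f a = f (\<Sum>i\<in>UNIV. a $ i *\<^sub>R axis i 1)" by simp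
  then show ?thesis by (simp only: linear_sum[OF assms] linear_scale[OF assms])
qed

text \<open>Metric compatibility contracted with a direction and two vectors, for abstract matrices,
  so that it serves both the fibre metric with its connection and the base metric with the
  Levi-Civita connection.\<close>

lemma metric_connection_derivative:
  fixes D :: "real^'n \<Rightarrow> real^'k^'k" and H :: "real^'k^'k" and Om :: "'n \<Rightarrow> real^'k^'k"
  assumes "linear D" and D: "\<And>i. D (axis i 1) = transpose (Om i) ** H + H ** Om i"
  shows "v \<bullet> (D a *v w) = ((\<Sum>i\<in>UNIV. a $ i *\<^sub>R Om i) *v v) \<bullet> (H *v w) + v \<bullet> (H *v ((\<Sum>i\<in>UNIV. a $ i *\<^sub>R Om i) *v w))"
proof -
  have 1: "v \<bullet> (D (axis i 1) *v w) = (Om i *v v) \<bullet> (H *v w) + v \<bullet> (H *v (Om i *v w))" for i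
    unfolding D matrix_vector_mult_add_rdistrib inner_add_right matrix_vector_mul_assoc[symmetric] inner_transpose_mult ..
  have "v \<bullet> (D a *v w) = (\<Sum>i\<in>UNIV. a $ i * (v \<bullet> (D (axis i 1) *v w)))"
    by (subst linear_axis_expand[OF assms(1), of a])
      (simp add: sum_matrix_vector_mult scaleR_matrix_vector_assoc[symmetric] inner_sum_right)
  also have "\<dots> = (\<Sum>i\<in>UNIV. a $ i * ((Om i *v v) \<bullet> (H *v w))) + (\<Sum>i\<in>UNIV. a $ i * (v \<bullet> (H *v (Om i *v w))))"
    unfolding 1 distrib_left sum.distrib ..
  also have "(\<Sum>i\<in>UNIV. a $ i * ((Om i *v v) \<bullet> (H *v w))) = ((\<Sum>i\<in>UNIV. a $ i *\<^sub>R Om i) *v v) \<bullet> (H *v w)"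
    by (simp add: sum_matrix_vector_mult scaleR_matrix_vector_assoc[symmetric] inner_sum_left)
  also have "(\<Sum>i\<in>UNIV. a $ i * (v \<bullet> (H *v (Om i *v w)))) = v \<bullet> (H *v ((\<Sum>i\<in>UNIV. a $ i *\<^sub>R Om i) *v w))"
    by (simp add: sum_matrix_vector_mult scaleR_matrix_vector_assoc[symmetric] inner_sum_right
        matrix_vector_mult_scaleR linear_sum[OF matrix_vector_mul_linear])
  finally show ?thesis .
qed

lemma bounded_bilinear_matrix_matrix_mult:
  "bounded_bilinear ((**) :: real^'k^'l \<Rightarrow> real^'j^'k \<Rightarrow> real^'j^'l)"
  unfolding bilinear_conv_bounded_bilinear[symmetric] bilinear_def
  by (intro conjI allI linearI)
    (simp_all add: matrix_matrix_mult_def vec_eq_iff sum.distrib sum_distrib_left distrib_left distrib_right mult.assoc mult.left_commute)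

abbreviation (input) cdom :: "('a, 'n::finite) chart \<Rightarrow> ('a, 'e, 'm::finite) triv \<Rightarrow> (real^'n) set" where
  "cdom c t \<equiv> snd c ` (fst c \<inter> fst t)"

text \<open>Coordinates of the punctured bundle, the domain on which the degree 0 extension of a
  radial function is smooth.\<close>

abbreviation (input) cdom0 :: "('a, 'n::finite) chart \<Rightarrow> ('a, 'e, 'm::finite) triv \<Rightarrow> ((real^'n) \<times> (real^'m)) set" where
  "cdom0 c t \<equiv> cdom c t \<times> (-{0})"

locale metric_bundle =
  fixes X :: "'a topology"
    and \<A> :: "('a, 'n::finite) chart set"
    and g :: "('a, 'n) tensor2"
    and \<Gamma> :: "('a, 'n) christoffel"
    and E :: "('a, 'e, 'm::finite) vbundle"
    and h :: "'e \<Rightarrow> 'e \<Rightarrow> real"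
    and \<omega> :: "('a, 'n, 'e, 'm) bundle_christoffel"
  assumes mfd: "smooth_manifold X \<A>"
    and riem: "riemannian_metric \<A> g"
    and levi: "levi_civita \<A> g \<Gamma>"
    and bdl: "vector_bundle X \<A> E"
    and fibm: "fibre_metric X \<A> E h"
    and conn: "metric_connection \<A> E h \<omega>"
begin

section \<open>Charts, trivialisations and fibre operations\<close>

lemma chart_openin: "c \<in> \<A> \<Longrightarrow> openin X (fst c)"
  and chart_open_image: "c \<in> \<A> \<Longrightarrow> open (snd c ` fst c)"
  and chart_homeo: "c \<in> \<A> \<Longrightarrow> homeomorphic_map (subtopology X (fst c)) (top_of_set (snd c ` fst c)) (snd c)"
proof -
  have "\<forall>(U, \<phi>)\<in>\<A>. openin X U \<and> open (\<phi> ` U) \<and>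
        homeomorphic_map (subtopology X U) (top_of_set (\<phi> ` U)) \<phi>"
    using mfd unfolding smooth_manifold_def by (elim conjE)
  from bspec[OF this, of c]
  show "c \<in> \<A> \<Longrightarrow> openin X (fst c)" "c \<in> \<A> \<Longrightarrow> open (snd c ` fst c)"
    "c \<in> \<A> \<Longrightarrow> homeomorphic_map (subtopology X (fst c)) (top_of_set (snd c ` fst c)) (snd c)"
    by (simp_all add: case_prod_unfold)
qed

lemma chart_subset: "c \<in> \<A> \<Longrightarrow> fst c \<subseteq> topspace X"
  using chart_openin openin_subset by blast

lemma chart_inj: "c \<in> \<A> \<Longrightarrow> inj_on (snd c) (fst c)"
  using homeomorphic_imp_injective_map[OF chart_homeo[of c]] chart_subset[of c] by (simp add: inf.absorb2)

lemma chart_inv_left [simp]: "c \<in> \<A> \<Longrightarrow> x \<in> fst c \<Longrightarrow> chart_inv c (snd c x) = x"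
  by (simp add: chart_inj inv_into_f_f)

lemma chart_inv_right [simp]: "x \<in> snd c ` fst c \<Longrightarrow> snd c (chart_inv c x) = x"
  by (simp add: f_inv_into_f)

lemma chart_inv_in: "x \<in> snd c ` fst c \<Longrightarrow> chart_inv c x \<in> fst c"
  by (rule inv_into_into)

lemma chart_image_open:
  assumes "c \<in> \<A>" "openin X V" shows "open (snd c ` (fst c \<inter> V))"
proof -
  have "openin (subtopology X (fst c)) (fst c \<inter> V)"
    using assms(2) by (metis openin_subtopology_Int inf_commute)
  then have "openin (top_of_set (snd c ` fst c)) (snd c ` (fst c \<inter> V))"
    using homeomorphic_imp_open_map[OF chart_homeo[OF assms(1)]] by (auto simp: open_map_def)
  then show ?thesis using chart_open_image[OF assms(1)] openin_open_trans by blast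
qed

lemma chart_preimage_openin:
  assumes "c \<in> \<A>" "open W" shows "openin X {x \<in> fst c. snd c x \<in> W}"
proof -
  have "continuous_map (subtopology X (fst c)) (top_of_set (snd c ` fst c)) (snd c)"
    using chart_homeo[OF assms(1)] homeomorphic_imp_continuous_map by blast
  moreover have "openin (top_of_set (snd c ` fst c)) (snd c ` fst c \<inter> W)"
    using assms(2) by (simp add: openin_open_Int)
  ultimately have "openin (subtopology X (fst c)) {x \<in> topspace (subtopology X (fst c)). snd c x \<in> snd c ` fst c \<inter> W}"
    by (rule openin_continuous_map_preimage)
  also have "{x \<in> topspace (subtopology X (fst c)). snd c x \<in> snd c ` fst c \<inter> W} = {x \<in> fst c. snd c x \<in> W}"
    using chart_subset[OF assms(1)] by auto
  finally show ?thesis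
    using chart_openin[OF assms(1)] openin_trans_full by blast
qed

lemma triv_local:
  assumes "t \<in> trivs E"
  shows "openin X (fst t) \<and> (\<forall>x\<in>fst t. bij_betw (snd t) (fibre E x) UNIV \<and> snd t (vzero E x) = 0 \<and>
    (\<forall>\<xi>\<in>fibre E x. (\<forall>\<eta>\<in>fibre E x. snd t (vplus E \<xi> \<eta>) = snd t \<xi> + snd t \<eta>) \<and>
                     (\<forall>r. snd t (vscale E r \<xi>) = r *\<^sub>R snd t \<xi>)))"
proof -
  have "\<forall>(V, \<Phi>)\<in>trivs E. openin X V \<and>
        (\<forall>x\<in>V. bij_betw \<Phi> (fibre E x) UNIV \<and> \<Phi> (vzero E x) = 0 \<and>
           (\<forall>\<xi>\<in>fibre E x. (\<forall>\<eta>\<in>fibre E x. \<Phi> (vplus E \<xi> \<eta>) = \<Phi> \<xi> + \<Phi> \<eta>) \<and>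
                            (\<forall>r. \<Phi> (vscale E r \<xi>) = r *\<^sub>R \<Phi> \<xi>)))"
    using bdl unfolding vector_bundle_def by (elim conjE)
  from bspec[OF this assms] show ?thesis by (simp add: case_prod_unfold)
qed

lemma triv_openin: "t \<in> trivs E \<Longrightarrow> openin X (fst t)"
  by (rule conjunct1[OF triv_local])

lemma triv_subset: "t \<in> trivs E \<Longrightarrow> fst t \<subseteq> topspace X"
  using triv_openin openin_subset by blast

lemma open_dom: "c \<in> \<A> \<Longrightarrow> t \<in> trivs E \<Longrightarrow> open (cdom c t)"
  by (simp add: chart_image_open triv_openin)

lemma chart_exists: "x \<in> topspace X \<Longrightarrow> \<exists>c\<in>\<A>. x \<in> fst c"
proof -
  assume "x \<in> topspace X"
  moreover have "topspace X = \<Union>(fst ` \<A>)" using mfd unfolding smooth_manifold_def by (elim conjE)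
  ultimately show ?thesis by simp
qed

lemma triv_exists: "x \<in> topspace X \<Longrightarrow> \<exists>t\<in>trivs E. x \<in> fst t"
proof -
  assume "x \<in> topspace X"
  moreover have "topspace X = \<Union>(fst ` trivs E)" using bdl unfolding vector_bundle_def by (elim conjE)
  ultimately show ?thesis by simp
qed

lemma proj_topspace: "\<xi> \<in> total E \<Longrightarrow> proj E \<xi> \<in> topspace X"
proof -
  assume "\<xi> \<in> total E"
  moreover have "proj E ` total E \<subseteq> topspace X" using bdl unfolding vector_bundle_def by (elim conjE)
  ultimately show ?thesis by blast
qed

lemma fibre_ops:
  assumes "x \<in> topspace X"
  shows "vzero E x \<in> fibre E x"
    and "\<xi> \<in> fibre E x \<Longrightarrow> \<eta> \<in> fibre E x \<Longrightarrow> vplus E \<xi> \<eta> \<in> fibre E x"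
    and "\<xi> \<in> fibre E x \<Longrightarrow> vscale E r \<xi> \<in> fibre E x"
proof -
  have "\<forall>x\<in>topspace X. vzero E x \<in> fibre E x \<and>
        (\<forall>\<xi>\<in>fibre E x. (\<forall>\<eta>\<in>fibre E x. vplus E \<xi> \<eta> \<in> fibre E x) \<and> (\<forall>r. vscale E r \<xi> \<in> fibre E x))"
    using bdl unfolding vector_bundle_def by (elim conjE)
  from bspec[OF this assms] show "vzero E x \<in> fibre E x"
    "\<xi> \<in> fibre E x \<Longrightarrow> \<eta> \<in> fibre E x \<Longrightarrow> vplus E \<xi> \<eta> \<in> fibre E x"
    "\<xi> \<in> fibre E x \<Longrightarrow> vscale E r \<xi> \<in> fibre E x"
    by blast+
qed

lemma triv_props:
  assumes "t \<in> trivs E" "x \<in> fst t"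
  shows "bij_betw (snd t) (fibre E x) UNIV"
    and "snd t (vzero E x) = 0"
    and "\<xi> \<in> fibre E x \<Longrightarrow> \<eta> \<in> fibre E x \<Longrightarrow> snd t (vplus E \<xi> \<eta>) = snd t \<xi> + snd t \<eta>"
    and "\<xi> \<in> fibre E x \<Longrightarrow> snd t (vscale E r \<xi>) = r *\<^sub>R snd t \<xi>"
  using bspec[OF conjunct2[OF triv_local[OF assms(1)]] assms(2)] by blast+

lemma fibre_iff: "\<xi> \<in> fibre E x \<longleftrightarrow> \<xi> \<in> total E \<and> proj E \<xi> = x"
  by (simp add: fibre_def)

context
  fixes t x assumes t: "t \<in> trivs E" and x: "x \<in> fst t"
begin

lemma from_frame_in: "from_frame E t x y \<in> fibre E x"
  using triv_props(1)[OF t x] unfolding from_frame_def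
  by (metis UNIV_I bij_betw_imp_surj_on inv_into_into)

lemma triv_from_frame [simp]: "snd t (from_frame E t x y) = y"
  using triv_props(1)[OF t x] unfolding from_frame_def
  by (simp add: bij_betw_inv_into_right)

lemma from_frame_triv: "\<xi> \<in> fibre E x \<Longrightarrow> from_frame E t x (snd t \<xi>) = \<xi>"
  using triv_props(1)[OF t x] unfolding from_frame_def
  by (simp add: bij_betw_inv_into_left)

lemma x_topspace: "x \<in> topspace X" using triv_subset t x by blast

lemma from_frame_scale: "from_frame E t x (r *\<^sub>R y) = vscale E r (from_frame E t x y)"
  using from_frame_triv[OF fibre_ops(3)[OF x_topspace from_frame_in, of r y]]
  by (simp add: triv_props(4)[OF t x from_frame_in])

lemma from_frame_add: "from_frame E t x (y + z) = vplus E (from_frame E t x y) (from_frame E t x z)"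
  using from_frame_triv[OF fibre_ops(2)[OF x_topspace from_frame_in[of y] from_frame_in[of z]]]
  by (simp add: triv_props(3)[OF t x from_frame_in from_frame_in])

lemma from_frame_0: "from_frame E t x y = vzero E x \<longleftrightarrow> y = 0"
  using from_frame_triv[OF fibre_ops(1)[OF x_topspace]] triv_props(2)[OF t x] triv_from_frame by metis

lemma h_props:
  assumes "\<xi> \<in> fibre E x"
  shows "\<xi> \<noteq> vzero E x \<Longrightarrow> h \<xi> \<xi> > 0"
    and "\<eta> \<in> fibre E x \<Longrightarrow> h \<xi> \<eta> = h \<eta> \<xi>"
    and "\<eta> \<in> fibre E x \<Longrightarrow> h (vscale E r \<xi>) \<eta> = r * h \<xi> \<eta>"
    and "\<eta> \<in> fibre E x \<Longrightarrow> \<zeta> \<in> fibre E x \<Longrightarrow> h (vplus E \<xi> \<eta>) \<zeta> = h \<xi> \<zeta> + h \<eta> \<zeta>"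
proof -
  have "\<forall>x\<in>topspace X. \<forall>\<xi>\<in>fibre E x.
        (\<xi> \<noteq> vzero E x \<longrightarrow> h \<xi> \<xi> > 0) \<and>
        (\<forall>\<eta>\<in>fibre E x. h \<xi> \<eta> = h \<eta> \<xi> \<and> (\<forall>r. h (vscale E r \<xi>) \<eta> = r * h \<xi> \<eta>) \<and>
           (\<forall>\<zeta>\<in>fibre E x. h (vplus E \<xi> \<eta>) \<zeta> = h \<xi> \<zeta> + h \<eta> \<zeta>))"
    using fibm unfolding fibre_metric_def by (elim conjE)
  from bspec[OF bspec[OF this x_topspace] assms]
  show "\<xi> \<noteq> vzero E x \<Longrightarrow> h \<xi> \<xi> > 0"
    "\<eta> \<in> fibre E x \<Longrightarrow> h \<xi> \<eta> = h \<eta> \<xi>"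
    "\<eta> \<in> fibre E x \<Longrightarrow> h (vscale E r \<xi>) \<eta> = r * h \<xi> \<eta>"
    "\<eta> \<in> fibre E x \<Longrightarrow> \<zeta> \<in> fibre E x \<Longrightarrow> h (vplus E \<xi> \<eta>) \<zeta> = h \<xi> \<zeta> + h \<eta> \<zeta>"
    by blast+
qed

abbreviation "hh \<equiv> \<lambda>v w. h (from_frame E t x v) (from_frame E t x w)"

lemma hh_sym: "hh v w = hh w v"
  by (rule h_props(2)[OF from_frame_in from_frame_in])

lemma hh_linear: "linear (\<lambda>v. hh v w)"
  by (rule linearI) (simp_all add: from_frame_add from_frame_scale h_props(3,4) from_frame_in)

lemma inner_form_hh: "inner_form hh"
proof
  show "bilinear hh"
  proof -
    have "linear (\<lambda>w. hh v w)" for v using hh_linear[of v] by (simp only: hh_sym[of v])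
    then show ?thesis unfolding bilinear_def using hh_linear by blast
  qed
  show "0 < hh v v" if "v \<noteq> 0" for v
    using h_props(1)[OF from_frame_in] from_frame_0 that by simp
qed (rule hh_sym)

lemma hh_gram: "hh v w = v \<bullet> (fibre_gram E h t x *v w)"
proof -
  have e: "v = (\<Sum>i\<in>UNIV. v $ i *\<^sub>R axis i 1)" for v :: "real^'m"
    by (simp add: vec_eq_iff axis_def if_distrib cong: if_cong)
  have A: "hh v w = (\<Sum>i\<in>UNIV. v $ i * hh (axis i 1) w)" for v w
    by (subst e[of v]) (simp add: linear_sum[OF hh_linear] linear_scale[OF hh_linear])
  have B: "hh (axis i 1) w = (\<Sum>j\<in>UNIV. w $ j * hh (axis j 1) (axis i 1))" for i
    by (subst hh_sym) (rule A)
  have C: "hh (axis j 1) (axis i 1) = fibre_gram E h t x $ i $ j" for i j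
    unfolding fibre_gram_def by (subst hh_sym) simp
  have "hh v w = (\<Sum>i\<in>UNIV. v $ i * (\<Sum>j\<in>UNIV. fibre_gram E h t x $ i $ j * w $ j))"
    by (subst A) (simp only: B C mult.commute[of "w $ _"])
  then show ?thesis
    by (simp add: inner_vec_def matrix_vector_mult_def)
qed

end

lemma vscale_simps:
  assumes "\<xi> \<in> total E"
  shows "proj E (vscale E r \<xi>) = proj E \<xi>" "vscale E r \<xi> \<in> total E"
    "vscale E s (vscale E r \<xi>) = vscale E (s * r) \<xi>" "vscale E 1 \<xi> = \<xi>"
    "h (vscale E r \<xi>) (vscale E r \<xi>) = r\<^sup>2 * h \<xi> \<xi>"
    "vscale E r \<xi> = vzero E (proj E \<xi>) \<longleftrightarrow> r = 0 \<or> \<xi> = vzero E (proj E \<xi>)"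
    "h \<xi> \<xi> \<ge> 0" "h \<xi> \<xi> = 0 \<longleftrightarrow> \<xi> = vzero E (proj E \<xi>)"
proof -
  define x where "x = proj E \<xi>"
  have "x \<in> topspace X" using proj_topspace assms x_def by simp
  then obtain t where t: "t \<in> trivs E" "x \<in> fst t" using triv_exists by blast
  have xi: "\<xi> \<in> fibre E x" using assms by (simp add: fibre_iff x_def)
  define y where "y = snd t \<xi>"
  have y: "\<xi> = from_frame E t x y" using from_frame_triv[OF t xi] y_def by simp
  have vs: "vscale E r \<xi> = from_frame E t x (r *\<^sub>R y)" for r
    using from_frame_scale[OF t] y by simp
  have "from_frame E t x z \<in> fibre E x" for z by (rule from_frame_in[OF t])
  then show "proj E (vscale E r \<xi>) = proj E \<xi>" "vscale E r \<xi> \<in> total E"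
    by (auto simp: vs fibre_iff x_def)
  show "vscale E s (vscale E r \<xi>) = vscale E (s * r) \<xi>"
    unfolding vs[of r] from_frame_scale[OF t, symmetric] vs by simp
  show "vscale E 1 \<xi> = \<xi>" unfolding vs by (simp add: y[symmetric])
  show "vscale E r \<xi> = vzero E (proj E \<xi>) \<longleftrightarrow> r = 0 \<or> \<xi> = vzero E (proj E \<xi>)"
    unfolding vs x_def[symmetric] from_frame_0[OF t] using from_frame_0[OF t, of y] y by simp
  interpret inner_form "\<lambda>v w. h (from_frame E t x v) (from_frame E t x w)" by (rule inner_form_hh[OF t])
  show "h (vscale E r \<xi>) (vscale E r \<xi>) = r\<^sup>2 * h \<xi> \<xi>"
    unfolding vs by (simp add: ip_simps y power2_eq_square)
  have "h \<xi> \<xi> = 0 \<longleftrightarrow> y = 0" "y \<noteq> 0 \<Longrightarrow> h \<xi> \<xi> > 0" "y = 0 \<longleftrightarrow> \<xi> = vzero E x"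
    using ip_eq_0[of y] ip_pos[of y] from_frame_0[OF t, of y] unfolding y[symmetric] by simp_all
  then show "h \<xi> \<xi> = 0 \<longleftrightarrow> \<xi> = vzero E (proj E \<xi>)" "h \<xi> \<xi> \<ge> 0"
    unfolding x_def[symmetric] by (metis, metis less_eq_real_def)
qed

text \<open>The inverse of \<open>ecoord\<close> on coordinates over \<open>cdom c t\<close>;
  computations are made with \<open>q\<close> and carried back to the bundle by it.\<close>

definition pt :: "('a, 'n) chart \<Rightarrow> ('a, 'e, 'm) triv \<Rightarrow> (real^'n) \<times> (real^'m) \<Rightarrow> 'e" where
  "pt c t q = from_frame E t (chart_inv c (fst q)) (snd q)"

lemma domD: "x \<in> cdom c t \<Longrightarrow> chart_inv c x \<in> fst c \<and> chart_inv c x \<in> fst t \<and> snd c (chart_inv c x) = x"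
  if "c \<in> \<A>"
  using that by auto

context
  fixes c t assumes c: "c \<in> \<A>" and t: "t \<in> trivs E"
begin

lemma dom_t: "x \<in> cdom c t \<Longrightarrow> chart_inv c x \<in> fst t"
  using domD[OF c] by blast

lemma open_cdom0: "open (cdom0 c t)"
  by (intro open_Times open_dom c t) auto

lemma pt_fibre: "fst q \<in> cdom c t \<Longrightarrow> pt c t q \<in> fibre E (chart_inv c (fst q))"
  unfolding pt_def using from_frame_in t domD[OF c] by blast

lemma pt_props:
  assumes "fst q \<in> cdom c t"
  shows "pt c t q \<in> edom E c t" "ecoord E c t (pt c t q) = q" "proj E (pt c t q) = chart_inv c (fst q)"
    "pt c t q \<in> total E" "snd t (pt c t q) = snd q"
proof -
  have f: "pt c t q \<in> total E" "proj E (pt c t q) = chart_inv c (fst q)"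
    using pt_fibre[OF assms] by (simp_all add: fibre_iff)
  have s: "snd t (pt c t q) = snd q"
    unfolding pt_def by (rule triv_from_frame[OF t dom_t[OF assms]])
  have d: "chart_inv c (fst q) \<in> fst c" "snd c (chart_inv c (fst q)) = fst q"
    using domD[OF c assms] by simp_all
  show "pt c t q \<in> edom E c t" using f d dom_t[OF assms] by (simp add: edom_def)
  show "ecoord E c t (pt c t q) = q" by (simp add: ecoord_def f s d)
  show "proj E (pt c t q) = chart_inv c (fst q)" "pt c t q \<in> total E" "snd t (pt c t q) = snd q"
    by (rule f s)+
qed

lemma pt_ecoord:
  assumes "\<xi> \<in> edom E c t" shows "pt c t (ecoord E c t \<xi>) = \<xi>" "fst (ecoord E c t \<xi>) \<in> cdom c t"
  using assms c from_frame_triv[OF t, of "proj E \<xi>" \<xi>]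
  by (auto simp: edom_def ecoord_def pt_def fibre_iff)

lemma inv_ecoord:
  assumes "fst q \<in> cdom c t" shows "inv_into (edom E c t) (ecoord E c t) q = pt c t q"
proof (rule inv_into_f_eq)
  show "inj_on (ecoord E c t) (edom E c t)"
    by (rule inj_on_inverseI[of _ "pt c t"]) (rule pt_ecoord)
qed (use pt_props[OF assms] in auto)

lemma in_ecoord_iff: "q \<in> in_ecoord E c t Y \<longleftrightarrow> fst q \<in> cdom c t \<and> pt c t q \<in> Y"
proof
  assume "q \<in> in_ecoord E c t Y"
  then show "fst q \<in> cdom c t \<and> pt c t q \<in> Y" using pt_ecoord by auto
next
  assume "fst q \<in> cdom c t \<and> pt c t q \<in> Y"
  then show "q \<in> in_ecoord E c t Y" using pt_props[of q] by (metis Int_iff imageI)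
qed

lemma pt_scale:
  "fst q \<in> cdom c t \<Longrightarrow> pt c t (fst q, s *\<^sub>R snd q) = vscale E s (pt c t q)"
  unfolding pt_def using from_frame_scale[OF t dom_t] by simp

lemma pt_punctured: "fst q \<in> cdom c t \<Longrightarrow> pt c t q \<in> punctured E \<longleftrightarrow> snd q \<noteq> 0"
  using pt_props[of q] domD[OF c, of "fst q"] from_frame_0[OF t, of "chart_inv c (fst q)" "snd q"]
  by (auto simp: punctured_def pt_def)

definition "gram x = fibre_gram E h t (chart_inv c x)"

lemma smooth_gram: "smooth_on (cdom c t) gram"
proof -
  have "\<forall>t\<in>trivs E. smooth_fun \<A> (fst t) (fibre_gram E h t)"
    using fibm unfolding fibre_metric_def by (elim conjE)
  then show ?thesis using c t by (simp add: smooth_fun_def gram_def[abs_def] o_def)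
qed

lemma h_pt: "x \<in> cdom c t \<Longrightarrow> h (pt c t (x, v)) (pt c t (x, w)) = v \<bullet> (gram x *v w)"
  unfolding pt_def gram_def using hh_gram[OF t dom_t] by simp

definition "sqnorm q = snd q \<bullet> (gram (fst q) *v snd q)"

lemma sqnorm_pt: "fst q \<in> cdom c t \<Longrightarrow> sqnorm q = h (pt c t q) (pt c t q)"
  unfolding sqnorm_def using h_pt[of "fst q" "snd q" "snd q"] by simp

lemma inner_form_gram: "x \<in> cdom c t \<Longrightarrow> inner_form (\<lambda>v w. v \<bullet> (gram x *v w))"
  using inner_form_hh[OF t dom_t, of x] h_pt[of x] by (simp only: pt_def fst_conv snd_conv)

lemma sqnorm_pos: "q \<in> cdom0 c t \<Longrightarrow> sqnorm q > 0"
  unfolding sqnorm_def using inner_form.ip_pos[OF inner_form_gram, of "fst q" "snd q"] by (auto simp: mem_Times_iff)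

lemma smooth_sqnorm: "smooth_on (cdom c t \<times> UNIV) sqnorm"
proof -
  have "smooth_on (cdom c t \<times> UNIV) (\<lambda>q. gram (fst q))"
    by (rule smooth_on_compose[OF smooth_gram smooth_on_fst[OF smooth_on_ident]]) auto
  then show ?thesis unfolding sqnorm_def
    by (intro smooth_on_inner smooth_on_matrix_vector_mult smooth_on_snd smooth_on_ident)
qed

end

section \<open>Radial graphs in coordinates\<close>

text \<open>\<open>rext u\<close> extends \<open>u\<close> from the unit sphere bundle homogeneously of degree 0. Hence \<open>rgauge u\<close> is homogeneous
  of degree 1 in the fibre, and the graph of \<open>u\<close> is its level set at height 1.\<close>

definition "rext u \<xi> = u (vscale E (1 / sqrt (h \<xi> \<xi>)) \<xi>)" for u :: "'e \<Rightarrow> real"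
definition "graph u = (\<lambda>\<xi>. vscale E (exp (u \<xi>)) \<xi>) ` unit_sphere_bundle E h" for u :: "'e \<Rightarrow> real"
definition "logr u c t q = rext u (pt c t q)"
definition "rgauge u c t q = sqrt (sqnorm c t q) * exp (- logr u c t q)"

abbreviation "smooth_sphere u \<equiv> smooth_on_total \<A> E (unit_sphere_bundle E h) u"

lemma rext_scale: "\<xi> \<in> total E \<Longrightarrow> s > 0 \<Longrightarrow> rext u (vscale E s \<xi>) = rext u \<xi>"
  unfolding rext_def by (simp add: vscale_simps real_sqrt_mult)

lemma sphere_punctured: "\<xi> \<in> unit_sphere_bundle E h \<Longrightarrow> \<xi> \<in> punctured E"
  using vscale_simps(8)[of \<xi>] by (auto simp: unit_sphere_bundle_def punctured_def)

lemma punctured_pos: "\<xi> \<in> punctured E \<Longrightarrow> \<xi> \<in> total E \<and> h \<xi> \<xi> > 0"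
  using vscale_simps(7,8)[of \<xi>] by (auto simp: punctured_def order_le_less)

lemma normalize_sphere: "\<xi> \<in> punctured E \<Longrightarrow> vscale E (1 / sqrt (h \<xi> \<xi>)) \<xi> \<in> unit_sphere_bundle E h"
  using punctured_pos[of \<xi>] by (simp add: unit_sphere_bundle_def vscale_simps(1-5) power_divide)

text \<open>Normalising \<open>\<eta>\<close> recovers the point of the sphere bundle from which it
  comes, so membership becomes an equation for \<open>\<eta>\<close> alone; in coordinates this is
  the level set condition for \<open>rgauge\<close>.\<close>

lemma graph_iff: "\<eta> \<in> graph u \<longleftrightarrow> \<eta> \<in> punctured E \<and> sqrt (h \<eta> \<eta>) = exp (rext u \<eta>)"
proof
  assume "\<eta> \<in> graph u"
  then obtain \<xi> where \<xi>: "\<xi> \<in> unit_sphere_bundle E h" "\<eta> = vscale E (exp (u \<xi>)) \<xi>"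
    by (auto simp: graph_def)
  then have t: "\<xi> \<in> total E" "h \<xi> \<xi> = 1" "\<xi> \<in> punctured E"
    using sphere_punctured by (auto simp: unit_sphere_bundle_def)
  have "sqrt (h \<eta> \<eta>) = exp (u \<xi>)"
    using t by (simp add: \<xi>(2) vscale_simps)
  moreover have "rext u \<eta> = u \<xi>"
    unfolding \<xi>(2) rext_scale[OF t(1) exp_gt_zero] rext_def t(2) by (simp add: vscale_simps t)
  moreover have "\<eta> \<in> punctured E"
    using t(3) vscale_simps(6)[OF t(1), of "exp (u \<xi>)"] by (simp add: \<xi>(2) punctured_def vscale_simps)
  ultimately show "\<eta> \<in> punctured E \<and> sqrt (h \<eta> \<eta>) = exp (rext u \<eta>)" by simp
next
  assume *: "\<eta> \<in> punctured E \<and> sqrt (h \<eta> \<eta>) = exp (rext u \<eta>)"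
  then have "\<eta> \<in> total E" "h \<eta> \<eta> > 0" using punctured_pos by auto
  then have "\<eta> = vscale E (exp (rext u \<eta>)) (vscale E (1 / sqrt (h \<eta> \<eta>)) \<eta>)"
    using * by (simp add: vscale_simps)
  then show "\<eta> \<in> graph u"
    unfolding graph_def rext_def by (rule image_eqI) (rule normalize_sphere, use * in blast)
qed

context
  fixes c t assumes c: "c \<in> \<A>" and t: "t \<in> trivs E"
begin

lemma logr_scale: "fst q \<in> cdom c t \<Longrightarrow> s > 0 \<Longrightarrow> logr u c t (fst q, s *\<^sub>R snd q) = logr u c t q"
  unfolding logr_def by (simp add: pt_scale[OF c t] rext_scale pt_props[OF c t])

lemma sqnorm_scale: "sqnorm c t (x, s *\<^sub>R y) = s\<^sup>2 * sqnorm c t (x, y)"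
  by (simp add: sqnorm_def[OF c t] matrix_vector_mult_scaleR power2_eq_square)

lemma smooth_sqrt_sqnorm: "smooth_on (cdom0 c t) (\<lambda>q. sqrt (sqnorm c t q))"
  by (rule smooth_on_sqrt[OF smooth_on_subset[OF smooth_sqnorm[OF c t]] sqnorm_pos[OF c t]]) auto

text \<open>\<open>u\<close> is smooth only relative to the sphere bundle, which is not open.
  Composing with the normalisation, which maps into the sphere bundle, gives a smooth function on an
  open set.\<close>

lemma smooth_logr:
  assumes "smooth_sphere u"
  shows "smooth_on (cdom0 c t) (logr u c t)"
proof -
  let ?k = "\<lambda>q :: (real^'n) \<times> (real^'m). (fst q, (1 / sqrt (sqnorm c t q)) *\<^sub>R snd q)"
  have pk: "pt c t (?k q) = vscale E (1 / sqrt (h (pt c t q) (pt c t q))) (pt c t q)" if "q \<in> cdom0 c t" for q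
    using that by (auto simp: pt_scale[OF c t, of q] sqnorm_pt[OF c t, of q] mem_Times_iff)
  have u: "smooth_on (in_ecoord E c t (unit_sphere_bundle E h)) (u \<circ> inv_into (edom E c t) (ecoord E c t))"
    using assms c t unfolding smooth_on_total_def by blast
  have k: "smooth_on (cdom0 c t) ?k"
    by (intro smooth_on_Pair smooth_on_scaleR smooth_on_divide smooth_sqrt_sqnorm smooth_on_const
        smooth_on_fst smooth_on_snd smooth_on_ident) (use sqnorm_pos[OF c t] in force)
  have "?k ` cdom0 c t \<subseteq> in_ecoord E c t (unit_sphere_bundle E h)"
  proof
    fix z assume "z \<in> ?k ` cdom0 c t"
    then obtain q where q: "q \<in> cdom0 c t" and z: "z = ?k q" by blast
    have d: "fst q \<in> cdom c t" "snd q \<noteq> 0" using q by auto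
    have "pt c t z \<in> unit_sphere_bundle E h"
      unfolding z pk[OF q] by (rule normalize_sphere) (use pt_punctured[OF c t d(1)] d in blast)
    moreover have "fst z \<in> cdom c t" using d z by simp
    ultimately show "z \<in> in_ecoord E c t (unit_sphere_bundle E h)"
      unfolding in_ecoord_iff[OF c t] by blast
  qed
  from smooth_on_compose[OF u k this] show ?thesis
  proof (rule smooth_on_cong)
    fix q assume q: "q \<in> cdom0 c t"
    then have "fst (?k q) \<in> cdom c t" by auto
    from inv_ecoord[OF c t this] show "(u \<circ> inv_into (edom E c t) (ecoord E c t)) (?k q) = logr u c t q"
      unfolding o_def by (simp only: pk[OF q] logr_def rext_def)
  qed
qed

text \<open>Degree 1 comes from the norm alone, since \<open>logr\<close> is unchanged by dilation.
  Through this lemma the tangent spaces of a graph become kernels of the differential of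
  \<open>rgauge\<close>.\<close>

lemma radial_level_rgauge:
  assumes "smooth_sphere u"
  shows "radial_level (cdom0 c t) (\<lambda>q. (0, snd q)) (rgauge u c t)"
proof (rule radial_level.intro)
  show "linear (\<lambda>q :: (real^'n) \<times> (real^'m). ((0 :: real^'n), snd q))"
    by (rule linearI) auto
  show "smooth_on (cdom0 c t) (rgauge u c t)"
    unfolding rgauge_def by (intro smooth_on_mult smooth_sqrt_sqnorm smooth_on_exp smooth_on_uminus smooth_logr assms)
  fix q :: "(real^'n) \<times> (real^'m)" and s :: real
  assume q: "q \<in> cdom0 c t"
  show "0 < rgauge u c t q" using sqnorm_pos[OF c t q] by (simp add: rgauge_def)
  assume s: "s > 0"
  have e: "q + (s - 1) *\<^sub>R (0, snd q) = (fst q, s *\<^sub>R snd q)"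
    by (simp add: prod_eq_iff scaleR_diff_left)
  show "q + (s - 1) *\<^sub>R (0, snd q) \<in> cdom0 c t"
    unfolding e using q s by auto
  show "rgauge u c t (q + (s - 1) *\<^sub>R (0, snd q)) = s * rgauge u c t q"
    unfolding e rgauge_def using q s logr_scale[of q s u] sqnorm_scale[of "fst q" s "snd q"]
    by (auto simp: real_sqrt_mult)
qed (use open_cdom0[OF c t] in auto)

lemma in_ecoord_graph: "in_ecoord E c t (graph u) = {q \<in> cdom0 c t. rgauge u c t q = 1}"
proof (intro set_eqI)
  fix q
  show "q \<in> in_ecoord E c t (graph u) \<longleftrightarrow> q \<in> {q \<in> cdom0 c t. rgauge u c t q = 1}"
  proof (cases "fst q \<in> cdom c t")
    case True
    have "rgauge u c t q = 1 \<longleftrightarrow> sqrt (sqnorm c t q) = exp (logr u c t q)"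
      by (auto simp: rgauge_def exp_minus field_simps)
    then show ?thesis
      using True pt_punctured[OF c t True] sqnorm_pt[OF c t True]
      by (auto simp: in_ecoord_iff[OF c t] graph_iff logr_def mem_Times_iff)
  qed (auto simp: in_ecoord_iff[OF c t])
qed

lemma fibre_graph:
  assumes "x \<in> fst c" "x \<in> fst t"
  shows "snd t ` (graph u \<inter> fibre E x) = {y \<in> -{0}. rgauge u c t (snd c x, y) = 1}"
proof -
  have d: "snd c x \<in> cdom c t" using assms by auto
  have "y \<in> snd t ` (graph u \<inter> fibre E x) \<longleftrightarrow> (snd c x, y) \<in> in_ecoord E c t (graph u)" for y
  proof
    assume "y \<in> snd t ` (graph u \<inter> fibre E x)"
    then obtain \<xi> where \<xi>: "\<xi> \<in> graph u" "\<xi> \<in> fibre E x" "y = snd t \<xi>" by auto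
    then have "\<xi> \<in> edom E c t" "ecoord E c t \<xi> = (snd c x, y)"
      using assms by (auto simp: fibre_iff edom_def ecoord_def)
    then show "(snd c x, y) \<in> in_ecoord E c t (graph u)" using \<xi>(1) by (metis IntI imageI)
  next
    assume "(snd c x, y) \<in> in_ecoord E c t (graph u)"
    then have "pt c t (snd c x, y) \<in> graph u" by (simp add: in_ecoord_iff[OF c t])
    moreover have "pt c t (snd c x, y) \<in> fibre E x"
      using pt_fibre[OF c t, of "(snd c x, y)"] d c assms by simp
    moreover have "snd t (pt c t (snd c x, y)) = y"
      using pt_props(5)[OF c t, of "(snd c x, y)"] d by simp
    ultimately show "y \<in> snd t ` (graph u \<inter> fibre E x)" by (metis IntI imageI)
  qed
  then show ?thesis using d by (auto simp: in_ecoord_graph)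
qed

lemma radial_level_fibre:
  assumes u: "smooth_sphere u" and "x \<in> fst c" "x \<in> fst t"
  shows "radial_level (-{0}) (\<lambda>v. v) (\<lambda>y. rgauge u c t (snd c x, y))"
proof -
  interpret radial_level "cdom0 c t" "\<lambda>q. (0, snd q)" "rgauge u c t" by (rule radial_level_rgauge[OF u])
  have q: "(snd c x, y) \<in> cdom0 c t" if "y \<noteq> 0" for y using that assms by auto
  show ?thesis
  proof
    show "smooth_on (-{0}) (\<lambda>y. rgauge u c t (snd c x, y))"
      by (rule smooth_on_compose[OF smooth_F smooth_on_Pair[OF smooth_on_const smooth_on_ident]]) (use q in auto)
    fix y :: "real^'m" and s :: real assume y: "y \<in> -{0}"
    then show "0 < rgauge u c t (snd c x, y)" using F_pos q by auto
    assume "s > 0"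
    have "y + (s - 1) *\<^sub>R y = s *\<^sub>R y" by (simp add: scaleR_diff_left)
    then show "y + (s - 1) *\<^sub>R y \<in> -{0}" using y \<open>s > 0\<close> by auto
    show "rgauge u c t (snd c x, y + (s - 1) *\<^sub>R y) = s * rgauge u c t (snd c x, y)"
      using F_scale[OF q \<open>s > 0\<close>, of y] y by (simp add: scaleR_diff_left)
  qed (auto intro: linear_ident)
qed

end

text \<open>The graph of a smooth \<open>u\<close> is a regular level set of \<open>rgauge u\<close>
  in every coordinate system, hence a hypersurface there.\<close>

lemma radial_graph_iff: "radial_graph \<A> E h Y \<longleftrightarrow> (\<exists>u. smooth_sphere u \<and> Y = graph u)"
proof
  assume "\<exists>u. smooth_sphere u \<and> Y = graph u"
  then obtain u where u: "smooth_sphere u" "Y = graph u" by blast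
  have "hypersurface (in_ecoord E c t Y)" if c: "c \<in> \<A>" and t: "t \<in> trivs E" for c t
  proof -
    interpret radial_level "cdom0 c t" "\<lambda>q. (0, snd q)" "rgauge u c t" by (rule radial_level_rgauge[OF c t u(1)])
    show ?thesis using hypersurface_S unfolding S_def u(2) in_ecoord_graph[OF c t] .
  qed
  moreover have "Y \<subseteq> punctured E" using u(2) graph_iff by blast
  ultimately show "radial_graph \<A> E h Y"
    using u unfolding radial_graph_def graph_def by blast
qed (auto simp: radial_graph_def graph_def)

text \<open>The connection matrix in the direction \<open>a\<close>: the covariant derivative of a
  section \<open>s\<close> along \<open>a\<close> is its coordinate derivative plus
  \<open>cform c t x a *v s\<close>.\<close>

definition "cform c t x a = (\<Sum>i\<in>UNIV. a $ i *\<^sub>R \<omega> c t (chart_inv c x) i)"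
definition "adapted c t q Z = (fst Z, snd Z - cform c t (fst q) (fst Z) *v snd q)"

lemma linear_cform: "linear (cform c t x)"
  unfolding cform_def by (rule linearI) (simp_all add: scaleR_left_distrib sum.distrib scaleR_sum_right)

lemma linear_adapted: "linear (adapted c t q)"
  unfolding adapted_def
  by (rule linearI)
    (simp_all add: linear_add[OF linear_cform] linear_scale[OF linear_cform] matrix_vector_mult_add_rdistrib
      scaleR_matrix_vector_assoc[symmetric] algebra_simps)

context
  fixes c t assumes c: "c \<in> \<A>" and t: "t \<in> trivs E"
begin

lemma adapted_vec_pt:
  assumes "fst q \<in> cdom c t"
  shows "adapted_vec E \<omega> c t (pt c t q) Z = adapted c t q Z"
  by (simp add: adapted_vec_def adapted_def cform_def pt_props[OF c t assms] sum_matrix_vector_mult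
      scaleR_matrix_vector_assoc[symmetric])

lemma gram_derivative:
  assumes "x \<in> cdom c t"
  shows "(gram c t has_derivative frechet_derivative (gram c t) (at x)) (at x)"
    and "v \<bullet> (frechet_derivative (gram c t) (at x) a *v w) =
      (cform c t x a *v v) \<bullet> (gram c t x *v w) + v \<bullet> (gram c t x *v (cform c t x a *v w))"
proof -
  show d: "(gram c t has_derivative frechet_derivative (gram c t) (at x)) (at x)"
    by (rule smooth_on_has_derivative[OF smooth_gram[OF c t] open_dom[OF c t] assms])
  have gram: "gram c t = fibre_gram E h t \<circ> chart_inv c"
    by (simp add: fun_eq_iff gram_def[OF c t])
  have x: "chart_inv c x \<in> fst c \<inter> fst t" "snd c (chart_inv c x) = x"
    using domD[OF c assms] by simp_all
  have "\<forall>c\<in>\<A>. \<forall>t\<in>trivs E. \<forall>x\<in>fst c \<inter> fst t. \<forall>i.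
        pderiv_chart c i (fibre_gram E h t) x =
          transpose (\<omega> c t x i) ** fibre_gram E h t x + fibre_gram E h t x ** \<omega> c t x i"
    using conn unfolding metric_connection_def by (elim conjE)
  from spec[OF bspec[OF bspec[OF bspec[OF this c] t] x(1)]]
  have "frechet_derivative (gram c t) (at x) (axis i 1) =
    transpose (\<omega> c t (chart_inv c x) i) ** gram c t x + gram c t x ** \<omega> c t (chart_inv c x) i" for i
    unfolding pderiv_chart_def x(2) gram[symmetric] gram_def[OF c t, of x, symmetric] .
  from metric_connection_derivative[of _ "\<lambda>i. \<omega> c t (chart_inv c x) i", OF has_derivative_linear[OF d] this]
  show "v \<bullet> (frechet_derivative (gram c t) (at x) a *v w) =
      (cform c t x a *v v) \<bullet> (gram c t x *v w) + v \<bullet> (gram c t x *v (cform c t x a *v w))"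
    unfolding cform_def .
qed

lemma gram_fst_derivative:
  assumes "fst q \<in> cdom c t"
  shows "((\<lambda>q. gram c t (fst q)) has_derivative (\<lambda>z. frechet_derivative (gram c t) (at (fst q)) (fst z))) (at q)"
  by (rule has_derivative_compose[OF has_derivative_fst[OF has_derivative_ident] gram_derivative(1)[OF assms]])

lemma gram_sym: "x \<in> cdom c t \<Longrightarrow> v \<bullet> (gram c t x *v w) = w \<bullet> (gram c t x *v v)"
  using inner_form.ip_sym[OF inner_form_gram[OF c t]] .

lemma sqnorm_derivative:
  assumes "fst q \<in> cdom c t"
  shows "(sqnorm c t has_derivative (\<lambda>z. 2 * (snd z \<bullet> (gram c t (fst q) *v snd q)) +
    snd q \<bullet> (frechet_derivative (gram c t) (at (fst q)) (fst z) *v snd q))) (at q)"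
proof -
  have "((\<lambda>q. snd q \<bullet> (gram c t (fst q) *v snd q)) has_derivative
    (\<lambda>z. snd q \<bullet> (gram c t (fst q) *v snd z + frechet_derivative (gram c t) (at (fst q)) (fst z) *v snd q)
      + snd z \<bullet> (gram c t (fst q) *v snd q))) (at q)"
    by (intro bounded_bilinear.FDERIV[OF bounded_bilinear_inner] has_derivative_snd has_derivative_ident
        bounded_bilinear.FDERIV[OF bounded_bilinear_matrix_vector_mult] gram_fst_derivative assms)
  then show ?thesis
    unfolding sqnorm_def[OF c t, abs_def]
    by (rule has_derivative_eq_rhs) (simp add: fun_eq_iff inner_add_right gram_sym[OF assms, of "snd q"])
qed

text \<open>The derivative of the Gram matrix cancels the connection term in the horizontal lift.
  For \<open>snd Z = 0\<close> this says that the norm is constant in horizontal directions.\<close>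

lemma sqnorm_derivative_adapted:
  assumes "fst q \<in> cdom c t"
  shows "frechet_derivative (sqnorm c t) (at q) (adapted c t q Z) = 2 * (snd Z \<bullet> (gram c t (fst q) *v snd q))"
  unfolding frechet_derivative_at[OF sqnorm_derivative[OF assms], symmetric]
  by (simp add: adapted_def gram_derivative(2)[OF assms] inner_diff_left algebra_simps gram_sym[OF assms, of "snd q"])

lemma sasaki_metric_pt:
  assumes "fst q \<in> cdom c t"
  shows "sasaki_metric g E h c t (pt c t q) Z Z' =
    fst Z \<bullet> (g c (chart_inv c (fst q)) *v fst Z') + snd Z \<bullet> (gram c t (fst q) *v snd Z')"
  by (simp add: sasaki_metric_def pt_props[OF c t assms] gram_def[OF c t])

lemma g_pos: "x \<in> fst c \<Longrightarrow> a \<noteq> 0 \<Longrightarrow> a \<bullet> (g c x *v a) > 0"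
  and g_sym: "x \<in> fst c \<Longrightarrow> transpose (g c x) = g c x"
  using riem c unfolding riemannian_metric_def by blast+

lemma sasaki_deriv_pt:
  assumes "fst q \<in> cdom c t"
  shows "fst (sasaki_deriv \<Gamma> E \<omega> c t (pt c t q) Z A) =
      fst (frechet_derivative A (at q) (adapted c t q Z)) + (\<Sum>i\<in>UNIV. fst Z $ i *\<^sub>R \<Gamma> c (chart_inv c (fst q)) i) *v fst (A q)"
    and "snd (sasaki_deriv \<Gamma> E \<omega> c t (pt c t q) Z A) =
      snd (frechet_derivative A (at q) (adapted c t q Z)) + cform c t (fst q) (fst Z) *v snd (A q)"
  by (simp_all add: sasaki_deriv_def Let_def pt_props[OF c t assms] adapted_vec_pt[OF assms] fst_sum snd_sum
      cform_def sum_matrix_vector_mult scaleR_matrix_vector_assoc[symmetric])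

end

section \<open>Sphere bundles\<close>

lemma graph_sphere_curvature:
  assumes u: "smooth_sphere u" and K: "\<And>\<xi>. \<xi> \<in> punctured E \<Longrightarrow> K \<xi> > 0"
    and K_fibre: "\<And>\<xi> \<eta>. \<xi> \<in> punctured E \<Longrightarrow> \<eta> \<in> punctured E \<Longrightarrow> proj E \<xi> = proj E \<eta> \<Longrightarrow> K \<xi> = K \<eta>"
    and m: "CARD('m) \<ge> 2"
    and uK: "\<And>\<xi>. \<xi> \<in> unit_sphere_bundle E h \<Longrightarrow> u \<xi> = - ln (K \<xi>) / real (CARD('m) - 1)"
  shows "vertical_curvature_given_by E h (graph u) K"
  unfolding vertical_curvature_given_by_def Let_def
proof (intro ballI impI)
  fix \<xi> t assume \<xi>: "\<xi> \<in> graph u" and t: "t \<in> trivs E" and xt: "proj E \<xi> \<in> fst t"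
  define x where "x = proj E \<xi>"
  have xt: "x \<in> fst t" using xt x_def by simp
  obtain c where c: "c \<in> \<A>" "x \<in> fst c" using chart_exists x_topspace[OF t xt] by blast
  have xi: "\<xi> \<in> punctured E" using \<xi> graph_iff by blast
  then have xif: "\<xi> \<in> fibre E x" by (simp add: punctured_def fibre_iff x_def)
  \<comment> \<open>The radius for which \<open>(1 / r) ^ (m - 1)\<close> equals the value of
    \<open>K\<close> on this fibre, where \<open>m\<close> is the rank.\<close>
  define r where "r = exp (- ln (K \<xi>) / real (CARD('m) - 1))"
  have "r > 0" by (simp add: r_def)
  interpret ip: inner_form "\<lambda>v w. h (from_frame E t x v) (from_frame E t x w)" by (rule inner_form_hh[OF t xt])
  have rext: "exp (rext u \<eta>) = r" if "\<eta> \<in> punctured E" "\<eta> \<in> fibre E x" for \<eta>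
  proof -
    have s: "vscale E (1 / sqrt (h \<eta> \<eta>)) \<eta> \<in> unit_sphere_bundle E h" by (rule normalize_sphere[OF that(1)])
    have "K (vscale E (1 / sqrt (h \<eta> \<eta>)) \<eta>) = K \<xi>"
      using that x_def by (intro K_fibre sphere_punctured s xi) (auto simp: vscale_simps fibre_iff)
    then show ?thesis unfolding rext_def uK[OF s] r_def by simp
  qed
  have Yx: "snd t ` (graph u \<inter> fibre E x) = {y. h (from_frame E t x y) (from_frame E t x y) = r\<^sup>2}"
  proof (intro equalityI subsetI)
    fix y assume "y \<in> snd t ` (graph u \<inter> fibre E x)"
    then obtain \<eta> where \<eta>: "\<eta> \<in> graph u" "\<eta> \<in> fibre E x" "y = snd t \<eta>" by blast
    then have "from_frame E t x y = \<eta>" using from_frame_triv[OF t xt] by simp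
    moreover have "sqrt (h \<eta> \<eta>) = r" "h \<eta> \<eta> > 0"
      using \<eta> rext graph_iff punctured_pos by auto
    then have "h \<eta> \<eta> = r\<^sup>2" by auto
    ultimately show "y \<in> {y. h (from_frame E t x y) (from_frame E t x y) = r\<^sup>2}" by simp
  next
    fix y assume "y \<in> {y. h (from_frame E t x y) (from_frame E t x y) = r\<^sup>2}"
    then have y: "h (from_frame E t x y) (from_frame E t x y) = r\<^sup>2" by simp
    then have "y \<noteq> 0" using \<open>r > 0\<close> ip.ip_simps by auto
    then have p: "from_frame E t x y \<in> punctured E" "from_frame E t x y \<in> fibre E x"
      using from_frame_in[OF t xt, of y] from_frame_0[OF t xt, of y] by (auto simp: punctured_def fibre_iff)
    then have "from_frame E t x y \<in> graph u"
      using rext[OF p] y \<open>r > 0\<close> by (simp add: graph_iff)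
    then show "y \<in> snd t ` (graph u \<inter> fibre E x)"
      using p(2) triv_from_frame[OF t xt] by (metis IntI imageI)
  qed
  interpret radial_level "-{0}" "\<lambda>v. v" "\<lambda>y. rgauge u c t (snd c x, y)"
    by (rule radial_level_fibre[OF c(1) t u c(2) xt])
  have "hypersurface (snd t ` (graph u \<inter> fibre E x))"
    unfolding fibre_graph[OF c(1) t c(2) xt] using hypersurface_S unfolding S_def .
  moreover have "has_gauss_curvature (\<lambda>v w. h (from_frame E t x v) (from_frame E t x w))
     (snd t ` (graph u \<inter> fibre E x)) (snd t \<xi>) (K \<xi>)"
  proof -
    have "snd t \<xi> \<in> snd t ` (graph u \<inter> fibre E x)" using \<xi> xif by blast
    then have "h (from_frame E t x (snd t \<xi>)) (from_frame E t x (snd t \<xi>)) = r\<^sup>2" unfolding Yx by simp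
    from ip.gauss_curvature_sphere[OF \<open>r > 0\<close> this]
    have "has_gauss_curvature (\<lambda>v w. h (from_frame E t x v) (from_frame E t x w))
     (snd t ` (graph u \<inter> fibre E x)) (snd t \<xi>) ((1 / r) ^ (CARD('m) - 1))"
      unfolding Yx by simp
    moreover have "(1 / r) ^ (CARD('m) - 1) = K \<xi>"
    proof -
      have "1 / r = exp (ln (K \<xi>) / real (CARD('m) - 1))" by (simp add: r_def exp_minus divide_inverse)
      then have "(1 / r) ^ (CARD('m) - 1) = exp (real (CARD('m) - 1) * (ln (K \<xi>) / real (CARD('m) - 1)))"
        by (simp only: exp_of_nat_mult)
      also have "\<dots> = K \<xi>" using m K[OF xi] by simp
      finally show ?thesis .
    qed
    ultimately show ?thesis by simp
  qed
  ultimately show "hypersurface (snd t ` (graph u \<inter> fibre E (proj E \<xi>))) \<and>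
    has_gauss_curvature (\<lambda>v w. h (from_frame E t (proj E \<xi>) v) (from_frame E t (proj E \<xi>) w))
     (snd t ` (graph u \<inter> fibre E (proj E \<xi>))) (snd t \<xi>) (K \<xi>)"
    unfolding x_def by blast
qed

lemma smooth_on_total_subset: "smooth_on_total \<A> E S f \<Longrightarrow> T \<subseteq> S \<Longrightarrow> smooth_on_total \<A> E T f"
  unfolding smooth_on_total_def by (meson Int_mono image_mono order_refl smooth_on_subset)

lemma graph_const_convex:
  assumes u: "smooth_sphere u" and uC: "\<And>\<xi>. \<xi> \<in> unit_sphere_bundle E h \<Longrightarrow> u \<xi> = C"
  shows "convex_graph \<A> g \<Gamma> E h \<omega> (graph u)"
  unfolding convex_graph_def
proof (intro ballI allI impI)
  fix c t \<xi> \<nu> A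
  assume c: "c \<in> \<A>" and t: "t \<in> trivs E" and \<xi>: "\<xi> \<in> graph u \<inter> edom E c t"
    and \<nu>: "outward_unit_normal g E h \<omega> (graph u) c t \<xi> \<nu>"
    and A: "tangent_field E \<omega> (graph u) c t \<xi> A"
  define q where "q = ecoord E c t \<xi>"
  have q: "pt c t q = \<xi>" "fst q \<in> cdom c t" using pt_ecoord[OF c t] \<xi> by (auto simp: q_def)
  interpret radial_level "cdom0 c t" "\<lambda>q. (0, snd q)" "rgauge u c t" by (rule radial_level_rgauge[OF c t u])
  interpret ip: inner_form "\<lambda>v w. v \<bullet> (gram c t (fst q) *v w)" by (rule inner_form_gram[OF c t q(2)])
  have S: "in_ecoord E c t (graph u) = S" unfolding S_def in_ecoord_graph[OF c t] ..
  have rgauge: "rgauge u c t p = exp (- C) * sqrt (sqnorm c t p)" if "p \<in> cdom0 c t" for p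
  proof -
    have "pt c t p \<in> punctured E" using pt_punctured[OF c t, of p] that by auto
    then have "logr u c t p = C" unfolding logr_def rext_def by (intro uC normalize_sphere)
    then show ?thesis by (simp add: rgauge_def)
  qed
  have sq_S: "sqnorm c t p = exp (2 * C)" if "p \<in> S" for p
  proof -
    have "exp (- C) * sqrt (sqnorm c t p) = 1" "sqnorm c t p > 0" using that rgauge[of p] sqnorm_pos[OF c t] by (auto simp: S_def)
    then have "sqrt (sqnorm c t p) = exp C" by (simp add: exp_minus field_simps)
    then have "sqnorm c t p = (exp C)\<^sup>2" using \<open>sqnorm c t p > 0\<close> by (metis less_imp_le real_sqrt_pow2)
    then show ?thesis by (simp add: exp_double)
  qed
  \<comment> \<open>\<open>rgauge\<close> is here a constant multiple of the norm, whose horizontal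
    derivative vanishes, so tangency only requires the vertical part to be orthogonal to the
    position vector.\<close>
  have tan_iff: "adapted c t p Z \<in> tangent_space S p \<longleftrightarrow> snd Z \<bullet> (gram c t (fst p) *v snd p) = 0" if p: "p \<in> S" for p Z
  proof -
    have d: "fst p \<in> cdom c t" and p0: "p \<in> cdom0 c t" using p by (auto simp: S_def)
    have "((\<lambda>p. exp (- C) * sqrt (sqnorm c t p)) has_derivative
        (\<lambda>v. exp (- C) * (frechet_derivative (sqnorm c t) (at p) v * (inverse (sqrt (sqnorm c t p)) / 2)))) (at p)"
      using sqnorm_derivative[OF c t d] sqnorm_pos[OF c t p0]
      by (auto intro!: derivative_eq_intros simp: frechet_derivative_at[OF sqnorm_derivative[OF c t d], symmetric] field_simps)
    then have "(rgauge u c t has_derivative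
        (\<lambda>v. exp (- C) * (frechet_derivative (sqnorm c t) (at p) v * (inverse (sqrt (sqnorm c t p)) / 2)))) (at p)"
      by (rule has_derivative_transform_within_open[OF _ open_D p0]) (simp add: rgauge)
    note dF = frechet_derivative_at[OF this, symmetric]
    show ?thesis
      unfolding tangent_space_S[OF p] mem_Collect_eq dF sqnorm_derivative_adapted[OF c t d, of Z]
      using sqnorm_pos[OF c t p0] by simp
  qed
  have qS: "q \<in> S" unfolding S[symmetric] in_ecoord_iff[OF c t] using q \<xi> by auto
  let ?y = "snd q" and ?H = "gram c t (fst q)"
  have n: "\<And>Z. snd Z \<bullet> (?H *v ?y) = 0 \<Longrightarrow>
      fst \<nu> \<bullet> (g c (chart_inv c (fst q)) *v fst Z) + snd \<nu> \<bullet> (?H *v snd Z) = 0"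
    and npos: "snd \<nu> \<bullet> (?H *v ?y) > 0"
    using \<nu> unfolding outward_unit_normal_def q(1)[symmetric] pt_props[OF c t q(2)] S
      sasaki_metric_pt[OF c t q(2)] adapted_vec_pt[OF c t q(2)] tan_iff[OF qS]
    by (auto simp: matrix_vector_mult_0_right)
  \<comment> \<open>A vector without vertical part is tangent; applied to the horizontal part of the
    normal itself, this makes that part vanish.\<close>
  have "fst \<nu> = 0"
    using n[of "(fst \<nu>, 0)"] g_pos[OF c t, of "chart_inv c (fst q)" "fst \<nu>"] domD[OF c q(2)] by fastforce
  define s where "s = (snd \<nu> \<bullet> (?H *v ?y)) / (?y \<bullet> (?H *v ?y))"
  have y0: "?y \<noteq> 0" using qS by (auto simp: S_def)
  have yy: "?y \<bullet> (?H *v ?y) > 0" using ip.ip_pos[OF y0] .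
  have "s > 0" using npos yy by (simp add: s_def)
  have n2: "snd \<nu> = s *\<^sub>R ?y"
  proof -
    \<comment> \<open>The remainder after projecting to the position vector is orthogonal to it,
      hence tangent, hence orthogonal to the normal and therefore to itself.\<close>
    define b where "b = snd \<nu> - s *\<^sub>R ?y"
    have by0: "b \<bullet> (?H *v ?y) = 0" unfolding b_def using yy by (simp add: ip.ip_simps s_def)
    then have "snd \<nu> \<bullet> (?H *v b) = 0" using n[of "(0, b)"] by simp
    then have "b \<bullet> (?H *v b) = 0"
      using by0 ip.ip_sym[of b ?y] by (subst b_def) (simp add: ip.ip_simps)
    then show ?thesis using ip.ip_eq_0 b_def by simp
  qed
  obtain W where W: "open W" "q \<in> W" "smooth_on W A" and AW:
    "\<And>p. p \<in> S \<Longrightarrow> p \<in> W \<Longrightarrow> adapted c t p (A p) \<in> tangent_space S p"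
  proof -
    from A obtain W where W: "open W" "q \<in> W" "smooth_on W A" and *:
      "\<forall>\<eta>\<in>graph u \<inter> edom E c t. ecoord E c t \<eta> \<in> W \<longrightarrow>
        adapted_vec E \<omega> c t \<eta> (A (ecoord E c t \<eta>)) \<in> tangent_space S (ecoord E c t \<eta>)"
      unfolding tangent_field_def S q_def[symmetric] by blast
    have "adapted c t p (A p) \<in> tangent_space S p" if p: "p \<in> S" "p \<in> W" for p
    proof -
      have d: "fst p \<in> cdom c t" "pt c t p \<in> graph u"
        using p(1) unfolding S[symmetric] in_ecoord_iff[OF c t] by auto
      from bspec[OF *, of "pt c t p"] show ?thesis
        using d p(2) by (simp add: pt_props[OF c t d(1)] adapted_vec_pt[OF c t d(1)])
    qed
    with W that show thesis by blast
  qed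
  let ?X = "A q"
  let ?V = "adapted c t q ?X"
  let ?a = "fst ?X"
  have dA: "(A has_derivative frechet_derivative A (at q)) (at q)" by (rule smooth_on_has_derivative[OF W(3,1,2)])
  \<comment> \<open>Tangency of the field \<open>A\<close>, as an equation along the graph.
    Differentiating it in the direction of \<open>A\<close> itself brings in the second fundamental
    form.\<close>
  define \<psi> where "\<psi> p = snd (A p) \<bullet> (gram c t (fst p) *v snd p)" for p
  have \<psi>S: "\<psi> p = 0" if "p \<in> S" "p \<in> W" for p
    using AW[OF that] tan_iff[OF that(1), of "A p"] by (simp add: \<psi>_def)
  have d\<psi>: "(\<psi> has_derivative (\<lambda>z. snd ?X \<bullet> (?H *v snd z + frechet_derivative (gram c t) (at (fst q)) (fst z) *v ?y)
      + snd (frechet_derivative A (at q) z) \<bullet> (?H *v ?y))) (at q)"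
    unfolding \<psi>_def[abs_def]
    by (intro bounded_bilinear.FDERIV[OF bounded_bilinear_inner] has_derivative_snd has_derivative_ident dA
        bounded_bilinear.FDERIV[OF bounded_bilinear_matrix_vector_mult] gram_fst_derivative[OF c t q(2)])
  obtain \<gamma> \<epsilon> where \<gamma>: "0 < (\<epsilon>::real)" "\<And>\<tau>. \<bar>\<tau>\<bar> < \<epsilon> \<Longrightarrow> \<gamma> \<tau> \<in> S" "\<gamma> 0 = q"
    "(\<gamma> has_vector_derivative ?V) (at 0)"
    using tangent_spaceE[OF AW[OF qS W(2)]] by blast
  have "\<gamma> 0 \<in> W" using W \<gamma>(3) by simp
  from curve_in_open[OF \<gamma>(4) W(1) this] obtain \<delta> where \<delta>: "\<delta> > 0" "\<And>\<tau>. \<bar>\<tau>\<bar> < \<delta> \<Longrightarrow> \<gamma> \<tau> \<in> W" by blast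
  have "((\<lambda>\<tau>. \<psi> (\<gamma> \<tau>)) has_vector_derivative
      (snd ?X \<bullet> (?H *v snd ?V + frechet_derivative (gram c t) (at (fst q)) (fst ?V) *v ?y)
      + snd (frechet_derivative A (at q) ?V) \<bullet> (?H *v ?y))) (at 0)"
    using d\<psi> \<gamma>(3,4) has_vector_derivative_chain[where f=\<psi> and \<gamma>=\<gamma> and t=0] by fastforce
  then have eq: "snd ?X \<bullet> (?H *v snd ?V + frechet_derivative (gram c t) (at (fst q)) (fst ?V) *v ?y)
      + snd (frechet_derivative A (at q) ?V) \<bullet> (?H *v ?y) = 0"
    by (rule has_vector_derivative_eventually_const[where \<epsilon>="min \<delta> \<epsilon>" and c=0]) (use \<gamma> \<delta> \<psi>S in auto)
  \<comment> \<open>Of the two terms from the derivative of the Gram matrix, one cancels the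
    connection term of the horizontal lift \<open>?V\<close>, the other completes the derivative of
    \<open>A\<close> to the covariant one.\<close>
  have "(snd (frechet_derivative A (at q) ?V) + cform c t (fst q) ?a *v snd ?X) \<bullet> (?H *v ?y) = - (snd ?X \<bullet> (?H *v snd ?X))"
    using eq unfolding inner_add_right gram_derivative(2)[OF c t q(2)]
    by (simp add: adapted_def ip.ip_simps algebra_simps)
  moreover have "snd ?X \<bullet> (?H *v snd ?X) \<ge> 0"
    using ip.ip_pos[of "snd ?X"] by (cases "snd ?X = 0") auto
  moreover have "second_fundamental_form g \<Gamma> E h \<omega> c t \<xi> \<nu> (A (ecoord E c t \<xi>)) A =
     - s * ((snd (frechet_derivative A (at q) ?V) + cform c t (fst q) ?a *v snd ?X) \<bullet> (?H *v ?y))"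
    unfolding second_fundamental_form_def q(1)[symmetric] pt_props[OF c t q(2)] sasaki_metric_pt[OF c t q(2)]
      sasaki_deriv_pt[OF c t q(2)] \<open>fst \<nu> = 0\<close> n2
    by (simp add: ip.ip_simps)
  ultimately show "0 \<le> second_fundamental_form g \<Gamma> E h \<omega> c t \<xi> \<nu> (A (ecoord E c t \<xi>)) A"
    using \<open>s > 0\<close> by simp
qed

section \<open>The horizontal derivative of the radial function\<close>

text \<open>This is \<open>L_a\<close> of the overview: the derivative of the extended radial
  function along the horizontal lift of \<open>a\<close>.\<close>

definition "hderiv u c t a q = frechet_derivative (logr u c t) (at q) (adapted c t q (a, 0))"
text \<open>The base connection matrix in the direction \<open>a\<close>;
  \<open>gform c x a *v a\<close> is the covariant derivative along \<open>a\<close> of the field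
  with constant components \<open>a\<close>.\<close>

definition "gform c x a = (\<Sum>i\<in>UNIV. a $ i *\<^sub>R \<Gamma> c (chart_inv c x) i)"

context
  fixes c t assumes c: "c \<in> \<A>" and t: "t \<in> trivs E"
begin

lemma smooth_cform: "smooth_on (cdom c t) (\<lambda>x. cform c t x a)"
proof -
  have "\<forall>c\<in>\<A>. \<forall>t\<in>trivs E. \<forall>i. smooth_fun \<A> (fst c \<inter> fst t) (\<lambda>x. \<omega> c t x i)"
    using conn unfolding metric_connection_def bundle_connection_def by (elim conjE)
  from bspec[OF bspec[OF this c] t] have "\<forall>i. smooth_fun \<A> (fst c \<inter> fst t) (\<lambda>x. \<omega> c t x i)" .
  then have "smooth_on (snd c ` (fst c \<inter> (fst c \<inter> fst t))) ((\<lambda>x. \<omega> c t x i) \<circ> chart_inv c)" for i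
    using c unfolding smooth_fun_def by blast
  then have "smooth_on (cdom c t) (\<lambda>x. \<omega> c t (chart_inv c x) i)" for i
    by (simp add: o_def Int_absorb2 Int_assoc[symmetric])
  then show ?thesis unfolding cform_def by (intro smooth_on_sum smooth_on_scaleR smooth_on_const)
qed

lemma smooth_adapted: "smooth_on (cdom0 c t) (\<lambda>q. adapted c t q (a, 0))"
proof -
  have "smooth_on (cdom0 c t) (\<lambda>q. cform c t (fst q) a)"
    by (rule smooth_on_compose[OF smooth_cform smooth_on_fst[OF smooth_on_ident]]) auto
  then show ?thesis unfolding adapted_def fst_conv snd_conv
    by (intro smooth_on_Pair smooth_on_diff smooth_on_matrix_vector_mult smooth_on_const smooth_on_snd smooth_on_ident)
qed

lemma smooth_hderiv: "smooth_sphere u \<Longrightarrow> smooth_on (cdom0 c t) (hderiv u c t a)"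
  unfolding hderiv_def
  by (rule smooth_on_frechet_derivative[OF open_cdom0[OF c t] smooth_logr[OF c t] smooth_adapted])

lemma linear_hderiv:
  assumes "smooth_sphere u" "q \<in> cdom0 c t" shows "linear (\<lambda>a. hderiv u c t a q)"
proof -
  have "linear (frechet_derivative (logr u c t) (at q))"
    by (rule linear_frechet_derivative[OF smooth_on_differentiable[OF smooth_logr[OF c t assms(1)] open_cdom0[OF c t] assms(2)]])
  moreover have "linear (\<lambda>a. adapted c t q (a, 0))"
    by (rule linearI) (simp_all add: linear_add[OF linear_adapted, symmetric] linear_scale[OF linear_adapted, symmetric])
  ultimately show ?thesis unfolding hderiv_def using linear_compose[unfolded o_def] by blast
qed

text \<open>Both identities differentiate the invariance under dilation, once in the point and once
  in the dilation factor. They are applied to \<open>logr\<close> and again to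
  \<open>hderiv\<close>.\<close>

lemma scale_invariant_derivative:
  fixes f :: "(real^'n) \<times> (real^'m) \<Rightarrow> real"
  assumes f: "smooth_on (cdom0 c t) f" and inv: "\<And>q s. q \<in> cdom0 c t \<Longrightarrow> s > 0 \<Longrightarrow> f (fst q, s *\<^sub>R snd q) = f q"
    and q: "q \<in> cdom0 c t" and s: "s > 0"
  shows "frechet_derivative f (at (fst q, s *\<^sub>R snd q)) (fst v, s *\<^sub>R snd v) = frechet_derivative f (at q) v"
    and "frechet_derivative f (at q) (0, snd q) = 0"
proof -
  have q': "(fst q, s *\<^sub>R snd q) \<in> cdom0 c t" if "s > 0" for s :: real using q that by auto
  note df = smooth_on_has_derivative[OF f open_cdom0[OF c t]]
  have "((\<lambda>q. (fst q, s *\<^sub>R snd q)) has_derivative (\<lambda>v. (fst v, s *\<^sub>R snd v))) (at q)"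
    by (auto intro!: derivative_eq_intros)
  from has_derivative_compose[OF this df[OF q'[OF s]]]
  have "((\<lambda>q. f (fst q, s *\<^sub>R snd q)) has_derivative
    (\<lambda>v. frechet_derivative f (at (fst q, s *\<^sub>R snd q)) (fst v, s *\<^sub>R snd v))) (at q)" .
  then have "(f has_derivative
    (\<lambda>v. frechet_derivative f (at (fst q, s *\<^sub>R snd q)) (fst v, s *\<^sub>R snd v))) (at q)"
    by (rule has_derivative_transform_within_open[OF _ open_cdom0[OF c t] q]) (rule inv[OF _ s])
  from fun_cong[OF frechet_derivative_at[OF this], of v]
  show "frechet_derivative f (at (fst q, s *\<^sub>R snd q)) (fst v, s *\<^sub>R snd v) = frechet_derivative f (at q) v" .
  let ?g = "\<lambda>r::real. (fst q, (1 + r) *\<^sub>R snd q)"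
  have "(?g has_vector_derivative (0, snd q)) (at 0)"
    by (auto intro!: derivative_eq_intros)
  then have "((\<lambda>r. f (?g r)) has_vector_derivative frechet_derivative f (at q) (0, snd q)) (at 0)"
    using df[OF q] by (intro has_vector_derivative_chain[where f=f and \<gamma>="?g"]) simp_all
  then show "frechet_derivative f (at q) (0, snd q) = 0"
    by (rule has_vector_derivative_eventually_const[where \<epsilon>=1 and c="f q"]) (use inv[OF q] in auto)
qed

lemma logr_invariant: "q \<in> cdom0 c t \<Longrightarrow> s > 0 \<Longrightarrow> logr u c t (fst q, s *\<^sub>R snd q) = logr u c t q"
  by (rule logr_scale[OF c t]) auto

lemma adapted_scale: "adapted c t (fst q, s *\<^sub>R snd q) (a, 0) = (fst (adapted c t q (a, 0)), s *\<^sub>R snd (adapted c t q (a, 0)))"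
  by (simp add: adapted_def matrix_vector_mult_scaleR)

lemma hderiv_scale:
  assumes "smooth_sphere u" "q \<in> cdom0 c t" "s > 0"
  shows "hderiv u c t a (fst q, s *\<^sub>R snd q) = hderiv u c t a q"
  unfolding hderiv_def adapted_scale
  by (rule scale_invariant_derivative(1)[OF smooth_logr[OF c t assms(1)] logr_invariant assms(2,3)])

lemma adapted_split: "adapted c t q (a, r *\<^sub>R snd q) = adapted c t q (a, 0) + r *\<^sub>R (0, snd q)"
  by (simp add: adapted_def)

text \<open>The norm factor of \<open>rgauge\<close> is horizontally constant, so the horizontal
  part contributes only through \<open>logr\<close>; the radial part is Euler's identity. On the
  graph the result vanishes exactly for \<open>r = hderiv u c t a q\<close>.\<close>

lemma dFF_adapted:
  assumes u: "smooth_sphere u" and q: "q \<in> cdom0 c t"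
  shows "frechet_derivative (rgauge u c t) (at q) (adapted c t q (a, r *\<^sub>R snd q)) = rgauge u c t q * (r - hderiv u c t a q)"
proof -
  interpret radial_level "cdom0 c t" "\<lambda>q. (0, snd q)" "rgauge u c t" by (rule radial_level_rgauge[OF c t u])
  have d: "fst q \<in> cdom c t" using q by auto
  note dU = smooth_on_has_derivative[OF smooth_logr[OF c t u] open_cdom0[OF c t] q]
  note dn = sqnorm_derivative[OF c t d]
  have dn': "(sqnorm c t has_derivative frechet_derivative (sqnorm c t) (at q)) (at q)"
    using dn frechet_derivative_at[OF dn] by simp
  have "(rgauge u c t has_derivative (\<lambda>v. sqrt (sqnorm c t q) * (exp (- logr u c t q) * - frechet_derivative (logr u c t) (at q) v) +
      frechet_derivative (sqnorm c t) (at q) v * (inverse (sqrt (sqnorm c t q)) / 2) * exp (- logr u c t q))) (at q)"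
    unfolding rgauge_def[abs_def] using sqnorm_pos[OF c t q]
    by (auto intro!: derivative_eq_intros dU dn' simp: field_simps)
  note dF = frechet_derivative_at[OF this, symmetric]
  have h: "frechet_derivative (rgauge u c t) (at q) (adapted c t q (a, 0)) = - rgauge u c t q * hderiv u c t a q"
    unfolding dF sqnorm_derivative_adapted[OF c t d] by (simp add: rgauge_def hderiv_def)
  show ?thesis
    unfolding adapted_split linear_add[OF linear_dF[OF q]] linear_scale[OF linear_dF[OF q]] h dF_radial[OF q]
    by (simp add: algebra_simps)
qed

lemma g_inner_form: "x \<in> fst c \<Longrightarrow> inner_form (\<lambda>v w. v \<bullet> (g c x *v w))"
proof
  assume x: "x \<in> fst c"
  show "bilinear (\<lambda>v w. v \<bullet> (g c x *v w))"
    unfolding bilinear_def by (auto intro!: linearI simp: inner_add_left inner_add_right matrix_vector_right_distrib matrix_vector_mult_scaleR)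
  show "v \<bullet> (g c x *v w) = w \<bullet> (g c x *v v)" for v w
    using inner_transpose_mult[of v "g c x" w] g_sym[OF c t x] by (simp add: inner_commute)
qed (rule g_pos[OF c t])

lemma sasaki_inner_form:
  assumes "x \<in> cdom c t"
  shows "inner_form (\<lambda>Z Z'. fst Z \<bullet> (g c (chart_inv c x) *v fst Z') + snd Z \<bullet> (gram c t x *v snd Z'))"
proof -
  interpret a: inner_form "\<lambda>v w. v \<bullet> (g c (chart_inv c x) *v w)" using g_inner_form domD[OF c assms] by blast
  interpret b: inner_form "\<lambda>v w. v \<bullet> (gram c t x *v w)" by (rule inner_form_gram[OF c t assms])
  show ?thesis
  proof
    show "bilinear (\<lambda>Z Z'. fst Z \<bullet> (g c (chart_inv c x) *v fst Z') + snd Z \<bullet> (gram c t x *v snd Z'))"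
      unfolding bilinear_def by (auto intro!: linearI simp: a.ip_simps b.ip_simps distrib_left)
    show "fst v \<bullet> (g c (chart_inv c x) *v fst w) + snd v \<bullet> (gram c t x *v snd w) =
       fst w \<bullet> (g c (chart_inv c x) *v fst v) + snd w \<bullet> (gram c t x *v snd v)" for v w :: "(real^'n) \<times> (real^'m)"
      using a.ip_sym b.ip_sym by simp
    fix v :: "(real^'n) \<times> (real^'m)" assume "v \<noteq> 0"
    then have "fst v \<noteq> 0 \<or> snd v \<noteq> 0" by (simp add: prod_eq_iff)
    moreover have "fst v \<bullet> (g c (chart_inv c x) *v fst v) \<ge> 0" "snd v \<bullet> (gram c t x *v snd v) \<ge> 0"
      using a.ip_pos[of "fst v"] b.ip_pos[of "snd v"] by (cases "fst v = 0"; cases "snd v = 0"; auto)+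
    ultimately show "0 < fst v \<bullet> (g c (chart_inv c x) *v fst v) + snd v \<bullet> (gram c t x *v snd v)"
      using a.ip_pos[of "fst v"] b.ip_pos[of "snd v"] by linarith
  qed
qed

text \<open>Applying the convexity to the field \<open>(a, L\<^sub>a y)\<close>, which is the tangential lift of a constant field
  \<open>a\<close> of the base, bounds the horizontal Hessian of the radial function from above.\<close>

lemma convex_hessian_graph:
  assumes u: "smooth_sphere u" and conv: "convex_graph \<A> g \<Gamma> E h \<omega> (graph u)"
    and q: "q \<in> cdom0 c t" and F1: "rgauge u c t q = 1"
  shows "frechet_derivative (hderiv u c t a) (at q) (adapted c t q (a, 0)) + (hderiv u c t a q)\<^sup>2
    \<le> hderiv u c t (gform c (fst q) a *v a) q"
proof -
  interpret radial_level "cdom0 c t" "\<lambda>q. (0, snd q)" "rgauge u c t" by (rule radial_level_rgauge[OF c t u])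
  have S: "in_ecoord E c t (graph u) = S" unfolding S_def in_ecoord_graph[OF c t] ..
  have d: "fst q \<in> cdom c t" using q by auto
  have qS: "q \<in> S" using q F1 by (simp add: S_def)
  define \<xi> where "\<xi> = pt c t q"
  have \<xi>: "\<xi> \<in> graph u \<inter> edom E c t" and eq: "ecoord E c t \<xi> = q"
    using qS unfolding S[symmetric] in_ecoord_iff[OF c t] \<xi>_def by (auto simp: pt_props[OF c t d])
  let ?G = "\<lambda>Z Z'. fst Z \<bullet> (g c (chart_inv c (fst q)) *v fst Z') + snd Z \<bullet> (gram c t (fst q) *v snd Z')"
  interpret G: inner_form ?G by (rule sasaki_inner_form[OF d])
  define l where "l Z = frechet_derivative (rgauge u c t) (at q) (adapted c t q Z)" for Z
  have l: "linear l" unfolding l_def using linear_compose[OF linear_adapted linear_dF[OF q]] by (simp add: o_def)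
  have l_rad: "l (b, r *\<^sub>R snd q) = r - hderiv u c t b q" for b r
    unfolding l_def dFF_adapted[OF u q] F1 by simp
  have LL0: "hderiv u c t 0 q = 0" using linear_0[OF linear_hderiv[OF u q]] .
  \<comment> \<open>The gradient of \<open>rgauge\<close> for the metric \<open>G\<close>, in
    adapted components. It points outward because its pairing with the radial vector is 1.\<close>
  obtain \<nu>0 where \<nu>0: "\<And>Z. ?G \<nu>0 Z = l Z" using G.riesz[OF l] by blast
  have ly: "l (0, snd q) = 1" using l_rad[of 0 1] LL0 by simp
  then have "\<nu>0 \<noteq> 0" using \<nu>0[of "(0, snd q)"] by auto
  define k where "k = 1 / sqrt (?G \<nu>0 \<nu>0)"
  have G0: "?G \<nu>0 \<nu>0 > 0" using G.ip_pos[OF \<open>\<nu>0 \<noteq> 0\<close>] .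
  then have "k > 0" by (simp add: k_def)
  define \<nu> where "\<nu> = k *\<^sub>R \<nu>0"
  have \<nu>Z: "?G \<nu> Z = k * l Z" for Z unfolding \<nu>_def G.ip_simps(4) \<nu>0 by simp
  have "?G \<nu> \<nu> = k * (k * ?G \<nu>0 \<nu>0)" unfolding \<nu>_def G.ip_simps(3,4) by simp
  also have "\<dots> = 1" using G0 by (simp add: k_def field_simps)
  finally have \<nu>1: "?G \<nu> \<nu> = 1" .
  have out: "outward_unit_normal g E h \<omega> (graph u) c t \<xi> \<nu>"
    unfolding outward_unit_normal_def \<xi>_def sasaki_metric_pt[OF c t d] adapted_vec_pt[OF c t d] S
      pt_props[OF c t d] \<nu>Z tangent_space_S[OF qS]
    using \<open>k > 0\<close> ly \<nu>1[unfolded \<nu>Z] by (simp add: l_def)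
  define A where "A p = (a, hderiv u c t a p *\<^sub>R snd p)" for p
  have tf: "tangent_field E \<omega> (graph u) c t \<xi> A"
    unfolding tangent_field_def
  proof (intro exI[of _ "cdom0 c t"] conjI ballI impI)
    show "open (cdom0 c t)" by (rule open_D)
    show "ecoord E c t \<xi> \<in> cdom0 c t" unfolding eq by (rule q)
    show "smooth_on (cdom0 c t) A" unfolding A_def
      by (intro smooth_on_Pair smooth_on_const smooth_on_scaleR smooth_hderiv u smooth_on_snd smooth_on_ident)
    fix \<eta> assume \<eta>: "\<eta> \<in> graph u \<inter> edom E c t"
    define p where "p = ecoord E c t \<eta>"
    have p: "pt c t p = \<eta>" "fst p \<in> cdom c t" using pt_ecoord[OF c t] \<eta> by (auto simp: p_def)
    have pS: "p \<in> S" unfolding S[symmetric] in_ecoord_iff[OF c t] using p \<eta> by auto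
    then have "frechet_derivative (rgauge u c t) (at p) (adapted c t p (A p)) = 0"
      unfolding A_def by (subst dFF_adapted[OF u]) (auto simp: S_def)
    then show "adapted_vec E \<omega> c t \<eta> (A (ecoord E c t \<eta>)) \<in> tangent_space (in_ecoord E c t (graph u)) (ecoord E c t \<eta>)"
      unfolding p(1)[symmetric] adapted_vec_pt[OF c t p(2)] pt_props(2)[OF c t p(2)] S tangent_space_S[OF pS] by simp
  qed
  let ?lam = "hderiv u c t a"
  let ?V = "adapted c t q (A q)"
  have dlam: "(?lam has_derivative frechet_derivative ?lam (at q)) (at q)"
    by (rule smooth_on_has_derivative[OF smooth_hderiv[OF u] open_D q])
  have dA: "(A has_derivative (\<lambda>z. (0, ?lam q *\<^sub>R snd z + frechet_derivative ?lam (at q) z *\<^sub>R snd q))) (at q)"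
    unfolding A_def[abs_def] by (auto intro!: derivative_eq_intros dlam)
  \<comment> \<open>The radial part of the field does not contribute, because \<open>hderiv\<close>
    is of degree 0 along the fibres.\<close>
  have dlamV: "frechet_derivative ?lam (at q) ?V = frechet_derivative ?lam (at q) (adapted c t q (a, 0))"
    unfolding A_def adapted_split linear_add[OF has_derivative_linear[OF dlam]] linear_scale[OF has_derivative_linear[OF dlam]]
    using scale_invariant_derivative(2)[OF smooth_hderiv[OF u] hderiv_scale[OF u] q, of 1] by simp
  let ?DA = "sasaki_deriv \<Gamma> E \<omega> c t (pt c t q) (A q) A"
  \<comment> \<open>The connection terms from the horizontal lift and from the Sasaki derivative
    cancel; the square arises because \<open>snd p\<close> is differentiated along the radial part
    of the field.\<close>
  have "snd ?DA = ((?lam q)\<^sup>2 + frechet_derivative ?lam (at q) (adapted c t q (a, 0))) *\<^sub>R snd q"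
    unfolding sasaki_deriv_pt(2)[OF c t d] frechet_derivative_at[OF dA, symmetric] dlamV snd_conv
    by (simp add: A_def adapted_def matrix_vector_mult_scaleR power2_eq_square algebra_simps)
  moreover have "fst ?DA = gform c (fst q) a *v a"
    unfolding sasaki_deriv_pt(1)[OF c t d] frechet_derivative_at[OF dA, symmetric] by (simp add: A_def gform_def)
  ultimately have DA: "?DA = (gform c (fst q) a *v a, ((?lam q)\<^sup>2 + frechet_derivative ?lam (at q) (adapted c t q (a, 0))) *\<^sub>R snd q)"
    by (simp add: prod_eq_iff)
  have "second_fundamental_form g \<Gamma> E h \<omega> c t \<xi> \<nu> (A (ecoord E c t \<xi>)) A = - (?G ?DA \<nu>)"
    unfolding second_fundamental_form_def \<xi>_def sasaki_metric_pt[OF c t d] pt_props(2)[OF c t d] ..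
  also have "\<dots> = - (k * l ?DA)" unfolding G.ip_sym[of ?DA] \<nu>Z ..
  finally have "0 \<le> - (k * l ?DA)"
    using conv out tf c t \<xi> unfolding convex_graph_def by metis
  then have "l ?DA \<le> 0" using \<open>k > 0\<close> by (simp add: mult_le_0_iff)
  then show ?thesis unfolding DA l_rad by simp
qed

text \<open>Convexity gives the inequality on the graph only. All its terms are invariant under
  dilation in the fibre, so it extends along rays to the whole punctured bundle.\<close>

lemma convex_hessian:
  assumes u: "smooth_sphere u" and conv: "convex_graph \<A> g \<Gamma> E h \<omega> (graph u)"
    and q: "q \<in> cdom0 c t"
  shows "frechet_derivative (hderiv u c t a) (at q) (adapted c t q (a, 0)) + (hderiv u c t a q)\<^sup>2
    \<le> hderiv u c t (gform c (fst q) a *v a) q"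
proof -
  interpret radial_level "cdom0 c t" "\<lambda>q. (0, snd q)" "rgauge u c t" by (rule radial_level_rgauge[OF c t u])
  define s where "s = 1 / rgauge u c t q"
  have s: "s > 0" using F_pos[OF q] by (simp add: s_def)
  let ?p = "(fst q, s *\<^sub>R snd q)"
  have e: "q + (s - 1) *\<^sub>R (0, snd q) = ?p"
    by (simp add: prod_eq_iff scaleR_diff_left)
  have p: "?p \<in> cdom0 c t" "rgauge u c t ?p = 1"
    using scale_D[OF q s] F_scale[OF q s] F_pos[OF q] unfolding e by (simp_all add: s_def)
  have "frechet_derivative (hderiv u c t a) (at ?p) (adapted c t ?p (a, 0)) =
    frechet_derivative (hderiv u c t a) (at q) (adapted c t q (a, 0))"
    unfolding adapted_scale by (rule scale_invariant_derivative(1)[OF smooth_hderiv[OF u] hderiv_scale[OF u] q s])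
  then show ?thesis
    using convex_hessian_graph[OF u conv p, of a] by (simp add: hderiv_scale[OF u q s])
qed

end

section \<open>Change of chart and trivialisation\<close>

lemma from_frame_linear_coords:
  assumes "t \<in> trivs E" "t' \<in> trivs E" "x \<in> fst t" "x \<in> fst t'"
  shows "transition_matrix E t t' x *v y = snd t' (from_frame E t x y)"
proof -
  have "linear (\<lambda>y. snd t' (from_frame E t x y))"
    using assms by (intro linearI) (simp_all add: from_frame_add from_frame_scale triv_props(3,4) from_frame_in)
  then show ?thesis unfolding transition_matrix_def by (simp add: matrix_works linear_matrix_vector_mul_eq)
qed

text \<open>The quotient \<open>L\<^sub>a\<^sup>2 / g(a, a)\<close> does not depend on the coordinates: this is where the transformation
  rule of the connection enters.\<close>

lemma hderiv_transform:
  assumes c: "c \<in> \<A>" and t: "t \<in> trivs E" and c': "c' \<in> \<A>" and t': "t' \<in> trivs E"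
    and u: "smooth_sphere u" and q: "q \<in> cdom0 c t"
    and z: "z = chart_inv c (fst q)" "z \<in> fst c'" "z \<in> fst t'"
  obtains q' where "q' \<in> cdom0 c' t'" "fst q' = snd c' z"
    "hderiv u c' t' (chart_jacobian c c' z *v a) q' = hderiv u c t a q"
proof -
  define \<tau> where "\<tau> = snd c' \<circ> chart_inv c"
  define T where "T x = transition_matrix E t t' (chart_inv c x)" for x
  define D where "D = snd c ` (fst c \<inter> (fst t \<inter> (fst c' \<inter> fst t')))"
  have opD: "open D" unfolding D_def
    by (intro chart_image_open c openin_Int triv_openin t t' chart_openin c')
  have D: "x \<in> cdom c t" "chart_inv c x \<in> fst c" "chart_inv c x \<in> fst t" "chart_inv c x \<in> fst c'" "chart_inv c x \<in> fst t'"
    if "x \<in> D" for x using that c unfolding D_def by auto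
  have d: "fst q \<in> cdom c t" and y0: "snd q \<noteq> 0" using q by auto
  have zc: "z \<in> fst c" "z \<in> fst t" "snd c z = fst q" using domD[OF c d] z(1) by auto
  have qD: "fst q \<in> D" unfolding D_def using zc z by (auto intro!: image_eqI[of _ _ z])
  have "smooth_on (snd c ` (fst c \<inter> fst c')) \<tau>"
    using mfd c c' unfolding smooth_manifold_def \<tau>_def by blast
  then have sm\<tau>: "smooth_on D \<tau>" by (rule smooth_on_subset) (auto simp: D_def)
  have smT: "smooth_on D T"
  proof -
    have "\<forall>t\<in>trivs E. \<forall>t'\<in>trivs E. \<forall>y. smooth_fun \<A> (fst t \<inter> fst t') (\<lambda>x. snd t' (from_frame E t x y))"
      using bdl unfolding vector_bundle_def by (elim conjE)
    then have "smooth_on (snd c ` (fst c \<inter> (fst t \<inter> fst t'))) ((\<lambda>x. snd t' (from_frame E t x y)) \<circ> chart_inv c)" for y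
      using c t t' unfolding smooth_fun_def by blast
    then have *: "smooth_on D (\<lambda>x. snd t' (from_frame E t (chart_inv c x) y))" for y
      unfolding o_def by (rule smooth_on_subset) (auto simp: D_def)
    have "smooth_on D (\<lambda>x. \<chi> i j. snd t' (from_frame E t (chart_inv c x) (axis j 1)) $ i)"
      by (intro smooth_on_vec smooth_on_nth *)
    then show ?thesis unfolding T_def transition_matrix_def matrix_def .
  qed
  \<comment> \<open>The change of bundle coordinates; it represents the identity of the bundle, so
    it carries one \<open>logr\<close> to the other.\<close>
  define \<Theta> where "\<Theta> p = (\<tau> (fst p), T (fst p) *v snd p)" for p
  have pt\<Theta>: "pt c' t' (\<Theta> p) = pt c t p" if "fst p \<in> D" for p
    using D[OF that] c' from_frame_triv[OF t' D(5)[OF that], of "pt c t p"] pt_fibre[OF c t D(1)[OF that]]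
    by (simp add: pt_def \<Theta>_def \<tau>_def T_def from_frame_linear_coords[OF t t' D(3,5)[OF that]])
  have \<Theta>dom: "\<Theta> p \<in> cdom0 c' t'" if "p \<in> D \<times> (-{0})" for p
  proof -
    have pD: "fst p \<in> D" "snd p \<noteq> 0" using that by auto
    have 1: "fst (\<Theta> p) \<in> cdom c' t'" using D[OF pD(1)] by (auto simp: \<Theta>_def \<tau>_def)
    have "snd (\<Theta> p) \<noteq> 0"
      using pt_punctured[OF c' t' 1] pt_punctured[OF c t D(1)[OF pD(1)]] pD(2) unfolding pt\<Theta>[OF pD(1)] by blast
    with 1 show ?thesis by (simp add: mem_Times_iff)
  qed
  have logr\<Theta>: "logr u c t p = logr u c' t' (\<Theta> p)" if "p \<in> D \<times> (-{0})" for p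
    using that by (auto simp: logr_def pt\<Theta>)
  define J where "J = chart_jacobian c c' z"
  have d\<tau>: "(\<tau> has_derivative (\<lambda>a. J *v a)) (at (fst q))"
  proof -
    have "(\<tau> has_derivative frechet_derivative \<tau> (at (fst q))) (at (fst q))"
      by (rule smooth_on_has_derivative[OF sm\<tau> opD qD])
    moreover from has_derivative_linear[OF this] have "frechet_derivative \<tau> (at (fst q)) = (\<lambda>a. J *v a)"
      unfolding J_def chart_jacobian_def zc(3) jacobian_def \<tau>_def[symmetric] by (auto simp: matrix_works)
    ultimately show ?thesis by simp
  qed
  define dT where "dT = frechet_derivative T (at (fst q))"
  have dT: "(T has_derivative dT) (at (fst q))"
    unfolding dT_def by (rule smooth_on_has_derivative[OF smT opD qD])
  have \<tau>q: "\<tau> (fst q) = snd c' z" by (simp add: \<tau>_def z)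
  have ciz: "chart_inv c' (snd c' z) = z" using c' z(2) by simp
  have rule_i: "T (fst q) *v (\<omega> c t z i *v y) = dT (axis i 1) *v y +
      (\<Sum>j\<in>UNIV. J $ j $ i *\<^sub>R (\<omega> c' t' z j *v (T (fst q) *v y)))" for i y
  proof -
    have "\<forall>c\<in>\<A>. \<forall>c'\<in>\<A>. \<forall>t\<in>trivs E. \<forall>t'\<in>trivs E. \<forall>x\<in>fst c \<inter> fst c' \<inter> fst t \<inter> fst t'. \<forall>i.
        transition_matrix E t t' x ** \<omega> c t x i =
          pderiv_chart c i (transition_matrix E t t') x +
          (\<Sum>j\<in>UNIV. chart_jacobian c c' x $ j $ i *\<^sub>R \<omega> c' t' x j) ** transition_matrix E t t' x"
      using conn unfolding metric_connection_def bundle_connection_def by (elim conjE)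
    moreover have "z \<in> fst c \<inter> fst c' \<inter> fst t \<inter> fst t'" using zc z by blast
    ultimately have "transition_matrix E t t' z ** \<omega> c t z i =
          pderiv_chart c i (transition_matrix E t t') z +
          (\<Sum>j\<in>UNIV. chart_jacobian c c' z $ j $ i *\<^sub>R \<omega> c' t' z j) ** transition_matrix E t t' z"
      using c c' t t' by blast
    moreover have "transition_matrix E t t' z = T (fst q)" by (simp add: T_def z(1))
    moreover have "pderiv_chart c i (transition_matrix E t t') z = dT (axis i 1)"
      unfolding pderiv_chart_def zc(3) dT_def T_def[abs_def] o_def ..
    ultimately have "T (fst q) ** \<omega> c t z i = dT (axis i 1) +
          (\<Sum>j\<in>UNIV. J $ j $ i *\<^sub>R \<omega> c' t' z j) ** T (fst q)"
      by (simp only: J_def)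
    then have "(T (fst q) ** \<omega> c t z i) *v y = (dT (axis i 1) +
          (\<Sum>j\<in>UNIV. J $ j $ i *\<^sub>R \<omega> c' t' z j) ** T (fst q)) *v y" by simp
    then show ?thesis
      by (simp add: matrix_vector_mul_assoc[symmetric] matrix_vector_mult_add_rdistrib sum_matrix_vector_mult
          scaleR_matrix_vector_assoc[symmetric])
  qed
  \<comment> \<open>The transformation rule of the connection, contracted with \<open>a\<close>. It
    states that the differential of \<open>\<Theta>\<close> maps the horizontal lift of
    \<open>a\<close> to that of \<open>J *v a\<close>.\<close>
  have rule: "T (fst q) *v (cform c t (fst q) a *v y) = dT a *v y + cform c' t' (snd c' z) (J *v a) *v (T (fst q) *v y)" for y
  proof -
    have "T (fst q) *v (cform c t (fst q) a *v y) = (\<Sum>i\<in>UNIV. a $ i *\<^sub>R (T (fst q) *v (\<omega> c t z i *v y)))"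
      by (simp add: cform_def z(1)[symmetric] sum_matrix_vector_mult scaleR_matrix_vector_assoc[symmetric]
          linear_sum[OF matrix_vector_mul_linear] matrix_vector_mult_scaleR)
    also have "\<dots> = (\<Sum>i\<in>UNIV. a $ i *\<^sub>R (dT (axis i 1) *v y)) +
        (\<Sum>i\<in>UNIV. \<Sum>j\<in>UNIV. (a $ i * J $ j $ i) *\<^sub>R (\<omega> c' t' z j *v (T (fst q) *v y)))"
      unfolding rule_i by (simp add: scaleR_add_right sum.distrib scaleR_sum_right)
    also have "(\<Sum>i\<in>UNIV. a $ i *\<^sub>R (dT (axis i 1) *v y)) = dT a *v y"
      by (subst linear_axis_expand[OF has_derivative_linear[OF dT], of a])
        (simp add: sum_matrix_vector_mult scaleR_matrix_vector_assoc[symmetric])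
    also have "(\<Sum>i\<in>UNIV. \<Sum>j\<in>UNIV. (a $ i * J $ j $ i) *\<^sub>R (\<omega> c' t' z j *v (T (fst q) *v y))) =
        (\<Sum>j\<in>UNIV. (J *v a) $ j *\<^sub>R (\<omega> c' t' z j *v (T (fst q) *v y)))"
      by (subst sum.swap) (simp add: matrix_vector_mult_def scaleR_sum_left[symmetric] mult.commute)
    also have "\<dots> = cform c' t' (snd c' z) (J *v a) *v (T (fst q) *v y)"
      by (simp add: cform_def ciz sum_matrix_vector_mult scaleR_matrix_vector_assoc[symmetric])
    finally show ?thesis .
  qed
  have "(\<Theta> has_derivative (\<lambda>v. (J *v fst v, T (fst q) *v snd v + dT (fst v) *v snd q))) (at q)"
    unfolding \<Theta>_def[abs_def]
    by (intro has_derivative_Pair has_derivative_compose[OF has_derivative_fst[OF has_derivative_ident] d\<tau>]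
        bounded_bilinear.FDERIV[OF bounded_bilinear_matrix_vector_mult] has_derivative_snd has_derivative_ident
        has_derivative_compose[OF has_derivative_fst[OF has_derivative_ident] dT])
  moreover have \<Theta>q: "\<Theta> q \<in> cdom0 c' t'" using \<Theta>dom q qD by (simp add: mem_Times_iff)
  note smooth_on_has_derivative[OF smooth_logr[OF c' t' u] open_cdom0[OF c' t'] this]
  ultimately have "((\<lambda>p. logr u c' t' (\<Theta> p)) has_derivative (\<lambda>v. frechet_derivative (logr u c' t') (at (\<Theta> q))
      (J *v fst v, T (fst q) *v snd v + dT (fst v) *v snd q))) (at q)"
    by (rule has_derivative_compose)
  then have "(logr u c t has_derivative (\<lambda>v. frechet_derivative (logr u c' t') (at (\<Theta> q))
      (J *v fst v, T (fst q) *v snd v + dT (fst v) *v snd q))) (at q)"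
    by (rule has_derivative_transform_within_open[OF _ open_Times[OF opD open_Compl[OF closed_singleton[of 0]]]])
      (use qD y0 logr\<Theta> in \<open>auto simp: mem_Times_iff\<close>)
  note dU = frechet_derivative_at[OF this, symmetric]
  have "hderiv u c t a q = hderiv u c' t' (J *v a) (\<Theta> q)"
    unfolding hderiv_def dU using rule[of "snd q"]
    by (simp add: adapted_def \<Theta>_def \<tau>q matrix_vector_mult_diff_distrib linear_neg[OF matrix_vector_mul_linear] algebra_simps)
  then show thesis
    using that[OF \<Theta>q] by (simp add: J_def \<Theta>_def \<tau>q)
qed

lemma g_transform:
  assumes "c \<in> \<A>" "c' \<in> \<A>" "z \<in> fst c" "z \<in> fst c'"
  shows "a \<bullet> (g c z *v a) = (chart_jacobian c c' z *v a) \<bullet> (g c' z *v (chart_jacobian c c' z *v a))"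
proof -
  have "\<forall>c\<in>\<A>. \<forall>c'\<in>\<A>. \<forall>x\<in>fst c \<inter> fst c'.
        g c x = transpose (chart_jacobian c c' x) ** g c' x ** chart_jacobian c c' x"
    using riem unfolding riemannian_metric_def by (elim conjE)
  then have "g c z = transpose (chart_jacobian c c' z) ** g c' z ** chart_jacobian c c' z"
    using assms by blast
  then show ?thesis by (simp only: matrix_vector_mul_assoc[symmetric] inner_transpose_mult)
qed

section \<open>The maximum principle\<close>

definition "gnorm c z = snd z \<bullet> (g c (chart_inv c (fst z)) *v snd z)" for z :: "(real^'n) \<times> (real^'n)"

context
  fixes c t assumes c: "c \<in> \<A>" and t: "t \<in> trivs E"
begin

lemma smooth_g_chart: "smooth_on (snd c ` fst c) (\<lambda>x. g c (chart_inv c x))"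
proof -
  have "\<forall>c\<in>\<A>. smooth_fun \<A> (fst c) (g c) \<and>
        (\<forall>x\<in>fst c. transpose (g c x) = g c x \<and> (\<forall>a. a \<noteq> 0 \<longrightarrow> a \<bullet> (g c x *v a) > 0))"
    using riem unfolding riemannian_metric_def by (elim conjE)
  then have "smooth_fun \<A> (fst c) (g c)" using c by blast
  then have "smooth_on (snd c ` (fst c \<inter> fst c)) (g c \<circ> chart_inv c)"
    using c unfolding smooth_fun_def by blast
  then show ?thesis by (simp add: o_def)
qed

lemma gnorm_pos: "x \<in> cdom c t \<Longrightarrow> a \<noteq> 0 \<Longrightarrow> gnorm c (x, a) > 0"
  unfolding gnorm_def using g_pos[OF c t] domD[OF c, of x t] by simp

lemma gnorm_scale: "gnorm c (x, r *\<^sub>R a) = r\<^sup>2 * gnorm c (x, a)"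
  by (simp add: gnorm_def matrix_vector_mult_scaleR power2_eq_square)

lemma gnorm_continuous: "continuous_on (cdom c t \<times> UNIV) (gnorm c)"
proof -
  have "smooth_on (cdom c t \<times> UNIV) (\<lambda>z :: (real^'n) \<times> (real^'n). g c (chart_inv c (fst z)))"
    by (rule smooth_on_compose[OF smooth_g_chart smooth_on_fst[OF smooth_on_ident]]) auto
  then have "smooth_on (cdom c t \<times> UNIV) (gnorm c)"
    unfolding gnorm_def[abs_def]
    by (intro smooth_on_inner smooth_on_matrix_vector_mult smooth_on_snd smooth_on_ident)
  then show ?thesis by (rule smooth_on_continuous_on)
qed

text \<open>The vector moves along the coordinate line as a parallel field does to first order; by
  metric compatibility its length is then stationary at time 0.\<close>

lemma gnorm_parallel:
  assumes x: "x \<in> snd c ` fst c"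
  shows "((\<lambda>s. gnorm c (x + s *\<^sub>R a, a - s *\<^sub>R (gform c x a *v a))) has_vector_derivative 0) (at 0)"
proof -
  let ?M = "\<lambda>x. g c (chart_inv c x)"
  let ?D = "frechet_derivative ?M (at x)"
  have dM: "(?M has_derivative ?D) (at x)"
    by (rule smooth_on_has_derivative[OF smooth_g_chart chart_open_image[OF c] x])
  have ci: "chart_inv c x \<in> fst c" "snd c (chart_inv c x) = x"
    using chart_inv_in[OF x] chart_inv_right[OF x] by simp_all
  have "?D (axis i 1) = transpose (\<Gamma> c (chart_inv c x) i) ** ?M x + ?M x ** \<Gamma> c (chart_inv c x) i" for i
  proof -
    have "pderiv_chart c i (g c) (chart_inv c x) = transpose (\<Gamma> c (chart_inv c x) i) ** ?M x + ?M x ** \<Gamma> c (chart_inv c x) i"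
      using levi c ci(1) unfolding levi_civita_def by blast
    then show ?thesis unfolding pderiv_chart_def ci(2) o_def .
  qed
  note DM = metric_connection_derivative[of ?D "\<lambda>i. \<Gamma> c (chart_inv c x) i", OF has_derivative_linear[OF dM] this, folded gform_def]
  have "(gnorm c has_derivative (\<lambda>z. snd (x, a) \<bullet> (?M (fst (x, a)) *v snd z + ?D (fst z) *v snd (x, a)) +
      snd z \<bullet> (?M (fst (x, a)) *v snd (x, a)))) (at (x, a))"
    unfolding gnorm_def[abs_def]
    by (intro bounded_bilinear.FDERIV[OF bounded_bilinear_inner] has_derivative_snd has_derivative_ident
        bounded_bilinear.FDERIV[OF bounded_bilinear_matrix_vector_mult]
        has_derivative_compose[OF has_derivative_fst[OF has_derivative_ident]]) (simp add: dM)
  moreover have "((\<lambda>s. (x + s *\<^sub>R a, a - s *\<^sub>R (gform c x a *v a))) has_vector_derivative (a, - (gform c x a *v a))) (at 0)"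
    by (auto intro!: derivative_eq_intros)
  ultimately have "((\<lambda>s. gnorm c (x + s *\<^sub>R a, a - s *\<^sub>R (gform c x a *v a))) has_vector_derivative
     (a \<bullet> (?M x *v (- (gform c x a *v a)) + ?D a *v a) + (- (gform c x a *v a)) \<bullet> (?M x *v a))) (at 0)"
    using has_vector_derivative_chain[where f="gnorm c" and \<gamma>="\<lambda>s. (x + s *\<^sub>R a, a - s *\<^sub>R (gform c x a *v a))" and t=0] by fastforce
  moreover have "a \<bullet> (?M x *v (- (gform c x a *v a)) + ?D a *v a) + (- (gform c x a *v a)) \<bullet> (?M x *v a) = 0"
    unfolding inner_add_right DM by (simp add: linear_neg[OF matrix_vector_mul_linear])
  ultimately show ?thesis by simp
qed

text \<open>At a maximum of \<open>L\<^sub>a\<^sup>2 / g(a, a)\<close>, moving along the horizontal geodesic with initial velocity \<open>a\<close> to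
  first order shows that the horizontal Hessian vanishes unless \<open>L\<^sub>a = 0\<close>.\<close>

lemma horizontal_maximum:
  assumes u: "smooth_sphere u" and conv: "convex_graph \<A> g \<Gamma> E h \<omega> (graph u)"
    and q: "q \<in> cdom0 c t"
    and le: "\<And>q a. q \<in> cdom0 c t \<Longrightarrow> (hderiv u c t a q)\<^sup>2 \<le> M * gnorm c (fst q, a)"
    and eq: "(hderiv u c t a q)\<^sup>2 = M * gnorm c (fst q, a)"
  shows "hderiv u c t a q = 0"
proof (rule ccontr)
  assume nz: "hderiv u c t a q \<noteq> 0"
  define V where "V = adapted c t q (a, 0)"
  define b where "b = gform c (fst q) a *v a"
  \<comment> \<open>A straight coordinate line tangent to the horizontal lift suffices, as only the
    first derivative at time 0 is used.\<close>
  define p where "p s = q + s *\<^sub>R V" for s :: real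
  have p0: "p 0 = q" by (simp add: p_def)
  have pV: "(p has_vector_derivative V) (at 0)"
    unfolding p_def[abs_def] by (auto intro!: derivative_eq_intros)
  have dL: "(hderiv u c t a' has_derivative frechet_derivative (hderiv u c t a') (at q)) (at q)" for a'
    by (rule smooth_on_has_derivative[OF smooth_hderiv[OF c t u] open_cdom0[OF c t] q])
  have dLp: "((\<lambda>s. hderiv u c t a' (p s)) has_vector_derivative frechet_derivative (hderiv u c t a') (at q) V) (at 0)" for a'
    using dL pV by (intro has_vector_derivative_chain[where f="hderiv u c t a'" and \<gamma>=p]) (simp_all add: p0)
  \<comment> \<open>By linearity this is the horizontal derivative at \<open>p s\<close> in the
    direction \<open>a - s *\<^sub>R b\<close>, the first order parallel transport of
    \<open>a\<close>. Its derivative \<open>d\<close> at 0 is the Hessian at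
    \<open>(a, a)\<close>.\<close>
  define l where "l s = hderiv u c t a (p s) - s * hderiv u c t b (p s)" for s
  define d where "d = frechet_derivative (hderiv u c t a) (at q) V - hderiv u c t b q"
  have l0: "l 0 = hderiv u c t a q" by (simp add: l_def p0)
  have dl: "(l has_real_derivative d) (at 0)"
    unfolding l_def[abs_def] d_def
    using dLp[of a, unfolded has_real_derivative_iff_has_vector_derivative[symmetric]]
      dLp[of b, unfolded has_real_derivative_iff_has_vector_derivative[symmetric]]
    by (auto intro!: derivative_eq_intros simp: p0)
  define e where "e s = gnorm c (fst q + s *\<^sub>R a, a - s *\<^sub>R b)" for s
  have de: "(e has_real_derivative 0) (at 0)"
    unfolding e_def[abs_def] b_def has_real_derivative_iff_has_vector_derivative
    by (rule gnorm_parallel) (use q in auto)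
  \<comment> \<open>The difference with the bound \<open>M\<close> replaces the quotient: it is at
    most 0 near time 0 and equals 0 at time 0.\<close>
  have dphi: "((\<lambda>s. (l s)\<^sup>2 - M * e s) has_real_derivative 2 * l 0 * d) (at 0)"
    using dl de by (auto intro!: derivative_eq_intros)
  obtain \<delta> where \<delta>: "\<delta> > 0" "\<And>s. \<bar>s\<bar> < \<delta> \<Longrightarrow> p s \<in> cdom0 c t"
    using curve_in_open[OF pV open_cdom0[OF c t]] q unfolding p0 by blast
  have l_eq: "l s = hderiv u c t (a - s *\<^sub>R b) (p s)" if "\<bar>s\<bar> < \<delta>" for s
    using linear_diff[OF linear_hderiv[OF c t u \<delta>(2)[OF that]]] linear_scale[OF linear_hderiv[OF c t u \<delta>(2)[OF that]]]
    by (simp add: l_def)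
  have e_eq: "e s = gnorm c (fst (p s), a - s *\<^sub>R b)" for s
    by (simp add: e_def p_def V_def adapted_def)
  have "2 * l 0 * d = 0"
  proof (rule DERIV_local_max[OF dphi \<delta>(1)], intro allI impI)
    fix s assume "\<bar>0 - s\<bar> < \<delta>"
    then have s: "\<bar>s\<bar> < \<delta>" by simp
    have "(l s)\<^sup>2 - M * e s \<le> 0"
      unfolding l_eq[OF s] e_eq using le[OF \<delta>(2)[OF s], of "a - s *\<^sub>R b"] by simp
    also have "0 = (l 0)\<^sup>2 - M * e 0" using eq by (simp add: l0 e_def)
    finally show "(l s)\<^sup>2 - M * e s \<le> (l 0)\<^sup>2 - M * e 0" .
  qed
  then have "d = 0" using nz l0 by simp
  then have "(hderiv u c t a q)\<^sup>2 \<le> 0"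
    using convex_hessian[OF c t u conv q, of a] by (simp add: d_def V_def b_def)
  with nz show False by simp
qed

end

lemma hderiv_quotient_scale:
  assumes "c \<in> \<A>" "t \<in> trivs E" "smooth_sphere u" "q \<in> cdom0 c t" "r \<noteq> 0" "s > 0"
  shows "(hderiv u c t (r *\<^sub>R a) (fst q, s *\<^sub>R snd q))\<^sup>2 / gnorm c (fst q, r *\<^sub>R a) =
    (hderiv u c t a q)\<^sup>2 / gnorm c (fst q, a)"
  using linear_scale[OF linear_hderiv[OF assms(1-4)], of r a] assms(5)
  unfolding hderiv_scale[OF assms(1-4,6)] gnorm_scale[OF assms(1,2)] by (simp add: power_mult_distrib)

text \<open>The maximum is taken over a compact set of real values rather than over a bundle.
  Finitely many coordinate balls with closures inside the chart domains cover the base, and since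
  the quotient ignores the scaling of fibre vector and direction, both may be taken on Euclidean
  unit spheres.\<close>

lemma convex_horizontally_constant:
  assumes cpt: "compact_space X" and u: "smooth_sphere u" and conv: "convex_graph \<A> g \<Gamma> E h \<omega> (graph u)"
    and c: "c \<in> \<A>" and t: "t \<in> trivs E" and q: "q \<in> cdom0 c t"
  shows "hderiv u c t a q = 0"
proof (cases "a = 0")
  case True
  then show ?thesis using linear_0[OF linear_hderiv[OF c t u q]] by simp
next
  case False
  have "\<exists>c t r. c \<in> \<A> \<and> t \<in> trivs E \<and> x \<in> fst c \<and> x \<in> fst t \<and> 0 < r \<and> cball (snd c x) r \<subseteq> cdom c t"
    if x: "x \<in> topspace X" for x
  proof -
    obtain c t where ct: "c \<in> \<A>" "t \<in> trivs E" "x \<in> fst c" "x \<in> fst t"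
      using chart_exists[OF x] triv_exists[OF x] by blast
    then have "snd c x \<in> cdom c t" by auto
    then obtain r where "r > 0" "cball (snd c x) r \<subseteq> cdom c t"
      using open_dom[OF ct(1,2)] open_contains_cball by blast
    with ct show ?thesis by blast
  qed
  then obtain cf tf rf where cf: "\<And>x. x \<in> topspace X \<Longrightarrow> cf x \<in> \<A>"
    and tf: "\<And>x. x \<in> topspace X \<Longrightarrow> tf x \<in> trivs E"
    and xin: "\<And>x. x \<in> topspace X \<Longrightarrow> x \<in> fst (cf x)"
    and rf: "\<And>x. x \<in> topspace X \<Longrightarrow> 0 < (rf x :: real)"
    and sub: "\<And>x. x \<in> topspace X \<Longrightarrow> cball (snd (cf x) x) (rf x) \<subseteq> cdom (cf x) (tf x)"
    by metis
  define Ox where "Ox x = {z \<in> fst (cf x). snd (cf x) z \<in> ball (snd (cf x) x) (rf x)}" for x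
  have "\<exists>\<F>. finite \<F> \<and> \<F> \<subseteq> Ox ` topspace X \<and> topspace X \<subseteq> \<Union>\<F>"
  proof (rule compactinD)
    show "compactin X (topspace X)" using cpt by (simp add: compact_space_def)
    show "openin X U" if "U \<in> Ox ` topspace X" for U
      using that cf chart_preimage_openin[OF _ open_ball] by (auto simp: Ox_def)
    show "topspace X \<subseteq> \<Union>(Ox ` topspace X)"
      using xin rf by (auto simp: Ox_def)
  qed
  then obtain I where I: "finite I" "I \<subseteq> topspace X" "topspace X \<subseteq> \<Union>(Ox ` I)"
    by (metis finite_subset_image)
  define Q where "Q c t z = (hderiv u c t (snd (snd z)) (fst z, fst (snd z)))\<^sup>2 / gnorm c (fst z, snd (snd z))"
    for c t and z :: "(real^'n) \<times> (real^'m) \<times> (real^'n)"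
  define Kc :: "'a \<Rightarrow> ((real^'n) \<times> (real^'m) \<times> (real^'n)) set"
    where "Kc x = cball (snd (cf x) x) (rf x) \<times> (sphere 0 1 \<times> sphere 0 1)" for x
  have Kc_dom: "(fst z, fst (snd z)) \<in> cdom0 (cf x) (tf x) \<and> snd (snd z) \<noteq> 0" if "x \<in> topspace X" "z \<in> Kc x" for x z
    using that sub[OF that(1)] by (auto simp: Kc_def)
  define W where "W = (\<Union>x\<in>I. Q (cf x) (tf x) ` Kc x)"
  have Q_cont: "continuous_on (Kc x) (Q (cf x) (tf x))" if x: "x \<in> topspace X" for x
  proof -
    have L: "continuous_on (Kc x) (\<lambda>z. hderiv u (cf x) (tf x) b (fst z, fst (snd z)))" for b
      by (rule continuous_on_compose2[OF smooth_on_continuous_on[OF smooth_hderiv[OF cf[OF x] tf[OF x] u]]])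
        (use Kc_dom[OF x] in \<open>auto intro!: continuous_intros\<close>)
    \<comment> \<open>Joint continuity in the point and the direction: \<open>hderiv\<close> is
      known to be continuous for each fixed direction and linear in the direction.\<close>
    have "continuous_on (Kc x) (\<lambda>z. \<Sum>i\<in>UNIV. snd (snd z) $ i * hderiv u (cf x) (tf x) (axis i 1) (fst z, fst (snd z)))"
      by (intro continuous_intros L)
    then have "continuous_on (Kc x) (\<lambda>z. hderiv u (cf x) (tf x) (snd (snd z)) (fst z, fst (snd z)))"
    proof (rule continuous_on_eq)
      fix z assume "z \<in> Kc x"
      from linear_axis_expand[OF linear_hderiv[OF cf[OF x] tf[OF x] u conjunct1[OF Kc_dom[OF x this]]], of "snd (snd z)"]
      show "(\<Sum>i\<in>UNIV. snd (snd z) $ i * hderiv u (cf x) (tf x) (axis i 1) (fst z, fst (snd z))) =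
        hderiv u (cf x) (tf x) (snd (snd z)) (fst z, fst (snd z))" by simp
    qed
    moreover have "continuous_on (Kc x) (\<lambda>z. gnorm (cf x) (fst z, snd (snd z)))"
      by (rule continuous_on_compose2[OF gnorm_continuous[OF cf[OF x] tf[OF x]]])
        (use Kc_dom[OF x] in \<open>auto intro!: continuous_intros\<close>)
    moreover have "gnorm (cf x) (fst z, snd (snd z)) \<noteq> 0" if "z \<in> Kc x" for z
      using gnorm_pos[OF cf[OF x] tf[OF x], of "fst z" "snd (snd z)"] Kc_dom[OF x that] by auto
    ultimately show ?thesis
      unfolding Q_def[abs_def] by (intro continuous_intros) auto
  qed
  have "compact W"
    unfolding W_def
  proof (intro compact_UN I(1) compact_continuous_image Q_cont)
    show "compact (Kc x)" for x unfolding Kc_def by (intro compact_Times compact_cball compact_sphere)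
  qed (use I(2) in auto)
  \<comment> \<open>Any quotient, in any coordinates, is also attained on one of the chosen compact
    sets: change to the coordinates of a covering ball, then normalise the fibre vector and the
    direction.\<close>
  have mem: "Q c t (fst q, snd q, a) \<in> W" if c: "c \<in> \<A>" and t: "t \<in> trivs E" and q: "q \<in> cdom0 c t" and a: "a \<noteq> 0" for c t q a
  proof -
    have d: "fst q \<in> cdom c t" using q by auto
    define z where "z = chart_inv c (fst q)"
    have z: "z \<in> fst c" using domD[OF c d] by (simp add: z_def)
    then obtain x where x: "x \<in> I" "z \<in> Ox x" using I(3) chart_subset[OF c] by blast
    have xt: "x \<in> topspace X" using x I by blast
    have zc: "z \<in> fst (cf x)" "snd (cf x) z \<in> ball (snd (cf x) x) (rf x)" using x(2) by (auto simp: Ox_def)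
    then have "snd (cf x) z \<in> cdom (cf x) (tf x)" using sub[OF xt] ball_subset_cball by blast
    then have zt: "z \<in> fst (tf x)"
      using domD[OF cf[OF xt], of "snd (cf x) z" "tf x"] zc(1) cf[OF xt] by simp
    obtain q' where q': "q' \<in> cdom0 (cf x) (tf x)" "fst q' = snd (cf x) z"
      and L: "hderiv u (cf x) (tf x) (chart_jacobian c (cf x) z *v a) q' = hderiv u c t a q"
      by (rule hderiv_transform[OF c t cf[OF xt] tf[OF xt] u q z_def zc(1) zt]) blast
    define a' where "a' = chart_jacobian c (cf x) z *v a"
    have G: "gnorm (cf x) (fst q', a') = gnorm c (fst q, a)"
      using g_transform[OF c cf[OF xt] z zc(1), of a] cf[OF xt] zc(1)
      by (simp add: gnorm_def q'(2) a'_def z_def[symmetric])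
    have a'0: "a' \<noteq> 0"
      using G gnorm_pos[OF c t d a] by (auto simp: gnorm_def)
    have y'0: "snd q' \<noteq> 0" using q'(1) by auto
    let ?z = "(fst q', (1 / norm (snd q')) *\<^sub>R snd q', (1 / norm a') *\<^sub>R a')"
    have "Q (cf x) (tf x) ?z = (hderiv u (cf x) (tf x) a' q')\<^sup>2 / gnorm (cf x) (fst q', a')"
      unfolding Q_def fst_conv snd_conv
      by (rule hderiv_quotient_scale[OF cf[OF xt] tf[OF xt] u q'(1)]) (use a'0 y'0 in auto)
    also have "\<dots> = Q c t (fst q, snd q, a)"
      unfolding G L[folded a'_def] by (simp add: Q_def)
    finally have "Q c t (fst q, snd q, a) = Q (cf x) (tf x) ?z" by simp
    moreover have "?z \<in> Kc x"
      using zc(2) a'0 y'0 by (auto simp: Kc_def q'(2) dist_norm)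
    ultimately show ?thesis unfolding W_def using x(1) by blast
  qed
  have "W \<noteq> {}" using mem[OF c t q False] by blast
  from compact_attains_sup[OF \<open>compact W\<close> this] obtain M where M_in: "M \<in> W" and M_max: "\<forall>w\<in>W. w \<le> M"
    by (elim bexE)
  note M = M_in bspec[OF M_max]
  have le: "(hderiv u c t a q)\<^sup>2 \<le> M * gnorm c (fst q, a)"
    if c: "c \<in> \<A>" and t: "t \<in> trivs E" and q: "q \<in> cdom0 c t" for c t q a
  proof (cases "a = 0")
    case True
    then show ?thesis using linear_0[OF linear_hderiv[OF c t u q]] by (simp add: gnorm_def)
  next
    case False
    then have "gnorm c (fst q, a) > 0" using gnorm_pos[OF c t] q by auto
    then show ?thesis using M(2)[OF mem[OF c t q False]] by (simp add: Q_def divide_le_eq)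
  qed
  from M(1) obtain x z where x: "x \<in> I" "z \<in> Kc x" and Mz: "M = Q (cf x) (tf x) z"
    unfolding W_def by blast
  have xt: "x \<in> topspace X" using x I by blast
  have zd: "(fst z, fst (snd z)) \<in> cdom0 (cf x) (tf x)" and z0: "snd (snd z) \<noteq> 0" using Kc_dom[OF xt x(2)] by auto
  have gp: "gnorm (cf x) (fst z, snd (snd z)) > 0" using gnorm_pos[OF cf[OF xt] tf[OF xt] _ z0] zd by auto
  have "hderiv u (cf x) (tf x) (snd (snd z)) (fst z, fst (snd z)) = 0"
  proof (rule horizontal_maximum[OF cf[OF xt] tf[OF xt] u conv zd le[OF cf[OF xt] tf[OF xt]]])
    show "(hderiv u (cf x) (tf x) (snd (snd z)) (fst z, fst (snd z)))\<^sup>2 =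
      M * gnorm (cf x) (fst (fst z, fst (snd z)), snd (snd z))"
      using gp by (simp add: Mz Q_def)
  qed
  \<comment> \<open>The largest quotient is 0, so the bound \<open>le\<close> leaves no other value
    for \<open>hderiv\<close>.\<close>
  then have "M = 0" by (simp add: Mz Q_def)
  then show ?thesis using le[OF c t q, of a] by simp
qed

section \<open>Parallel transport\<close>

text \<open>\<open>P\<close> solves the linear equation of parallel transport along the coordinate
  segment from \<open>x0\<close> to \<open>x1\<close>. Horizontal curves preserve the norm, because
  the connection is metric, and preserve \<open>rgauge\<close>, because \<open>hderiv\<close>
  vanishes.\<close>

lemma parallel_transport:
  assumes u: "smooth_sphere u" and c: "c \<in> \<A>" and t: "t \<in> trivs E" and x0: "x0 \<in> cdom c t"
    and LL0: "\<And>a q. q \<in> cdom0 c t \<Longrightarrow> hderiv u c t a q = 0"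
  shows "\<exists>\<delta>>0. \<forall>x1\<in>ball x0 \<delta>. x1 \<in> cdom c t \<and> (\<exists>P. linear P \<and>
    (\<forall>y. sqnorm c t (x1, P y) = sqnorm c t (x0, y)) \<and> (\<forall>y. y \<noteq> 0 \<longrightarrow> rgauge u c t (x1, P y) = rgauge u c t (x0, y)))"
proof -
  obtain r where r: "r > 0" "cball x0 r \<subseteq> cdom c t"
    using open_dom[OF c t] x0 open_contains_cball by blast
  obtain k where k: "k > 0" "\<And>(M :: real^'m^'m) (N :: real^'m^'m). norm (M ** N) \<le> norm M * norm N * k"
    using bounded_bilinear.pos_bounded[OF bounded_bilinear_matrix_matrix_mult] by blast
  define N where "N x = (\<Sum>i\<in>UNIV. norm (cform c t x (axis i 1)))" for x
  have cform_cont: "continuous_on (cdom c t) (\<lambda>x. cform c t x a)" for a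
    by (rule smooth_on_continuous_on[OF smooth_cform[OF c t]])
  have "continuous_on (cball x0 r) N"
    unfolding N_def by (intro continuous_intros continuous_on_subset[OF cform_cont r(2)])
  then have "bounded (N ` cball x0 r)"
    by (intro compact_imp_bounded compact_continuous_image compact_cball)
  then obtain C where "C > 0" and C_abs: "\<forall>y\<in>N ` cball x0 r. norm y \<le> C"
    unfolding bounded_pos by blast
  have NC: "N x \<le> C" if "x \<in> cball x0 r" for x
    using bspec[OF C_abs imageI[OF that]] by simp
  have cform_le: "norm (cform c t x a) \<le> norm a * C" if "x \<in> cball x0 r" for x a
  proof -
    have "norm (cform c t x a) \<le> (\<Sum>i\<in>UNIV. norm (a $ i *\<^sub>R cform c t x (axis i 1)))"
      unfolding linear_axis_expand[OF linear_cform, of c t x a] by (rule norm_sum)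
    also have "\<dots> \<le> (\<Sum>i\<in>UNIV. norm a * norm (cform c t x (axis i 1)))"
      by (intro sum_mono) (simp add: mult_right_mono component_le_norm_cart)
    also have "\<dots> = norm a * N x" by (simp add: N_def sum_distrib_left)
    also have "\<dots> \<le> norm a * C" using NC[OF that] by (simp add: mult_left_mono)
    finally show ?thesis .
  qed
  \<comment> \<open>\<open>C\<close> bounds the connection matrix on the ball and \<open>k\<close>
    is the constant for the norm of matrix products, so a segment shorter than
    \<open>1 / (2 * k * C)\<close> yields the Lipschitz constant 1/2 required by
    \<open>lipschitz_ode_solution\<close>.\<close>
  define \<delta> where "\<delta> = min r (1 / (2 * k * C))"
  have "\<delta> > 0" using r(1) k(1) \<open>C > 0\<close> by (simp add: \<delta>_def)
  moreover have "x1 \<in> cdom c t \<and> (\<exists>P. linear P \<and>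
    (\<forall>y. sqnorm c t (x1, P y) = sqnorm c t (x0, y)) \<and> (\<forall>y. y \<noteq> 0 \<longrightarrow> rgauge u c t (x1, P y) = rgauge u c t (x0, y)))"
    if x1: "x1 \<in> ball x0 \<delta>" for x1
  proof -
    define a where "a = x1 - x0"
    have na: "norm a < r" "norm a < 1 / (2 * k * C)"
      using x1 by (auto simp: a_def \<delta>_def dist_norm norm_minus_commute)
    have seg: "x0 + s *\<^sub>R a \<in> cball x0 r" if "s \<in> {0..1}" for s
    proof -
      have "\<bar>s\<bar> * norm a \<le> 1 * norm a" using that by (intro mult_right_mono) auto
      then show ?thesis using na(1) by (simp add: dist_norm)
    qed
    then have segd: "x0 + s *\<^sub>R a \<in> cdom c t" if "s \<in> {0..1}" for s using r(2) that by blast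
    define f where "f s M = - cform c t (x0 + s *\<^sub>R a) a ** M" for s and M :: "real^'m^'m"
    have "continuous_on ({0..1} \<times> UNIV) (\<lambda>(s, M). f s M)"
    proof -
      have "continuous_on ({0..1} \<times> (UNIV :: (real^'m^'m) set)) (\<lambda>z. cform c t (x0 + fst z *\<^sub>R a) a)"
        by (rule continuous_on_compose2[OF cform_cont]) (use segd in \<open>auto intro!: continuous_intros\<close>)
      then show ?thesis
        unfolding f_def case_prod_unfold
        by (intro bounded_bilinear.continuous_on[OF bounded_bilinear_matrix_matrix_mult] continuous_intros)
    qed
    moreover have "norm (f s M - f s M') \<le> norm (M - M') / 2" if s: "s \<in> {0..1}" for s M M'
    proof -
      have "f s M - f s M' = - cform c t (x0 + s *\<^sub>R a) a ** (M - M')"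
        unfolding f_def using bounded_bilinear.diff_right[OF bounded_bilinear_matrix_matrix_mult] by metis
      then have "norm (f s M - f s M') \<le> norm (cform c t (x0 + s *\<^sub>R a) a) * norm (M - M') * k"
        using k(2)[of "- cform c t (x0 + s *\<^sub>R a) a" "M - M'"] by simp
      also have "\<dots> \<le> (norm a * C) * norm (M - M') * k"
        using cform_le[OF seg[OF s], of a] k(1) by (intro mult_right_mono) auto
      also have "\<dots> = (norm a * (k * C)) * norm (M - M')" by simp
      also have "\<dots> \<le> (1 / 2) * norm (M - M')"
        using na(2) k(1) \<open>C > 0\<close> by (intro mult_right_mono) (auto simp: field_simps)
      finally show ?thesis by simp
    qed
    ultimately obtain P where P0: "P 0 = mat 1"
      and P: "\<And>s. s \<in> {0..1} \<Longrightarrow> (P has_vector_derivative f s (P s)) (at s within {0..1})"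
      using lipschitz_ode_solution[of f "mat 1"] by blast
    \<comment> \<open>The horizontal lift of the segment that starts at \<open>y\<close>: its
      velocity is the adapted vector with components \<open>(a, 0)\<close>.\<close>
    define p where "p y s = (x0 + s *\<^sub>R a, P s *v y)" for y s
    have p: "(p y has_vector_derivative adapted c t (p y s) (a, 0)) (at s within {0..1})" if s: "s \<in> {0..1}" for y s
    proof -
      have "((\<lambda>s. P s *v y) has_vector_derivative f s (P s) *v y) (at s within {0..1})"
        using bounded_linear.has_vector_derivative[OF bounded_bilinear.bounded_linear_left[OF bounded_bilinear_matrix_vector_mult] P[OF s]] .
      moreover have "f s (P s) *v y = - (cform c t (x0 + s *\<^sub>R a) a *v (P s *v y))"
        using bounded_bilinear.minus_left[OF bounded_bilinear_matrix_vector_mult]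
        by (simp add: f_def matrix_vector_mul_assoc[symmetric])
      ultimately show ?thesis
        unfolding p_def[abs_def] adapted_def
        by (auto intro!: derivative_eq_intros has_vector_derivative_Pair)
    qed
    have const: "F (p y \<tau>) = F (p y 0)"
      if \<tau>: "\<tau> \<in> {0..1}" and F: "\<And>s. s \<in> {0..1} \<Longrightarrow> (F has_derivative F' s) (at (p y s)) \<and> F' s (adapted c t (p y s) (a, 0)) = 0"
      for F :: "(real^'n) \<times> (real^'m) \<Rightarrow> real" and F' y \<tau>
    proof -
      have "((\<lambda>s. F (p y s)) has_vector_derivative 0) (at s within {0..1})" if s: "s \<in> {0..1}" for s
        using has_vector_derivative_chain[OF conjunct1[OF F[OF s]] p[OF s, of y]] F[OF s] by simp
      then obtain C where "\<And>s. s \<in> {0..1} \<Longrightarrow> F (p y s) = C"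
        using has_vector_derivative_zero_constant[of "{0..1::real}" "\<lambda>s. F (p y s)"] by (metis convex_real_interval(5))
      then show ?thesis using \<tau> by simp
    qed
    have x1a: "x0 + a = x1" by (simp add: a_def)
    have "x1 \<in> cdom c t" using segd[of 1] x1a by simp
    moreover have sq: "sqnorm c t (x0 + \<tau> *\<^sub>R a, P \<tau> *v y) = sqnorm c t (x0, y)" if \<tau>: "\<tau> \<in> {0..1}" for y \<tau>
    proof -
      have d: "fst (p y s) \<in> cdom c t" if "s \<in> {0..1}" for s using segd[OF that] by (simp add: p_def)
      have "(sqnorm c t has_derivative frechet_derivative (sqnorm c t) (at (p y s))) (at (p y s))" if "s \<in> {0..1}" for s
        using sqnorm_derivative[OF c t d[OF that]] frechet_derivative_at[OF sqnorm_derivative[OF c t d[OF that]]] by simp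
      then have "sqnorm c t (p y \<tau>) = sqnorm c t (p y 0)"
        using sqnorm_derivative_adapted[OF c t d, of _ "(a, 0)"]
        by (intro const[OF \<tau>, where F'="\<lambda>s. frechet_derivative (sqnorm c t) (at (p y s))"] conjI) simp_all
      then show ?thesis by (simp add: p_def P0)
    qed
    moreover have "rgauge u c t (x1, P 1 *v y) = rgauge u c t (x0, y)" if y: "y \<noteq> 0" for y
    proof -
      interpret radial_level "cdom0 c t" "\<lambda>q. (0, snd q)" "rgauge u c t" by (rule radial_level_rgauge[OF c t u])
      \<comment> \<open>Preservation of the norm comes first because it keeps the lift off the zero
        section, where \<open>rgauge\<close> could not be differentiated.\<close>
      have "p y s \<in> cdom0 c t" if s: "s \<in> {0..1}" for s
      proof -
        have "sqnorm c t (x0, y) > 0" using sqnorm_pos[OF c t, of "(x0, y)"] x0 y by auto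
        then have "P s *v y \<noteq> 0" using sq[OF s, of y] by (auto simp: sqnorm_def[OF c t])
        then show ?thesis using segd[OF s] by (auto simp: p_def)
      qed
      then have "rgauge u c t (p y 1) = rgauge u c t (p y 0)"
        using dFF_adapted[OF c t u, of _ a 0] LL0
        by (intro const[where F'="\<lambda>s. frechet_derivative (rgauge u c t) (at (p y s))"] conjI F_deriv) simp_all
      then show ?thesis by (simp add: p_def P0 x1a)
    qed
    moreover have "linear (\<lambda>y. P 1 *v y)" by (rule matrix_vector_mul_linear)
    ultimately show ?thesis using sq[of 1] x1a by auto
  qed
  ultimately show ?thesis by blast
qed

text \<open>Parallel transport is a linear isometry carrying one fibre of the graph onto the other,
  so the curvature at a point equals that at its image. Neither fibre is required to be a round
  sphere.\<close>

lemma curvature_locally_constant: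
  assumes u: "smooth_sphere u" and c: "c \<in> \<A>" and t: "t \<in> trivs E" and x0: "x0 \<in> cdom c t"
    and LL0: "\<And>a q. q \<in> cdom0 c t \<Longrightarrow> hderiv u c t a q = 0"
    and vc: "vertical_curvature_given_by E h (graph u) K"
    and K_fibre: "\<And>\<xi> \<eta>. \<xi> \<in> punctured E \<Longrightarrow> \<eta> \<in> punctured E \<Longrightarrow> proj E \<xi> = proj E \<eta> \<Longrightarrow> K \<xi> = K \<eta>"
  shows "\<exists>\<delta>>0. \<forall>\<xi>\<in>punctured E. \<forall>\<eta>\<in>punctured E. proj E \<xi> = chart_inv c x0 \<longrightarrow>
    proj E \<eta> \<in> fst c \<longrightarrow> snd c (proj E \<eta>) \<in> ball x0 \<delta> \<longrightarrow> K \<xi> = K \<eta>"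
proof -
  obtain \<delta> where \<delta>: "\<delta> > 0" and tr: "\<And>x1. x1 \<in> ball x0 \<delta> \<Longrightarrow> x1 \<in> cdom c t \<and> (\<exists>P. linear P \<and>
    (\<forall>y. sqnorm c t (x1, P y) = sqnorm c t (x0, y)) \<and> (\<forall>y. y \<noteq> 0 \<longrightarrow> rgauge u c t (x1, P y) = rgauge u c t (x0, y)))"
    using parallel_transport[OF u c t x0 LL0] by blast
  have "K \<xi> = K \<eta>" if \<xi>: "\<xi> \<in> punctured E" "proj E \<xi> = chart_inv c x0"
    and \<eta>: "\<eta> \<in> punctured E" "proj E \<eta> \<in> fst c" "snd c (proj E \<eta>) \<in> ball x0 \<delta>" for \<xi> \<eta>
  proof -
    define x1 where "x1 = snd c (proj E \<eta>)"
    have x1: "x1 \<in> cdom c t" and ci1: "chart_inv c x1 = proj E \<eta>" using tr \<eta> c by (auto simp: x1_def)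
    obtain P where P: "linear P" "\<And>y. sqnorm c t (x1, P y) = sqnorm c t (x0, y)"
      "\<And>y. y \<noteq> 0 \<Longrightarrow> rgauge u c t (x1, P y) = rgauge u c t (x0, y)"
      using tr[OF \<eta>(3)] unfolding x1_def by blast
    let ?z0 = "chart_inv c x0" and ?z1 = "chart_inv c x1"
    have z: "?z0 \<in> fst c" "?z0 \<in> fst t" "snd c ?z0 = x0" "?z1 \<in> fst c" "?z1 \<in> fst t" "snd c ?z1 = x1"
      using domD[OF c x0] domD[OF c x1] by simp_all
    let ?ip0 = "\<lambda>v w. h (from_frame E t ?z0 v) (from_frame E t ?z0 w)"
    let ?ip1 = "\<lambda>v w. h (from_frame E t ?z1 v) (from_frame E t ?z1 w)"
    interpret i0: inner_form ?ip0 by (rule inner_form_hh[OF t z(2)])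
    interpret i1: inner_form ?ip1 by (rule inner_form_hh[OF t z(5)])
    have q0: "sqnorm c t (x0, y) = ?ip0 y y" and q1: "sqnorm c t (x1, y) = ?ip1 y y" for y
      using sqnorm_pt[OF c t, of "(x0, y)"] sqnorm_pt[OF c t, of "(x1, y)"] x0 x1 by (simp_all add: pt_def)
    have quad: "?ip1 (P v) (P v) = ?ip0 v v" for v using P(2)[of v] unfolding q0 q1 .
    \<comment> \<open>Polarisation: preservation of the quadratic form gives preservation of the
      inner product.\<close>
    have iso: "?ip1 (P v) (P w) = ?ip0 v w" for v w
    proof -
      have "?ip1 (P (v + w)) (P (v + w)) = ?ip0 (v + w) (v + w)" by (rule quad)
      then show ?thesis
        unfolding linear_add[OF P(1)] i0.ip_simps i1.ip_simps quad i0.ip_sym[of w v] i1.ip_sym[of "P w" "P v"] by simp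
    qed
    have inj: "inj P"
    proof (rule injI)
      fix v w assume "P v = P w"
      then have "P (v - w) = 0" by (simp add: linear_diff[OF P(1)])
      then have "?ip0 (v - w) (v - w) = 0" using quad[of "v - w"] i1.ip_simps(7) by simp
      then show "v = w" using i0.ip_eq_0 by simp
    qed
    then have bij: "bij P" using linear_inj_imp_surj[OF P(1)] by (simp add: bij_def)
    have P0: "P y \<noteq> 0" if "y \<noteq> 0" for y using that inj linear_0[OF P(1)] by (metis injD)
    interpret r0: radial_level "-{0}" "\<lambda>v. v" "\<lambda>y. rgauge u c t (x0, y)"
      using radial_level_fibre[OF c t u z(1,2)] unfolding z(3) .
    interpret r1: radial_level "-{0}" "\<lambda>v. v" "\<lambda>y. rgauge u c t (x1, y)"
      using radial_level_fibre[OF c t u z(4,5)] unfolding z(6) .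
    have S0: "snd t ` (graph u \<inter> fibre E ?z0) = r0.S" and S1: "snd t ` (graph u \<inter> fibre E ?z1) = r1.S"
      using fibre_graph[OF c t z(1,2), of u] fibre_graph[OF c t z(4,5), of u] unfolding r0.S_def r1.S_def z(3,6) by simp_all
    have PS: "P ` r0.S = r1.S"
    proof (intro equalityI subsetI)
      fix y assume y: "y \<in> r1.S"
      obtain v where v: "y = P v" using bij by (metis bij_pointE)
      have "v \<noteq> 0" using y v linear_0[OF P(1)] by (auto simp: r1.S_def)
      then have "v \<in> r0.S" using y v P(3) by (simp add: r0.S_def r1.S_def)
      then show "y \<in> P ` r0.S" using v by blast
    next
      fix w assume "w \<in> P ` r0.S"
      then obtain v where v: "w = P v" "v \<noteq> 0" "rgauge u c t (x0, v) = 1" by (auto simp: r0.S_def)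
      then show "w \<in> r1.S" using P(3)[OF v(2)] P0[OF v(2)] by (simp add: r1.S_def)
    qed
    \<comment> \<open>One point of the fibre suffices, because \<open>K\<close> is constant on
      fibres. An arbitrary nonzero vector, with \<open>undefined\<close> as an arbitrary index, is
      dilated by \<open>\<sigma>\<close> onto the graph.\<close>
    define e :: "real^'m" where "e = axis undefined 1"
    have e: "e \<in> -{0}" by (simp add: e_def)
    define \<sigma> where "\<sigma> = 1 / rgauge u c t (x0, e)"
    define y where "y = e + (\<sigma> - 1) *\<^sub>R e"
    have \<sigma>: "\<sigma> > 0" using r0.F_pos[OF e] by (simp add: \<sigma>_def)
    have "rgauge u c t (x0, y) = \<sigma> * rgauge u c t (x0, e)" unfolding y_def by (rule r0.F_scale[OF e \<sigma>])
    also have "\<dots> = 1" using r0.F_pos[OF e] by (simp add: \<sigma>_def)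
    finally have y: "y \<in> r0.S"
      using r0.scale_D[OF e \<sigma>] unfolding r0.S_def y_def by simp
    from y[folded S0] obtain \<xi>' where \<xi>': "\<xi>' \<in> graph u" "\<xi>' \<in> fibre E ?z0" "snd t \<xi>' = y" by blast
    have Py: "P y \<in> r1.S" using imageI[OF y, of P] by (simp only: PS)
    then have "P y \<in> snd t ` (graph u \<inter> fibre E ?z1)" by (simp only: S1)
    then obtain \<eta>' where "P y = snd t \<eta>'" "\<eta>' \<in> graph u \<inter> fibre E ?z1" by (rule imageE)
    then have \<eta>': "\<eta>' \<in> graph u" "\<eta>' \<in> fibre E ?z1" "snd t \<eta>' = P y" by simp_all
    have pr: "proj E \<xi>' = ?z0" "proj E \<eta>' = ?z1" using \<xi>'(2) \<eta>'(2) by (auto simp: fibre_iff)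
    have gc: "has_gauss_curvature (\<lambda>v w. h (from_frame E t (proj E \<zeta>) v) (from_frame E t (proj E \<zeta>) w))
      (snd t ` (graph u \<inter> fibre E (proj E \<zeta>))) (snd t \<zeta>) (K \<zeta>)" if "\<zeta> \<in> graph u" "proj E \<zeta> \<in> fst t" for \<zeta>
      using vc t that unfolding vertical_curvature_given_by_def Let_def by blast
    have "has_gauss_curvature ?ip0 r0.S y (K \<xi>')"
      using gc[OF \<xi>'(1)] z(2) unfolding pr \<xi>'(3) S0 by blast
    from gauss_curvature_isometry[where ip'="?ip1", OF P(1) bij iso this]
    have "has_gauss_curvature ?ip1 r1.S (P y) (K \<xi>')" unfolding PS .
    moreover have "has_gauss_curvature ?ip1 r1.S (P y) (K \<eta>')"
      using gc[OF \<eta>'(1)] z(5) unfolding pr \<eta>'(3) S1 by blast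
    \<comment> \<open>The differential of \<open>rgauge\<close> on the fibre is such a functional;
      it equals 1 on the position vector by Euler's identity.\<close>
    moreover have "\<exists>f :: real^'m \<Rightarrow> real. linear f \<and> f v \<noteq> 0 \<and> tangent_space r1.S v = {w. f w = 0}" if v: "v \<in> r1.S" for v
    proof -
      have v': "v \<in> -{0}" "rgauge u c t (x1, v) = 1" using v by (auto simp: r1.S_def)
      show ?thesis
        using r1.tangent_space_S[OF v] r1.linear_dF[OF v'(1)] r1.dF_radial[OF v'(1)] v'(2) by (metis zero_neq_one)
    qed
    ultimately have "K \<xi>' = K \<eta>'"
      using i1.gauss_curvature_unique[OF _ Py] by blast
    moreover have "K \<xi>' = K \<xi>" using \<xi> \<xi>'(1) pr graph_iff by (intro K_fibre) auto
    moreover have "K \<eta>' = K \<eta>" using \<eta> \<eta>'(1) pr ci1 graph_iff by (intro K_fibre) auto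
    ultimately show ?thesis by simp
  qed
  with \<delta> show ?thesis by blast
qed

text \<open>Since \<open>K\<close> is constant on fibres, it descends to the base, where it is
  locally constant; connectedness then makes it constant.\<close>

lemma convex_imp_curvature_constant:
  assumes cpt: "compact_space X" and con: "connected_space X"
    and u: "smooth_sphere u" and conv: "convex_graph \<A> g \<Gamma> E h \<omega> (graph u)"
    and vc: "vertical_curvature_given_by E h (graph u) K"
    and K_fibre: "\<And>\<xi> \<eta>. \<xi> \<in> punctured E \<Longrightarrow> \<eta> \<in> punctured E \<Longrightarrow> proj E \<xi> = proj E \<eta> \<Longrightarrow> K \<xi> = K \<eta>"
  shows "K constant_on punctured E"
proof (cases "punctured E = {}")
  case True
  then show ?thesis by (simp add: constant_on_def)
next
  case False
  then obtain \<xi>0 where \<xi>0: "\<xi>0 \<in> punctured E" by blast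
  have pT: "proj E \<xi> \<in> topspace X" if "\<xi> \<in> punctured E" for \<xi>
    using that proj_topspace by (simp add: punctured_def)
  \<comment> \<open>Every fibre contains a nonzero vector, so the condition that defines
    \<open>A\<close> below is never vacuous.\<close>
  have ex: "\<exists>\<xi>\<in>punctured E. proj E \<xi> = x" if x: "x \<in> topspace X" for x
  proof -
    obtain t where t: "t \<in> trivs E" "x \<in> fst t" using triv_exists[OF x] by blast
    have "from_frame E t x (axis undefined 1) \<noteq> vzero E x" using from_frame_0[OF t] by (simp add: axis_eq_0_iff)
    then show ?thesis using from_frame_in[OF t, of "axis undefined 1"]
      by (intro bexI[of _ "from_frame E t x (axis undefined 1)"]) (auto simp: punctured_def fibre_iff)
  qed
  have loc: "\<exists>U. openin X U \<and> x \<in> U \<and> (\<forall>\<xi>\<in>punctured E. \<forall>\<eta>\<in>punctured E. proj E \<xi> = x \<longrightarrow> proj E \<eta> \<in> U \<longrightarrow> K \<xi> = K \<eta>)"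
    if x: "x \<in> topspace X" for x
  proof -
    obtain c t where c: "c \<in> \<A>" and t: "t \<in> trivs E" and xc: "x \<in> fst c" "x \<in> fst t"
      using chart_exists[OF x] triv_exists[OF x] by blast
    have d: "snd c x \<in> cdom c t" using xc by auto
    obtain \<delta> where "\<delta> > 0" and \<delta>: "\<forall>\<xi>\<in>punctured E. \<forall>\<eta>\<in>punctured E. proj E \<xi> = chart_inv c (snd c x) \<longrightarrow>
      proj E \<eta> \<in> fst c \<longrightarrow> snd c (proj E \<eta>) \<in> ball (snd c x) \<delta> \<longrightarrow> K \<xi> = K \<eta>"
      using curvature_locally_constant[OF u c t d convex_horizontally_constant[OF cpt u conv c t] vc K_fibre] by blast
    show ?thesis
    proof (intro exI conjI)
      show "openin X {z \<in> fst c. snd c z \<in> ball (snd c x) \<delta>}" by (rule chart_preimage_openin[OF c open_ball])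
      show "x \<in> {z \<in> fst c. snd c z \<in> ball (snd c x) \<delta>}" using xc \<open>\<delta> > 0\<close> by simp
    qed (use \<delta> xc c in auto)
  qed
  define A where "A = {x \<in> topspace X. \<forall>\<xi>\<in>punctured E. proj E \<xi> = x \<longrightarrow> K \<xi> = K \<xi>0}"
  \<comment> \<open>Membership in \<open>A\<close> is locally constant, which gives openness of
    \<open>A\<close> and of its complement at once.\<close>
  have locA: "\<exists>U. openin X U \<and> x \<in> U \<and> (\<forall>z\<in>U. z \<in> A \<longleftrightarrow> x \<in> A)" if x: "x \<in> topspace X" for x
  proof -
    obtain U where U: "openin X U" "x \<in> U"
      and KU: "\<And>\<xi> \<eta>. \<xi> \<in> punctured E \<Longrightarrow> \<eta> \<in> punctured E \<Longrightarrow> proj E \<xi> = x \<Longrightarrow> proj E \<eta> \<in> U \<Longrightarrow> K \<xi> = K \<eta>"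
      using loc[OF x] by blast
    obtain \<xi> where \<xi>: "\<xi> \<in> punctured E" "proj E \<xi> = x" using ex[OF x] by blast
    have "z \<in> A \<longleftrightarrow> K \<xi> = K \<xi>0" if z: "z \<in> U" for z
    proof -
      have zX: "z \<in> topspace X" using U(1) z openin_subset by blast
      obtain \<eta> where \<eta>: "\<eta> \<in> punctured E" "proj E \<eta> = z" using ex[OF zX] by blast
      have "K \<eta>' = K \<xi>" if "\<eta>' \<in> punctured E" "proj E \<eta>' = z" for \<eta>' using KU[OF \<xi>(1) that(1) \<xi>(2)] that z by simp
      then show ?thesis using zX \<eta> unfolding A_def by auto
    qed
    then show ?thesis using U by blast
  qed
  have "openin X A"
  proof (subst openin_subopen, intro ballI)
    fix x assume "x \<in> A"
    then show "\<exists>T. openin X T \<and> x \<in> T \<and> T \<subseteq> A" using locA[of x] unfolding A_def by blast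
  qed
  moreover have "openin X (topspace X - A)"
  proof (subst openin_subopen, intro ballI)
    fix x assume x: "x \<in> topspace X - A"
    then obtain U where "openin X U" "x \<in> U" "\<forall>z\<in>U. z \<notin> A" using locA[of x] by blast
    then show "\<exists>T. openin X T \<and> x \<in> T \<and> T \<subseteq> topspace X - A" using openin_subset by blast
  qed
  ultimately have "A = {} \<or> A = topspace X"
    using con unfolding connected_space_clopen_in closedin_def using openin_subset by blast
  moreover have "proj E \<xi>0 \<in> A" using pT[OF \<xi>0] K_fibre[OF _ \<xi>0] unfolding A_def by blast
  ultimately have "A = topspace X" by blast
  then have "K \<xi> = K \<xi>0" if "\<xi> \<in> punctured E" for \<xi> using that pT unfolding A_def by blast
  then show ?thesis by (auto simp: constant_on_def)
qed

end

text \<open>The last claim concerns a connected base. On a disconnected one \<open>K\<close> may be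
  locally constant without being constant, and its sphere bundle graph is still convex, since the
  computation in \<open>graph_const_convex\<close> is local over the base.\<close>

theorem theorem1:
  fixes X :: "'a topology"
    and \<A> :: "('a, 'n::finite) chart set"
    and g :: "('a, 'n) tensor2"
    and \<Gamma> :: "('a, 'n) christoffel"
    and E :: "('a, 'e, 'm::finite) vbundle"
    and h :: "'e \<Rightarrow> 'e \<Rightarrow> real"
    and \<omega> :: "('a, 'n, 'e, 'm) bundle_christoffel"
    and K :: "'e \<Rightarrow> real"
  assumes "smooth_manifold X \<A>"
    and "compact_space X"
    and "riemannian_metric \<A> g"
    and "levi_civita \<A> g \<Gamma>"
    and "vector_bundle X \<A> E"
    and "CARD('m) \<ge> 2"
    and "fibre_metric X \<A> E h"
    and "metric_connection \<A> E h \<omega>"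
    and "smooth_on_total \<A> E (punctured E) K"
    and "\<And>\<xi>. \<xi> \<in> punctured E \<Longrightarrow> K \<xi> > 0"
    and "\<And>\<xi> \<eta>. \<xi> \<in> punctured E \<Longrightarrow> \<eta> \<in> punctured E \<Longrightarrow> proj E \<xi> = proj E \<eta> \<Longrightarrow> K \<xi> = K \<eta>"
  shows "(\<exists>Y. radial_graph \<A> E h Y \<and> vertical_curvature_given_by E h Y K) \<and>
    (K constant_on punctured E \<longrightarrow>
       (\<exists>Y. radial_graph \<A> E h Y \<and> vertical_curvature_given_by E h Y K \<and>
            convex_graph \<A> g \<Gamma> E h \<omega> Y)) \<and>
    (connected_space X \<longrightarrow> \<not> K constant_on punctured E \<longrightarrow>
       (\<forall>Y. radial_graph \<A> E h Y \<and> vertical_curvature_given_by E h Y K \<longrightarrow>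
            \<not> convex_graph \<A> g \<Gamma> E h \<omega> Y))"
proof -
  interpret metric_bundle X \<A> g \<Gamma> E h \<omega>
    using assms(1,3,4,5,7,8) by (rule metric_bundle.intro)
  define u where "u \<xi> = - ln (K \<xi>) / real (CARD('m) - 1)" for \<xi>
  have "smooth_on_total \<A> E (punctured E) u"
    unfolding smooth_on_total_def
  proof (intro ballI)
    fix c t assume c: "c \<in> \<A>" and t: "t \<in> trivs E"
    let ?i = "inv_into (edom E c t) (ecoord E c t)"
    have K: "smooth_on (in_ecoord E c t (punctured E)) (\<lambda>q. K (?i q))"
      using assms(9) c t unfolding smooth_on_total_def o_def by blast
    have "K (?i q) > 0" if "q \<in> in_ecoord E c t (punctured E)" for q
      using that assms(10) inv_ecoord[OF c t, of q] unfolding in_ecoord_iff[OF c t] by simp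
    then have "smooth_on (in_ecoord E c t (punctured E)) (\<lambda>q. - ln (K (?i q)) / real (CARD('m) - 1))"
      using assms(6) by (intro smooth_on_divide smooth_on_uminus smooth_on_ln K smooth_on_const) auto
    then show "smooth_on (in_ecoord E c t (punctured E)) (u \<circ> ?i)"
      unfolding o_def u_def .
  qed
  then have u: "smooth_sphere u"
    by (rule smooth_on_total_subset) (use sphere_punctured in blast)
  then have rg: "radial_graph \<A> E h (graph u)" using radial_graph_iff by blast
  have vc: "vertical_curvature_given_by E h (graph u) K"
    by (rule graph_sphere_curvature[OF u assms(10,11,6)]) (simp_all add: u_def)
  have conv: "convex_graph \<A> g \<Gamma> E h \<omega> (graph u)" if K: "K constant_on punctured E"
  proof -
    obtain k where k: "\<And>\<xi>. \<xi> \<in> punctured E \<Longrightarrow> K \<xi> = k" using K by (auto simp: constant_on_def)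
    show ?thesis
      by (rule graph_const_convex[OF u, of "- ln k / real (CARD('m) - 1)"])
        (use k sphere_punctured in \<open>simp add: u_def\<close>)
  qed
  have "K constant_on punctured E"
    if con: "connected_space X" and Y: "radial_graph \<A> E h Y" "vertical_curvature_given_by E h Y K"
      "convex_graph \<A> g \<Gamma> E h \<omega> Y" for Y
  proof -
    obtain v where v: "smooth_sphere v" "Y = graph v" using Y(1) radial_graph_iff by blast
    show ?thesis
      by (rule convex_imp_curvature_constant[OF assms(2) con v(1) Y(3)[unfolded v(2)] Y(2)[unfolded v(2)] assms(11)])
  qed
  with rg vc conv show ?thesis by blast
qed

end
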